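(* Let $n>2$ and let $\mathcal{P}$ be a convex polytope of dimension $n$. If every facet of $\mathcal{P}$ is centrally symmetric, then $\mathcal{P}$ is centrally symmetric.
   Context: A set $X\subset\mathbb{R}^N$ is centrally symmetric if there exists $\boldsymbol{c}\in\mathbb{R}^N$ such that $X=2\boldsymbol{c}-X$, where $2\boldsymbol{c}-X=\{2\boldsymbol{c}-\boldsymbol{x}\mid \boldsymbol{x}\in X\}$. A convex polytope is the convex hull of a finite set of points; a facet of an $n$-dimensional polytope is a face of dimension $n-1$. *)

theory Defs
  imports "HOL-Analysis.Analysis"
begin

definition centrally_symmetric :: "'a::real_vector set \<Rightarrow> bool" where
  "centrally_symmetric X \<longleftrightarrow> (\<exists>c. X = {2 *\<^sub>R c - x | x. x \<in> X})"

end

theory Submission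
  imports Defs
begin

text \<open>Let \<open>V\<close> be the vertex set of \<open>P\<close> and \<open>V\<^sub>u\<close> the vertices maximising the inner product with \<open>u\<close>;
  write \<open>\<doteq>\<close> for equality up to translation. The proof compares \<open>V\<^sub>u\<close> with \<open>(- V)\<^sub>u = - V\<^bsub>- u\<^esub>\<close> while \<open>u\<close>
  runs through a great circle: a face changes only where \<open>u\<close> meets a larger face, and when that
  one is a centrally symmetric facet, its faces on the two sides are reflections of each other. Around
  the circle perpendicular to a ridge \<open>R\<close> one therefore meets only translates of \<open>R\<close> and \<open>- R\<close>.
  Hence facet normals come in opposite pairs, and the facets \<open>F = V\<^sub>v\<close> and \<open>G = (- V)\<^sub>v\<close> have ridges that agree up
  to translation and sign. A second walk shows that a ridge \<open>K\<close> of \<open>F\<close> whose sign disagrees again has only facets \<open>X\<close>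
  that are centrally symmetric or lie opposite to a translate of \<open>- X\<close>. So the assertion,
  stated for polytopes with this weaker property, reduces from dimension \<open>n\<close> to dimension \<open>n - 2\<close>. Odd \<open>n\<close> end at
  segments. The reduction from 4 to 2 fails, since polygons need not be symmetric; in dimension 4
  the directions of the edges that differ in \<open>F\<close> and \<open>G\<close> form, in a projective plane, a finite set of points
  such that each line through two of them contains a third one. By the Sylvester--Gallai theorem they are
  collinear, but they occur in facets with different normals.\<close>

section \<open>Faces of finite sets in a given direction\<close>

text \<open>What can be compared are \<open>V\<close> and \<open>- V\<close>, and a half turn
  exchanges their roles, because \<open>tface (neg V) u = neg (tface V (- u))\<close>. Several
  contradictions arise this way: a relation between faces of the two sets is carried from
  \<open>u\<close> to \<open>- u\<close> and is there read with the sets exchanged, which clashes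
  with the start. The state carried along is not the face at \<open>p\<close> but the one-sided
  limit \<open>tface (tface V p) r\<close>; crossing a larger face then is the single passage
  between \<open>r\<close> and \<open>- r\<close>, and local constancy on a segment replaces any
  list of critical directions. Polygons cannot end the descent, since their edges are symmetric and
  the weakened property holds for free. In dimension 4 their asymmetry is used positively: an
  asymmetric polygon differs from its reflection in at least three edge directions, which gives the
  third point on each line.\<close>

definition tface :: "'a::euclidean_space set \<Rightarrow> 'a \<Rightarrow> 'a set" where
  "tface V u = {x \<in> V. \<forall>y\<in>V. u \<bullet> y \<le> u \<bullet> x}"

definition dirs :: "'a::euclidean_space set \<Rightarrow> 'a set" where
  "dirs V = span {x - y |x y. x \<in> V \<and> y \<in> V}"

definition ddim :: "'a::euclidean_space set \<Rightarrow> nat" where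
  "ddim V = dim (dirs V)"

definition translate_of :: "'a::euclidean_space set \<Rightarrow> 'a set \<Rightarrow> bool"  (infix "\<doteq>" 50) where
  "A \<doteq> B \<longleftrightarrow> (\<exists>t. B = (+) t ` A)"

abbreviation neg :: "'a::euclidean_space set \<Rightarrow> 'a set" where
  "neg A \<equiv> uminus ` A"

text \<open>Each point is the unique maximiser of some functional, so \<open>V\<close> is the vertex
  set of its convex hull. The argument runs on such finite sets; polytopes enter only at the
  end.\<close>

definition exposed_points :: "'a::euclidean_space set \<Rightarrow> bool" where
  "exposed_points V \<longleftrightarrow> finite V \<and> V \<noteq> {} \<and> (\<forall>x\<in>V. \<exists>u. tface V u = {x})"

lemma tface_subset: "tface V u \<subseteq> V"
  by (auto simp: tface_def)

lemma finite_tface: "finite V \<Longrightarrow> finite (tface V u)"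
  using finite_subset[OF tface_subset] .

lemma tface_nonempty:
  assumes "finite V" "V \<noteq> {}" shows "tface V u \<noteq> {}"
proof -
  let ?M = "Max ((\<lambda>y. u \<bullet> y) ` V)"
  have "?M \<in> (\<lambda>y. u \<bullet> y) ` V" using assms by (intro Max_in) auto
  then obtain x where x: "x \<in> V" "u \<bullet> x = ?M" by auto
  have "\<forall>y\<in>V. u \<bullet> y \<le> u \<bullet> x" using assms x by auto
  then show ?thesis using x by (auto simp: tface_def)
qed

text \<open>For small positive \<open>t\<close> maximisation is lexicographic: strict inequalities
  for \<open>u\<close> survive the perturbation and ties are decided by \<open>w\<close>. Finiteness
  gives one bound on \<open>t\<close> for all pairs of points.\<close>

lemma tface_germ:
  assumes "finite V"
  shows "\<forall>\<^sub>F t in at_right 0. tface V (u + t *\<^sub>R w) = tface (tface V u) w"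
proof (cases "V = {}")
  case True then show ?thesis by (simp add: tface_def)
next
  case False
  have "\<forall>\<^sub>F t in at_right 0. \<forall>x\<in>V. \<forall>y\<in>V. u \<bullet> y < u \<bullet> x \<longrightarrow> (u + t *\<^sub>R w) \<bullet> y < (u + t *\<^sub>R w) \<bullet> x"
  proof (intro eventually_ball_finite[OF assms] ballI)
    fix x y assume "x \<in> V" "y \<in> V"
    have "((\<lambda>t. (u + t *\<^sub>R w) \<bullet> x - (u + t *\<^sub>R w) \<bullet> y) \<longlongrightarrow> (u + 0 *\<^sub>R w) \<bullet> x - (u + 0 *\<^sub>R w) \<bullet> y) (at_right 0)"
      by (intro tendsto_intros)
    then have "u \<bullet> y < u \<bullet> x \<Longrightarrow> \<forall>\<^sub>F t in at_right 0. 0 < (u + t *\<^sub>R w) \<bullet> x - (u + t *\<^sub>R w) \<bullet> y"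
      by (rule order_tendstoD(1)) simp
    then show "\<forall>\<^sub>F t in at_right 0. u \<bullet> y < u \<bullet> x \<longrightarrow> (u + t *\<^sub>R w) \<bullet> y < (u + t *\<^sub>R w) \<bullet> x"
      by (cases "u \<bullet> y < u \<bullet> x") simp_all
  qed
  moreover have "\<forall>\<^sub>F t::real in at_right 0. 0 < t" by (simp add: eventually_at_right_less)
  ultimately show ?thesis
  proof eventually_elim
    case (elim t)
    have key: "(u + t *\<^sub>R w) \<bullet> y \<le> (u + t *\<^sub>R w) \<bullet> x \<longleftrightarrow> w \<bullet> y \<le> w \<bullet> x" if "u \<bullet> x = u \<bullet> y" for x y
      using that elim(2) by (simp add: inner_add_left)
    obtain m where m: "m \<in> tface V u" using tface_nonempty[OF assms False] by blast
    show ?case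
    proof (intro equalityI subsetI)
      fix x assume x: "x \<in> tface V (u + t *\<^sub>R w)"
      then have "x \<in> V" by (simp add: tface_def)
      have mV: "m \<in> V" "\<And>y. y \<in> V \<Longrightarrow> u \<bullet> y \<le> u \<bullet> m" using m by (simp_all add: tface_def)
      have "(u + t *\<^sub>R w) \<bullet> m \<le> (u + t *\<^sub>R w) \<bullet> x" using x mV by (simp add: tface_def)
      then have "u \<bullet> m \<le> u \<bullet> x" using elim(1) \<open>x \<in> V\<close> mV by (meson not_le)
      then have ux: "x \<in> tface V u" using mV \<open>x \<in> V\<close> by (auto simp: tface_def intro: order_trans)
      have "w \<bullet> y \<le> w \<bullet> x" if y: "y \<in> tface V u" for y
      proof -
        have "u \<bullet> x = u \<bullet> y" using ux y by (intro order_antisym) (simp_all add: tface_def)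
        moreover have "(u + t *\<^sub>R w) \<bullet> y \<le> (u + t *\<^sub>R w) \<bullet> x" using x y by (simp add: tface_def)
        ultimately show ?thesis using key by simp
      qed
      then show "x \<in> tface (tface V u) w" using ux by (simp add: tface_def[of "tface V u"])
    next
      fix x assume x: "x \<in> tface (tface V u) w"
      then have ux: "x \<in> tface V u" by (simp add: tface_def)
      have "(u + t *\<^sub>R w) \<bullet> y \<le> (u + t *\<^sub>R w) \<bullet> x" if y: "y \<in> V" for y
      proof (cases "u \<bullet> y < u \<bullet> x")
        case True then show ?thesis using elim(1) y ux tface_subset by (meson less_imp_le subsetD)
      next
        case False
        have uV: "x \<in> V" "\<And>y. y \<in> V \<Longrightarrow> u \<bullet> y \<le> u \<bullet> x" using ux by (simp_all add: tface_def)
        then have eq: "u \<bullet> x = u \<bullet> y" using False y by (simp add: order_antisym)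
        then have "y \<in> tface V u" using uV y by (simp add: tface_def)
        then have "w \<bullet> y \<le> w \<bullet> x" using x by (simp add: tface_def[of "tface V u"])
        then show ?thesis using key[OF eq] by simp
      qed
      then show "x \<in> tface V (u + t *\<^sub>R w)" using ux tface_subset[of V u] by (auto simp: tface_def[of V "u + t *\<^sub>R w"])
    qed
  qed
qed

section \<open>Translates, reflections and direction spaces\<close>

lemma translate_of_refl [simp]: "A \<doteq> A"
  unfolding translate_of_def by (rule exI[of _ 0]) simp

lemma translate_of_sym: assumes "A \<doteq> B" shows "B \<doteq> A"
proof -
  obtain t where "B = (+) t ` A" using assms by (auto simp: translate_of_def)
  then have "A = (+) (- t) ` B" by (simp add: image_image)
  then show ?thesis unfolding translate_of_def by blast
qed

lemma translate_of_commute: "A \<doteq> B \<longleftrightarrow> B \<doteq> A"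
  using translate_of_sym by blast

lemma translate_of_trans [trans]: assumes "A \<doteq> B" "B \<doteq> C" shows "A \<doteq> C"
proof -
  obtain t t' where "B = (+) t ` A" "C = (+) t' ` B" using assms by (auto simp: translate_of_def)
  then have "C = (+) (t' + t) ` A" by (simp add: image_image add.assoc)
  then show ?thesis unfolding translate_of_def by blast
qed

lemma neg_neg [simp]: "neg (neg A) = A"
  by (simp add: image_image)

lemma neg_translate: "neg ((+) t ` A) = (+) (- t) ` neg A"
  unfolding image_image by (rule image_cong) simp_all

lemma translate_of_neg: "neg A \<doteq> neg B \<longleftrightarrow> A \<doteq> B"
proof -
  have "neg A \<doteq> neg B" if "A \<doteq> B" for A B :: "'a set"
    using that neg_translate unfolding translate_of_def by blast
  from this[of A B] this[of "neg A" "neg B"] show ?thesis by auto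
qed

lemma translate_of_neg': "neg A \<doteq> B \<longleftrightarrow> A \<doteq> neg B"
  using translate_of_neg[of A "neg B"] by simp

lemma tface_translate: "tface ((+) t ` A) u = (+) t ` tface A u"
  by (auto simp: tface_def inner_add_right)

lemma tface_neg: "tface (neg A) u = neg (tface A (- u))"
  by (auto simp: tface_def)

lemma translate_of_tface: "A \<doteq> B \<Longrightarrow> tface A u \<doteq> tface B u"
  unfolding translate_of_def using tface_translate by blast

lemma dirs_translate: "dirs ((+) t ` A) = dirs A"
proof -
  have "{x - y |x y. x \<in> (+) t ` A \<and> y \<in> (+) t ` A} = {(t + x) - (t + y) |x y. x \<in> A \<and> y \<in> A}"
    by blast
  then show ?thesis by (simp add: dirs_def)
qed

lemma dirs_neg [simp]: "dirs (neg A) = dirs A"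
proof -
  have "{x - y |x y. x \<in> neg A \<and> y \<in> neg A} = {- x - (- y) |x y. x \<in> A \<and> y \<in> A}"
    by blast
  also have "\<dots> = {y - x |x y. x \<in> A \<and> y \<in> A}" by simp
  also have "\<dots> = {x - y |x y. x \<in> A \<and> y \<in> A}" by blast
  finally show ?thesis by (simp add: dirs_def)
qed

lemma ddim_neg [simp]: "ddim (neg A) = ddim A"
  by (simp add: ddim_def)

lemma translate_of_dirs: "A \<doteq> B \<Longrightarrow> dirs A = dirs B"
  unfolding translate_of_def using dirs_translate by blast

lemma translate_of_ddim: "A \<doteq> B \<Longrightarrow> ddim A = ddim B"
  using translate_of_dirs[of A B] by (simp add: ddim_def)

lemma subspace_dirs [simp]: "subspace (dirs A)"
  by (simp add: dirs_def)

lemma diff_in_dirs: "x \<in> A \<Longrightarrow> y \<in> A \<Longrightarrow> x - y \<in> dirs A"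
  unfolding dirs_def by (rule span_base) auto

lemma dirs_mono: "A \<subseteq> B \<Longrightarrow> dirs A \<subseteq> dirs B"
  unfolding dirs_def by (rule span_mono) auto

lemma dirs_tface_subset: "dirs (tface A u) \<subseteq> dirs A"
  by (simp add: dirs_mono tface_subset)

lemma orth_dirs_iff: "(\<forall>x\<in>dirs A. w \<bullet> x = 0) \<longleftrightarrow> (\<forall>x\<in>A. \<forall>y\<in>A. w \<bullet> x = w \<bullet> y)"
proof
  assume "\<forall>x\<in>dirs A. w \<bullet> x = 0"
  then have "w \<bullet> x - w \<bullet> y = 0" if "x \<in> A" "y \<in> A" for x y
    using diff_in_dirs[OF that] by (metis inner_diff_right)
  then show "\<forall>x\<in>A. \<forall>y\<in>A. w \<bullet> x = w \<bullet> y" by (metis eq_iff_diff_eq_0)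
next
  assume *: "\<forall>x\<in>A. \<forall>y\<in>A. w \<bullet> x = w \<bullet> y"
  show "\<forall>x\<in>dirs A. w \<bullet> x = 0"
  proof
    fix x assume "x \<in> dirs A"
    then show "w \<bullet> x = 0" unfolding dirs_def
    proof (induction rule: span_induct)
      case base then show ?case using subspace_hyperplane[of w] by simp
    next
      case (step x)
      then obtain a b where "a \<in> A" "b \<in> A" and x: "x = a - b" by blast
      then have "w \<bullet> a = w \<bullet> b" using * by blast
      with x show ?case by (simp add: inner_diff_right)
    qed
  qed
qed

lemma tface_orth: "x \<in> dirs (tface A u) \<Longrightarrow> u \<bullet> x = 0"
proof -
  assume x: "x \<in> dirs (tface A u)"
  have "\<forall>x\<in>tface A u. \<forall>y\<in>tface A u. u \<bullet> x = u \<bullet> y"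
    unfolding tface_def by (auto intro!: order_antisym)
  with x orth_dirs_iff[of "tface A u" u] show "u \<bullet> x = 0" by blast
qed

lemma tface_add_orth:
  assumes "\<forall>x\<in>dirs A. w \<bullet> x = 0" shows "tface A (u + w) = tface A u"
proof -
  have "(u + w) \<bullet> y \<le> (u + w) \<bullet> x \<longleftrightarrow> u \<bullet> y \<le> u \<bullet> x" if "x \<in> A" "y \<in> A" for x y
  proof -
    have "w \<bullet> x = w \<bullet> y" using assms that unfolding orth_dirs_iff by blast
    then show ?thesis by (simp add: inner_add_left)
  qed
  then show ?thesis unfolding tface_def by blast
qed

lemma tface_orth_eq:
  assumes "\<forall>x\<in>dirs A. w \<bullet> x = 0" shows "tface A w = A"
proof -
  have "\<forall>x\<in>A. \<forall>y\<in>A. w \<bullet> x = w \<bullet> y" using assms orth_dirs_iff[of A w] by blast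
  then have "w \<bullet> y \<le> w \<bullet> x" if "x \<in> A" "y \<in> A" for x y using that by (metis order_refl)
  then show ?thesis unfolding tface_def by blast
qed

lemma tface_scale: "c > 0 \<Longrightarrow> tface A (c *\<^sub>R u) = tface A u"
  by (simp add: tface_def)

lemma ddim_tface_less:
  assumes "u \<in> dirs A" "u \<noteq> 0" shows "ddim (tface A u) < ddim A"
proof -
  have "u \<notin> dirs (tface A u)" using tface_orth[of u A u] assms by auto
  then have "dirs (tface A u) \<subset> dirs A" using dirs_tface_subset[of A u] assms(1) by auto
  then show ?thesis unfolding ddim_def
    using dim_psubset[of "dirs (tface A u)" "dirs A"] by (simp add: span_eq_iff[THEN iffD2])
qed

lemma dirs_eq_of_ddim:
  assumes "dirs A \<subseteq> dirs B" "ddim B \<le> ddim A" shows "dirs A = dirs B"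
  using subspace_dim_equal[OF subspace_dirs subspace_dirs assms(1)] assms(2) by (simp add: ddim_def)

text \<open>A face of full dimension forces \<open>r\<close> to be constant on \<open>A\<close>.
  Along a walk this is the case in which nothing changes.\<close>

lemma tface_flat:
  assumes "ddim A \<le> ddim (tface A r)" shows "tface A r = A" "tface A (- r) = A"
proof -
  have "dirs (tface A r) = dirs A" by (rule dirs_eq_of_ddim[OF dirs_tface_subset assms])
  then have "\<forall>x\<in>dirs A. r \<bullet> x = 0" using tface_orth[of _ A r] by simp
  then show "tface A r = A" "tface A (- r) = A"
    using tface_orth_eq[of A r] tface_orth_eq[of A "- r"] by simp_all
qed

lemma dirs_facet:
  assumes "u \<in> dirs A" "u \<noteq> 0" "Suc (ddim (tface A u)) = ddim A" "x \<in> dirs A" "u \<bullet> x = 0"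
  shows "x \<in> dirs (tface A u)"
proof -
  let ?H = "{x \<in> dirs A. u \<bullet> x = 0}"
  have "?H = dirs A \<inter> {x. u \<bullet> x = 0}" by auto
  then have sH: "subspace ?H"
    using subspace_inter[OF subspace_dirs[of A] subspace_hyperplane[of u]] by simp
  have "u \<notin> ?H" using assms(2) by simp
  then have "?H \<subset> dirs A" using assms(1) by blast
  then have "dim ?H < ddim A" unfolding ddim_def
    using dim_psubset[of ?H "dirs A"] sH by (simp add: span_eq_iff[THEN iffD2])
  moreover have sub: "dirs (tface A u) \<subseteq> ?H"
    using tface_orth[of _ A u] dirs_tface_subset[of A u] by auto
  ultimately have "dirs (tface A u) = ?H"
    using subspace_dim_equal[OF subspace_dirs sH sub] assms(3) by (simp add: ddim_def)
  then show ?thesis using assms by simp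
qed

lemma orth_exists:
  fixes S :: "'a::euclidean_space set"
  assumes "subspace S" "T \<subseteq> S" "dim T < dim S"
  obtains w where "w \<in> S" "w \<noteq> 0" "\<And>x. x \<in> T \<Longrightarrow> w \<bullet> x = 0"
proof -
  have "span T \<noteq> span S" using assms(3) by (metis dim_span less_irrefl)
  then have "span T \<subset> span S" using span_mono[OF assms(2)] by blast
  then obtain w where w: "w \<noteq> 0" "w \<in> span S" "\<And>y. y \<in> span T \<Longrightarrow> orthogonal w y"
    using orthogonal_to_subspace_exists_gen[of T S] by auto
  moreover have "span S = S" using assms(1) by (simp add: span_eq_iff)
  ultimately show thesis using that[of w] by (simp add: orthogonal_def span_base)
qed

text \<open>Codimension at least two leaves room for a second direction: if \<open>u\<close> is
  orthogonal to \<open>dirs B\<close>, then \<open>u\<close> and \<open>w\<close> span the plane of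
  a great circle perpendicular to \<open>B\<close>.\<close>

lemma orth_dirs_exists:
  assumes "u \<in> dirs A" "B \<subseteq> A" "Suc (ddim B) < ddim A"
  obtains w where "w \<in> dirs A" "w \<noteq> 0" "w \<bullet> u = 0" "\<And>x. x \<in> dirs B \<Longrightarrow> w \<bullet> x = 0"
proof -
  have "dim (insert u (dirs B)) < dim (dirs A)"
    using assms(3) by (simp add: dim_insert ddim_def split: if_splits)
  then obtain w where "w \<in> dirs A" "w \<noteq> 0" "\<And>x. x \<in> insert u (dirs B) \<Longrightarrow> w \<bullet> x = 0"
    using orth_exists[of "dirs A" "insert u (dirs B)"] assms(1) dirs_mono[OF assms(2)] by auto
  then show thesis using that by blast
qed

section \<open>Travelling along great circles\<close>

lemma tface_tface_eq2:
  assumes "finite V" "finite W"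
  shows "\<exists>e>0. \<forall>t. 0 < t \<and> t < e \<longrightarrow>
    tface V (u + t *\<^sub>R w) = tface (tface V u) w \<and> tface W (u + t *\<^sub>R w) = tface (tface W u) w"
proof -
  have "\<forall>\<^sub>F t in at_right 0.
    tface V (u + t *\<^sub>R w) = tface (tface V u) w \<and> tface W (u + t *\<^sub>R w) = tface (tface W u) w"
    using tface_germ[OF assms(1)] tface_germ[OF assms(2)] by (rule eventually_conj)
  then show ?thesis using eventually_at_right[of "0::real" 1] by auto
qed

text \<open>\<open>Q\<close> is arbitrary, so nothing monotone is at hand. But the faces just after
  and just before a point are constant near it on either side, and \<open>step\<close> glues the two
  sides; a locally constant value on an open interval is constant.\<close>

lemma segment_propagate:
  fixes Q :: "'a::euclidean_space set \<Rightarrow> 'a set \<Rightarrow> bool"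
  assumes fin: "finite V" "finite W"
    and step: "\<And>t. 0 < t \<Longrightarrow> t < 1 \<Longrightarrow>
      Q (tface (tface V (a + t *\<^sub>R d)) d) (tface (tface W (a + t *\<^sub>R d)) d) \<longleftrightarrow>
      Q (tface (tface V (a + t *\<^sub>R d)) (- d)) (tface (tface W (a + t *\<^sub>R d)) (- d))"
  shows "Q (tface (tface V a) d) (tface (tface W a) d) \<longleftrightarrow>
    Q (tface (tface V (a + d)) (- d)) (tface (tface W (a + d)) (- d))"
proof -
  \<comment> \<open>\<open>q\<close> is the value at a point, \<open>R\<close> and \<open>L\<close>
    are its limits from the right and from the left; at critical parameters \<open>q\<close> may
    differ from both.\<close>
  define q where "q t = Q (tface V (a + t *\<^sub>R d)) (tface W (a + t *\<^sub>R d))" for t :: real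
  define R where "R t = Q (tface (tface V (a + t *\<^sub>R d)) d) (tface (tface W (a + t *\<^sub>R d)) d)" for t :: real
  define L where "L t = Q (tface (tface V (a + t *\<^sub>R d)) (- d)) (tface (tface W (a + t *\<^sub>R d)) (- d))" for t :: real
  have germR: "\<exists>e>0. \<forall>s. t < s \<and> s < t + e \<longrightarrow> q s = R t" for t
  proof -
    obtain e where e: "e > 0" "\<forall>s. 0 < s \<and> s < e \<longrightarrow>
      tface V (a + t *\<^sub>R d + s *\<^sub>R d) = tface (tface V (a + t *\<^sub>R d)) d \<and>
      tface W (a + t *\<^sub>R d + s *\<^sub>R d) = tface (tface W (a + t *\<^sub>R d)) d"
      using tface_tface_eq2[OF fin, of "a + t *\<^sub>R d" d] by (elim exE conjE) (rule that)
    have "q s = R t" if "t < s" "s < t + e" for s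
    proof -
      have eq: "a + s *\<^sub>R d = (a + t *\<^sub>R d) + (s - t) *\<^sub>R d" by (simp add: algebra_simps)
      show ?thesis unfolding q_def R_def eq using e(2)[rule_format, of "s - t"] that by simp
    qed
    then show ?thesis using e(1) by blast
  qed
  have germL: "\<exists>e>0. \<forall>s. t - e < s \<and> s < t \<longrightarrow> q s = L t" for t
  proof -
    obtain e where e: "e > 0" "\<forall>s. 0 < s \<and> s < e \<longrightarrow>
      tface V (a + t *\<^sub>R d + s *\<^sub>R (- d)) = tface (tface V (a + t *\<^sub>R d)) (- d) \<and>
      tface W (a + t *\<^sub>R d + s *\<^sub>R (- d)) = tface (tface W (a + t *\<^sub>R d)) (- d)"
      using tface_tface_eq2[OF fin, of "a + t *\<^sub>R d" "- d"] by (elim exE conjE) (rule that)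
    have "q s = L t" if "t - e < s" "s < t" for s
    proof -
      have eq: "a + s *\<^sub>R d = (a + t *\<^sub>R d) + (t - s) *\<^sub>R (- d)" by (simp add: algebra_simps)
      show ?thesis unfolding q_def L_def eq using e(2)[rule_format, of "t - s"] that by simp
    qed
    then show ?thesis using e(1) by blast
  qed
  have constR: "\<exists>e>0. \<forall>s. t < s \<and> s < t + e \<longrightarrow> R s = R t" for t
  proof -
    obtain e where e: "e > 0" "\<And>s. t < s \<Longrightarrow> s < t + e \<Longrightarrow> q s = R t" using germR[of t] by blast
    \<comment> \<open>A point \<open>x\<close> slightly to the right of \<open>s\<close> lies in the
      germ at \<open>s\<close> and still in the germ at \<open>t\<close>, so \<open>q x\<close>
      equals both limits.\<close>
    have "R s = R t" if s: "t < s" "s < t + e" for s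
    proof -
      obtain e' where e': "e' > 0" "\<And>x. s < x \<Longrightarrow> x < s + e' \<Longrightarrow> q x = R s" using germR[of s] by blast
      define m where "m = min e' (t + e - s)"
      define x where "x = s + m / 2"
      have "0 < m" "m \<le> e'" "m \<le> t + e - s" using s e'(1) by (auto simp: m_def)
      then have "s < x" "x < s + e'" "x < t + e" "t < x" unfolding x_def using s by linarith+
      then show ?thesis using e(2)[of x] e'(2)[of x] by simp
    qed
    then show ?thesis using e(1) by blast
  qed
  have constL: "\<exists>e>0. \<forall>s. t - e < s \<and> s < t \<longrightarrow> R s = L t" for t
  proof -
    obtain e where e: "e > 0" "\<And>s. t - e < s \<Longrightarrow> s < t \<Longrightarrow> q s = L t" using germL[of t] by blast
    have "R s = L t" if s: "t - e < s" "s < t" for s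
    proof -
      obtain e' where e': "e' > 0" "\<And>x. s < x \<Longrightarrow> x < s + e' \<Longrightarrow> q x = R s" using germR[of s] by blast
      define m where "m = min e' (t - s)"
      define x where "x = s + m / 2"
      have "0 < m" "m \<le> e'" "m \<le> t - s" using s e'(1) by (auto simp: m_def)
      then have "s < x" "x < s + e'" "x < t" "t - e < x" unfolding x_def using s by linarith+
      then show ?thesis using e(2)[of x] e'(2)[of x] by simp
    qed
    then show ?thesis using e(1) by blast
  qed
  have const: "R x = R y" if xy: "x \<in> {0<..<1}" "y \<in> {0<..<1}" for x y
  proof (rule connected_local_const[of "{0<..<1}" x y R])
    show "\<forall>t\<in>{0<..<1}. \<forall>\<^sub>F s in at t within {0<..<1}. R t = R s"
    proof
      fix t :: real assume t: "t \<in> {0<..<1}"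
      obtain e1 where e1: "e1 > 0" "\<And>s. t < s \<Longrightarrow> s < t + e1 \<Longrightarrow> R s = R t" using constR[of t] by blast
      obtain e2 where e2: "e2 > 0" "\<And>s. t - e2 < s \<Longrightarrow> s < t \<Longrightarrow> R s = L t" using constL[of t] by blast
      have LR: "L t = R t" unfolding L_def R_def using t by (intro step[symmetric]) simp_all
      have "R t = R s" if "dist s t < min e1 e2" for s
      proof (cases s t rule: linorder_cases)
        case less
        then have "R s = L t" using that by (intro e2(2)) (simp_all add: dist_real_def)
        then show ?thesis using LR by blast
      next
        case greater
        then have "R s = R t" using that by (intro e1(2)) (simp_all add: dist_real_def)
        then show ?thesis by blast
      qed blast
      then show "\<forall>\<^sub>F s in at t within {0<..<1}. R t = R s"
        unfolding eventually_at using e1(1) e2(1) by (metis min_less_iff_conj)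
    qed
  qed (use xy in \<open>simp_all only: connected_Ioo\<close>)
  \<comment> \<open>At the ends only the inner side counts, so \<open>step\<close> is asked for
    strictly between them.\<close>
  obtain e1 where e1: "e1 > 0" "\<And>s. 0 < s \<Longrightarrow> s < 0 + e1 \<Longrightarrow> R s = R 0" using constR[of 0] by blast
  obtain e2 where e2: "e2 > 0" "\<And>s. 1 - e2 < s \<Longrightarrow> s < 1 \<Longrightarrow> R s = L 1" using constL[of 1] by blast
  define x y where "x = min e1 1 / 2" and "y = 1 - min e2 1 / 2"
  have xy: "0 < x" "x < 0 + e1" "x < 1" "0 < y" "1 - e2 < y" "y < 1"
    using e1(1) e2(1) by (simp_all add: x_def y_def min_def field_simps)
  have "R x = R 0" by (rule e1(2)[OF xy(1,2)])
  moreover have "R y = L 1" by (rule e2(2)[OF xy(5,6)])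
  moreover have "R x = R y" by (rule const) (use xy in simp_all)
  ultimately have "R 0 = L 1" by blast
  then show ?thesis by (simp add: R_def L_def)
qed

text \<open>The states \<open>tface (tface V p) r\<close> and \<open>tface (tface V p) (- r)\<close> are the faces met immediately after and before
  passing the point \<open>p\<close> in direction \<open>r\<close>. The circle is replaced by the square with vertices \<open>\<plusminus>u, \<plusminus>w\<close>.\<close>

lemma circle_propagate:
  fixes Q :: "'a::euclidean_space set \<Rightarrow> 'a set \<Rightarrow> bool"
  assumes fin: "finite V" "finite W"
    and C: "subspace C" "u \<in> C" "w \<in> C" "u \<noteq> 0" "w \<noteq> 0" "u \<bullet> w = 0"
    and step: "\<And>p r. p \<in> C \<Longrightarrow> p \<noteq> 0 \<Longrightarrow> r \<in> C \<Longrightarrow>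
      Q (tface (tface V p) r) (tface (tface W p) r) \<Longrightarrow>
      Q (tface (tface V p) (- r)) (tface (tface W p) (- r))"
    and start: "Q (tface (tface V u) w) (tface (tface W u) w)"
  shows "Q (tface (tface V (- u)) w) (tface (tface W (- u)) w)"
proof -
  \<comment> \<open>\<open>p\<close> is constant on \<open>tface X p\<close>, so only
    \<open>r\<close> modulo \<open>p\<close> matters there. Heading from \<open>a\<close> to
    \<open>b\<close> is direction \<open>b\<close> at \<open>a\<close>, and looking back is
    direction \<open>a\<close> at \<open>b\<close>; thus the walk can turn the corners of the
    square.\<close>
  have corner: "tface (tface X p) (r + c *\<^sub>R p) = tface (tface X p) r" for X and p r :: 'a and c
    by (rule tface_add_orth) (simp add: tface_orth)
  have iff: "Q (tface (tface V p) r) (tface (tface W p) r) \<longleftrightarrow>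
      Q (tface (tface V p) (- r)) (tface (tface W p) (- r))" if "p \<in> C" "p \<noteq> 0" "r \<in> C" for p r
    using step[OF that] step[of p "- r"] that C(1) by (auto simp: subspace_neg)
  have seg: "Q (tface (tface V a) b) (tface (tface W a) b) \<longleftrightarrow> Q (tface (tface V b) a) (tface (tface W b) a)"
    if ab: "a \<in> C" "b \<in> C" "b \<noteq> 0" "a \<bullet> b = 0" for a b
  proof -
    have nz: "a + t *\<^sub>R (b - a) \<noteq> 0" if "0 < t" for t
    proof
      assume "a + t *\<^sub>R (b - a) = 0"
      then have "(a + t *\<^sub>R (b - a)) \<bullet> b = 0" by simp
      then show False using ab that by (simp add: inner_add_left inner_diff_left)
    qed
    have "Q (tface (tface V a) (b - a)) (tface (tface W a) (b - a)) \<longleftrightarrow>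
      Q (tface (tface V (a + (b - a))) (- (b - a))) (tface (tface W (a + (b - a))) (- (b - a)))"
      using ab C(1) nz
      by (intro segment_propagate fin iff subspace_add subspace_scale subspace_diff) auto
    then show ?thesis using corner[of _ a b "- 1"] corner[of _ b a "- 1"] by simp
  qed
  have "Q (tface (tface V w) (- u)) (tface (tface W w) (- u))"
    using start seg[of u w] iff[of w u] C by simp
  then show ?thesis using seg[of w "- u"] C by (simp add: subspace_neg inner_commute)
qed

section \<open>Sets with congruent facets\<close>

text \<open>The sum of the points moves by \<open>card A\<close> times the translation
  vector.\<close>

lemma translation_unique:
  fixes A :: "'a::euclidean_space set"
  assumes "finite A" "A \<noteq> {}" "(+) s ` A = (+) t ` A"
  shows "s = t"
proof -
  have "\<Sum> ((+) c ` A) = real (card A) *\<^sub>R c + \<Sum> A" for c :: 'a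
    by (simp add: sum.reindex sum.distrib sum_constant_scaleR)
  from this[of s] this[of t] assms(3) have "real (card A) *\<^sub>R s = real (card A) *\<^sub>R t"
    by (metis add_right_cancel)
  then show ?thesis using assms(1,2) by simp
qed

lemma tface_antipode:
  assumes "u \<in> dirs V" "u \<noteq> 0" shows "tface V u \<inter> tface V (- u) = {}"
proof (rule ccontr)
  assume "tface V u \<inter> tface V (- u) \<noteq> {}"
  then obtain x where x: "x \<in> tface V u" "x \<in> tface V (- u)" by blast
  have "u \<bullet> y = u \<bullet> x" if "y \<in> V" for y
    using x that by (intro order_antisym) (simp_all add: tface_def)
  then have "u \<bullet> y = u \<bullet> z" if "y \<in> V" "z \<in> V" for y z using that by simp
  then have "u \<bullet> u = 0" using orth_dirs_iff[of V u] assms(1) by blast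
  then show False using assms(2) by simp
qed

section \<open>Vertex sets and their exposing directions\<close>

lemma dirs_singleton [simp]: "dirs {x} = {0}"
  by (simp add: dirs_def)

lemma ddim_singleton [simp]: "ddim {x} = 0"
  by (simp add: ddim_def)

lemma exposed_points_tface:
  assumes "exposed_points V" shows "exposed_points (tface V u)"
proof -
  have "\<exists>v. tface (tface V u) v = {x}" if "x \<in> tface V u" for x
  proof -
    have "x \<in> V" using that tface_subset by blast
    then obtain v where v: "tface V v = {x}" using assms by (auto simp: exposed_points_def)
    have "y = x" if y: "y \<in> tface (tface V u) v" for y
    proof -
      have "v \<bullet> x \<le> v \<bullet> y" using y that \<open>x \<in> tface V u\<close> by (simp add: tface_def[of "tface V u"])
      moreover have "x \<in> tface V v" using v by simp
      then have "\<forall>z\<in>V. v \<bullet> z \<le> v \<bullet> x" by (simp add: tface_def)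
      moreover have "y \<in> V" using y tface_subset by blast
      ultimately have "y \<in> tface V v" by (auto simp: tface_def intro: order_trans)
      then show ?thesis using v by simp
    qed
    moreover have "x \<in> tface (tface V u) v"
    proof -
      have "x \<in> tface V v" using v by simp
      then show ?thesis using that tface_subset[of V u] by (auto simp: tface_def[of _ v])
    qed
    ultimately show ?thesis by blast
  qed
  then show ?thesis using assms tface_nonempty finite_tface by (auto simp: exposed_points_def)
qed

lemma exposed_points_neg:
  assumes "exposed_points V" shows "exposed_points (neg V)"
proof -
  have "\<exists>u. tface (neg V) u = {x}" if "x \<in> neg V" for x
  proof -
    have "- x \<in> V" using that by auto
    then obtain u where "tface V u = {- x}" using assms by (auto simp: exposed_points_def)
    then have "tface (neg V) (- u) = {x}" by (simp add: tface_neg)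
    then show ?thesis by blast
  qed
  then show ?thesis using assms by (auto simp: exposed_points_def)
qed

lemma exposed_in_dirs:
  assumes "exposed_points V" "0 < ddim V" "x \<in> V"
  obtains u where "u \<in> dirs V" "u \<noteq> 0" "tface V u = {x}"
proof -
  obtain v where v: "tface V v = {x}" using assms by (auto simp: exposed_points_def)
  obtain u w where uw: "u \<in> span (dirs V)" "\<And>y. y \<in> span (dirs V) \<Longrightarrow> orthogonal w y" "v = u + w"
    using orthogonal_subspace_decomp_exists[of "dirs V" v] by metis
  have u: "u \<in> dirs V" using uw(1) by (simp add: span_eq_iff[THEN iffD2])
  have "\<forall>y\<in>dirs V. w \<bullet> y = 0" using uw(2) by (simp add: span_base orthogonal_def)
  then have eq: "tface V u = {x}" using tface_add_orth[of V w u] v uw(3) by simp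
  moreover have "u \<noteq> 0"
  proof
    assume "u = 0"
    then have "V = {x}" using eq by (simp add: tface_def)
    then show False using assms(2) by simp
  qed
  ultimately show thesis using that u by blast
qed

text \<open>If the faces of largest dimension not known to be translates were not translates of each other,
  then travelling along a great circle perpendicular to such a face, one could never leave it.\<close>

lemma translate_of_tface_step:
  fixes V W :: "'a::euclidean_space set"
  assumes fin: "finite V" "V \<noteq> {}" "finite W" and u: "u \<in> dirs V" "u \<noteq> 0"
    and d: "Suc (ddim (tface V u)) < ddim V"
    and big: "\<And>p. p \<in> dirs V \<Longrightarrow> p \<noteq> 0 \<Longrightarrow>
      ddim (tface V u) < ddim (tface V p) \<or> ddim (tface V u) < ddim (tface W p) \<Longrightarrow> tface V p \<doteq> tface W p"
  shows "tface V u \<doteq> tface W u"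
proof (rule ccontr)
  let ?X = "tface V u"
  assume no: "\<not> ?X \<doteq> tface W u"
  obtain w where w: "w \<in> dirs V" "w \<noteq> 0" "w \<bullet> u = 0" "\<And>x. x \<in> dirs ?X \<Longrightarrow> w \<bullet> x = 0"
    using orth_dirs_exists[OF u(1) tface_subset d] by metis
  \<comment> \<open>Where this state holds, the faces at \<open>p\<close> are not translates, so by
    \<open>big\<close> neither exceeds \<open>?X\<close> in dimension. Hence the face of
    \<open>V\<close> at \<open>p\<close> is \<open>?X\<close> itself and crossing \<open>p\<close>
    changes nothing.\<close>
  define Q where "Q A B \<longleftrightarrow> A = ?X \<and> \<not> ?X \<doteq> B" for A B
  have flatW: "tface (tface W p) (- r) = tface (tface W p) r"
    if "?X \<doteq> tface (tface W p) r" "ddim (tface W p) \<le> ddim ?X" for p r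
  proof -
    have "ddim (tface W p) \<le> ddim (tface (tface W p) r)" using that translate_of_ddim by metis
    then show ?thesis using tface_flat by metis
  qed
  have "Q (tface (tface V (- u)) w) (tface (tface W (- u)) w)"
  proof (rule circle_propagate[where C = "dirs V" and u = u])
    show "Q (tface (tface V u) w) (tface (tface W u) w)"
    proof -
      have "tface ?X w = ?X" using w(4) tface_orth_eq by blast
      moreover have "\<not> ?X \<doteq> tface (tface W u) w"
      proof
        assume X: "?X \<doteq> tface (tface W u) w"
        have "ddim (tface W u) \<le> ddim ?X" using big[OF u] no by (meson not_le)
        then have "tface (tface W u) w = tface W u" using X tface_flat(1) translate_of_ddim by metis
        then show False using X no by simp
      qed
      ultimately show ?thesis by (simp add: Q_def)
    qed
  next
    fix p r assume p: "p \<in> dirs V" "p \<noteq> 0" and Q: "Q (tface (tface V p) r) (tface (tface W p) r)"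
    have small: "ddim (tface V p) \<le> ddim ?X" "ddim (tface W p) \<le> ddim ?X"
      using big[OF p] Q translate_of_tface[of "tface V p" "tface W p" r] unfolding Q_def
      by (metis not_le)+
    have "tface (tface V p) r = ?X" using Q by (simp add: Q_def)
    then have "tface (tface V p) (- r) = ?X" using small(1) tface_flat by metis
    moreover have "\<not> ?X \<doteq> tface (tface W p) (- r)"
      using flatW[of p "- r"] small(2) Q unfolding Q_def by (metis minus_minus)
    ultimately show "Q (tface (tface V p) (- r)) (tface (tface W p) (- r))" by (simp add: Q_def)
  qed (use fin u w in \<open>simp_all add: inner_commute\<close>)
  \<comment> \<open>After half a turn \<open>u\<close> would be both maximal and minimal on
    \<open>?X\<close>.\<close>
  then have "?X \<subseteq> tface V (- u)" unfolding Q_def using tface_subset by metis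
  then show False using tface_antipode[OF u] tface_nonempty[OF fin(1,2), of u] by blast
qed

text \<open>Downward induction on dimension, where \<open>m + 1\<close> bounds the codimension of
  the larger of the two faces. Either set may provide the larger face, so the single step is applied
  in both orders.\<close>

lemma translate_of_all_tfaces:
  fixes V W :: "'a::euclidean_space set"
  assumes fin: "finite V" "V \<noteq> {}" "finite W" "W \<noteq> {}" and dirs: "dirs V = dirs W"
    and facets: "\<And>u. u \<in> dirs V \<Longrightarrow> u \<noteq> 0 \<Longrightarrow>
      Suc (ddim (tface V u)) = ddim V \<or> Suc (ddim (tface W u)) = ddim V \<Longrightarrow> tface V u \<doteq> tface W u"
    and u: "u \<in> dirs V" "u \<noteq> 0"
  shows "tface V u \<doteq> tface W u"
proof -
  let ?n = "ddim V"
  have nW: "ddim W = ?n" using dirs by (simp add: ddim_def)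
  have "\<forall>u\<in>dirs V. u \<noteq> 0 \<longrightarrow> ?n \<le> Suc (ddim (tface V u) + m) \<or> ?n \<le> Suc (ddim (tface W u) + m)
    \<longrightarrow> tface V u \<doteq> tface W u" for m
  proof (induction m)
    case 0
    show ?case
    proof (intro ballI impI)
      fix u assume u: "u \<in> dirs V" "u \<noteq> 0"
        and "?n \<le> Suc (ddim (tface V u) + 0) \<or> ?n \<le> Suc (ddim (tface W u) + 0)"
      moreover have "ddim (tface V u) < ?n" using ddim_tface_less[OF u] .
      moreover have "ddim (tface W u) < ?n" using ddim_tface_less[of u W] u dirs nW by simp
      ultimately have "Suc (ddim (tface V u)) = ?n \<or> Suc (ddim (tface W u)) = ?n" by linarith
      then show "tface V u \<doteq> tface W u" using facets[OF u] by blast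
    qed
  next
    case (Suc m)
    have IH: "tface V p \<doteq> tface W p" if "p \<in> dirs V" "p \<noteq> 0"
      "?n \<le> Suc (ddim (tface V p) + m) \<or> ?n \<le> Suc (ddim (tface W p) + m)" for p
      using Suc.IH that by blast
    show ?case
    proof (intro ballI impI)
      fix u assume u: "u \<in> dirs V" "u \<noteq> 0"
        and c: "?n \<le> Suc (ddim (tface V u) + Suc m) \<or> ?n \<le> Suc (ddim (tface W u) + Suc m)"
      show "tface V u \<doteq> tface W u"
      proof (cases "?n \<le> Suc (ddim (tface V u) + m) \<or> ?n \<le> Suc (ddim (tface W u) + m)")
        case True then show ?thesis using IH u by blast
      next
        case False
        then consider "?n = Suc (Suc (ddim (tface V u) + m))" | "?n = Suc (Suc (ddim (tface W u) + m))"
          using c by linarith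
        then show ?thesis
        proof cases
          case 1
          show ?thesis
            by (rule translate_of_tface_step[OF fin(1-3) u]) (use 1 in \<open>auto intro!: IH\<close>)
        next
          case 2
          have "tface W u \<doteq> tface V u"
          proof (rule translate_of_tface_step[OF fin(3,4,1)])
            fix p assume p: "p \<in> dirs W" "p \<noteq> 0"
              and "ddim (tface W u) < ddim (tface W p) \<or> ddim (tface W u) < ddim (tface V p)"
            then have "?n \<le> Suc (ddim (tface V p) + m) \<or> ?n \<le> Suc (ddim (tface W p) + m)"
              using 2 by linarith
            then show "tface W p \<doteq> tface V p" using IH[of p] p dirs translate_of_sym by simp
          qed (use 2 u dirs nW in simp_all)
          then show ?thesis by (rule translate_of_sym)
        qed
      qed
    qed
  qed
  from this[of ?n] u show ?thesis by simp
qed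

text \<open>A translation vector is unique and already determined by corresponding subfaces. So the
  vector at \<open>p\<close> is inherited by the faces on both sides of \<open>p\<close> and cannot
  change along the segment.\<close>

lemma translation_propagate:
  fixes V W :: "'a::euclidean_space set"
  assumes fin: "finite V" "V \<noteq> {}" "finite W"
    and all: "\<And>s. 0 < s \<Longrightarrow> s < 1 \<Longrightarrow> tface V (a + s *\<^sub>R (b - a)) \<doteq> tface W (a + s *\<^sub>R (b - a))"
    and a: "tface W a = (+) t ` tface V a" and b: "tface V b \<doteq> tface W b"
  shows "tface W b = (+) t ` tface V b"
proof -
  define Q where "Q A B \<longleftrightarrow> B = (+) t ` A" for A B :: "'a set"
  have iff: "Q (tface (tface V p) r) (tface (tface W p) r) \<longleftrightarrow> tface W p = (+) t ` tface V p"
    if pt: "tface V p \<doteq> tface W p" for p r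
  proof -
    obtain s where s: "tface W p = (+) s ` tface V p" using pt by (auto simp: translate_of_def)
    have fp: "finite (tface V p)" "tface V p \<noteq> {}" using fin finite_tface tface_nonempty by blast+
    have fr: "finite (tface (tface V p) r)" "tface (tface V p) r \<noteq> {}"
      using fp finite_tface tface_nonempty by blast+
    have "Q (tface (tface V p) r) (tface (tface W p) r) \<longleftrightarrow> s = t"
      unfolding Q_def s tface_translate using translation_unique[OF fr] by blast
    also have "\<dots> \<longleftrightarrow> tface W p = (+) t ` tface V p"
      unfolding s using translation_unique[OF fp] by blast
    finally show ?thesis .
  qed
  have "tface V a \<doteq> tface W a" using a translate_of_def by blast
  then have "Q (tface (tface V a) (b - a)) (tface (tface W a) (b - a))" using iff a by blast
  then have "Q (tface (tface V (a + (b - a))) (- (b - a))) (tface (tface W (a + (b - a))) (- (b - a)))"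
    using segment_propagate[OF fin(1,3), of Q a "b - a"] iff[OF all] by blast
  then show ?thesis using iff[OF b, of "- (b - a)"] by simp
qed

text \<open>All faces match up to translation, and one vector serves for all, since nonzero
  directions are connected in dimension at least two. Vertices are faces, so this vector carries
  \<open>V\<close> to \<open>W\<close>. In dimension one the facets are points and lengths stay
  undetermined.\<close>

lemma translate_of_if_facets:
  fixes V W :: "'a::euclidean_space set"
  assumes V: "exposed_points V" and W: "exposed_points W" and dirs: "dirs V = dirs W" and n: "2 \<le> ddim V"
    and facets: "\<And>u. u \<in> dirs V \<Longrightarrow> u \<noteq> 0 \<Longrightarrow>
      Suc (ddim (tface V u)) = ddim V \<or> Suc (ddim (tface W u)) = ddim V \<Longrightarrow> tface V u \<doteq> tface W u"
  shows "V \<doteq> W"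
proof -
  have fin: "finite V" "V \<noteq> {}" "finite W" "W \<noteq> {}" using V W by (auto simp: exposed_points_def)
  have all: "tface V u \<doteq> tface W u" if "u \<in> dirs V" "u \<noteq> 0" for u
    using translate_of_all_tfaces[OF fin dirs _ that] facets by blast
  have nW: "0 < ddim W" and nV: "0 < ddim V" using dirs n by (auto simp: ddim_def)
  obtain x0 where x0: "x0 \<in> V" using fin by blast
  obtain u0 where u0: "u0 \<in> dirs V" "u0 \<noteq> 0" using exposed_in_dirs[OF V nV x0] by metis
  obtain t where t: "tface W u0 = (+) t ` tface V u0" using all[OF u0] by (auto simp: translate_of_def)
  have extend: "tface W b = (+) t ` tface V b"
    if ab: "a \<in> dirs V" "b \<in> dirs V" "b \<noteq> 0" "tface W a = (+) t ` tface V a"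
      and nz: "\<And>s. 0 < s \<Longrightarrow> s < 1 \<Longrightarrow> a + s *\<^sub>R (b - a) \<noteq> 0" for a b
  proof (rule translation_propagate[OF fin(1-3) _ ab(4)])
    show "tface V b \<doteq> tface W b" using all ab by blast
    show "tface V (a + s *\<^sub>R (b - a)) \<doteq> tface W (a + s *\<^sub>R (b - a))" if "0 < s" "s < 1" for s
      using ab nz[OF that] by (intro all) (simp_all add: subspace_add subspace_scale subspace_diff)
  qed
  have tr: "tface W u = (+) t ` tface V u" if u: "u \<in> dirs V" "u \<noteq> 0" for u
  proof (cases "\<exists>s. 0 < s \<and> s < 1 \<and> u0 + s *\<^sub>R (u - u0) = 0")
    case False then show ?thesis using extend[OF u0(1) u t] by blast
  next
    case True
    then obtain s where s: "0 < s" "s < 1" "u0 + s *\<^sub>R (u - u0) = 0" by blast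
    \<comment> \<open>The segment from \<open>u0\<close> hits the origin only if \<open>u\<close> is
      a negative multiple of \<open>u0\<close>; a detour through a perpendicular \<open>v\<close>
      avoids it.\<close>
    have "Suc (ddim {x0}) < ddim V" using n by simp
    then obtain v where v: "v \<in> dirs V" "v \<noteq> 0" "v \<bullet> u0 = 0"
      using orth_dirs_exists[OF u0(1), of "{x0}"] x0 by blast
    have "u0 \<bullet> v + s * (u \<bullet> v - u0 \<bullet> v) = 0"
      using arg_cong[OF s(3), of "\<lambda>x. x \<bullet> v"] by (simp add: inner_add_left inner_diff_left)
    then have uv: "u \<bullet> v = 0" using s(1) v(3) by (simp add: inner_commute)
    have "tface W v = (+) t ` tface V v"
    proof (rule extend[OF u0(1) v(1,2) t])
      fix s :: real assume "0 < s"
      have "(u0 + s *\<^sub>R (v - u0)) \<bullet> v = s * (v \<bullet> v)"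
        using v(3) by (simp add: inner_add_left inner_diff_left inner_commute[of u0])
      then have "(u0 + s *\<^sub>R (v - u0)) \<bullet> v \<noteq> 0" using v(2) \<open>0 < s\<close> by simp
      then show "u0 + s *\<^sub>R (v - u0) \<noteq> 0" by (metis inner_zero_left)
    qed
    then show ?thesis
    proof (rule extend[OF v(1) u])
      fix s :: real assume "s < 1"
      have "(v + s *\<^sub>R (u - v)) \<bullet> v = (1 - s) * (v \<bullet> v)"
        using uv by (simp add: inner_add_left inner_diff_left algebra_simps)
      then have "(v + s *\<^sub>R (u - v)) \<bullet> v \<noteq> 0" using \<open>s < 1\<close> v(2) by simp
      then show "v + s *\<^sub>R (u - v) \<noteq> 0" by (metis inner_zero_left)
    qed
  qed
  have "W = (+) t ` V"
  proof (intro equalityI subsetI)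
    fix y assume "y \<in> W"
    then obtain u where u: "u \<in> dirs W" "u \<noteq> 0" "tface W u = {y}" using exposed_in_dirs[OF W nW] by metis
    then have "y \<in> (+) t ` tface V u" using tr[of u] dirs by auto
    then show "y \<in> (+) t ` V" using tface_subset by blast
  next
    fix y assume "y \<in> (+) t ` V"
    then obtain x where x: "x \<in> V" "y = t + x" by blast
    then obtain u where u: "u \<in> dirs V" "u \<noteq> 0" "tface V u = {x}" using exposed_in_dirs[OF V nV] by metis
    then have "tface W u = {y}" using tr x by simp
    then show "y \<in> W" using tface_subset by blast
  qed
  then show ?thesis by (auto simp: translate_of_def)
qed

section \<open>Ridges and opposite facets\<close>

definition csym :: "'a::euclidean_space set \<Rightarrow> bool" where
  "csym A \<longleftrightarrow> A \<doteq> neg A"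

definition translate_pm :: "'a::euclidean_space set \<Rightarrow> 'a set \<Rightarrow> bool" where
  "translate_pm A B \<longleftrightarrow> A \<doteq> B \<or> neg A \<doteq> B"

text \<open>Unlike central symmetry of all facets, this property is inherited by the ridges in question; see \<open>csym_pair_facet\<close>.\<close>

definition facets_csym_or_opposite :: "'a::euclidean_space set \<Rightarrow> bool" where
  "facets_csym_or_opposite V \<longleftrightarrow> (\<forall>u\<in>dirs V. u \<noteq> 0 \<longrightarrow> Suc (ddim (tface V u)) = ddim V \<longrightarrow>
    csym (tface V u) \<or> tface V u \<doteq> tface (neg V) u)"

lemma facets_csym_or_oppositeD:
  "facets_csym_or_opposite V \<Longrightarrow> u \<in> dirs V \<Longrightarrow> u \<noteq> 0 \<Longrightarrow> Suc (ddim (tface V u)) = ddim V \<Longrightarrow>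
    \<not> tface V u \<doteq> tface (neg V) u \<Longrightarrow> csym (tface V u)"
  by (auto simp: facets_csym_or_opposite_def)

section \<open>Crossing symmetric facets\<close>

lemma csym_neg: "csym (neg A) \<longleftrightarrow> csym A"
  by (simp add: csym_def translate_of_neg[of "A" "neg A"] translate_of_neg' translate_of_commute)

lemma csym_tface: "csym A \<Longrightarrow> tface A (- r) \<doteq> neg (tface A r)"
  unfolding csym_def using translate_of_tface[of A "neg A" "- r"] by (simp add: tface_neg)

lemma facets_csym_or_opposite_neg:
  assumes "facets_csym_or_opposite V" shows "facets_csym_or_opposite (neg V)"
  unfolding facets_csym_or_opposite_def
proof (intro ballI impI)
  fix u assume u: "u \<in> dirs (neg V)" "u \<noteq> 0" "Suc (ddim (tface (neg V) u)) = ddim (neg V)"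
  have "- u \<in> dirs V" "- u \<noteq> 0" "Suc (ddim (tface V (- u))) = ddim V"
    using u by (simp_all add: subspace_neg tface_neg)
  then have "csym (tface V (- u)) \<or> tface V (- u) \<doteq> tface (neg V) (- u)"
    using assms unfolding facets_csym_or_opposite_def by blast
  then show "csym (tface (neg V) u) \<or> tface (neg V) u \<doteq> tface (neg (neg V)) u"
    by (simp add: tface_neg csym_neg translate_of_neg')
qed

lemma translate_pm_neg [simp]: "translate_pm R (neg A) \<longleftrightarrow> translate_pm R A"
  unfolding translate_pm_def using translate_of_neg[of R A] translate_of_neg'[of R A] by auto

lemma translate_pm_trans: "translate_pm R A \<Longrightarrow> A \<doteq> B \<Longrightarrow> translate_pm R B"
  unfolding translate_pm_def using translate_of_trans by blast

lemma translate_pm_sym: "translate_pm A B \<Longrightarrow> translate_pm B A"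
  unfolding translate_pm_def using translate_of_neg' translate_of_sym by blast

lemma translate_pm_refl [simp]: "translate_pm A A"
  by (simp add: translate_pm_def)

lemma translate_pm_dirs: "translate_pm A B \<Longrightarrow> dirs A = dirs B"
  unfolding translate_pm_def using translate_of_dirs[of A B] translate_of_dirs[of "neg A" B] by auto

lemma translate_pm_ddim: "translate_pm A B \<Longrightarrow> ddim A = ddim B"
  using translate_pm_dirs[of A B] by (simp add: ddim_def)

text \<open>The two sides of a symmetric facet are reflections of each other, which
  \<open>translate_pm\<close> ignores. Any smaller face at \<open>p\<close> has at most the
  dimension of \<open>R\<close>, so the state is that whole face on both sides.\<close>

lemma translate_pm_flip:
  assumes V: "facets_csym_or_opposite V" and p: "p \<in> dirs V" "p \<noteq> 0"
    and no: "\<not> tface V p \<doteq> tface (neg V) p"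
    and d: "ddim V = Suc (Suc (ddim R))" and pm: "translate_pm R (tface (tface V p) r)"
  shows "translate_pm R (tface (tface V p) (- r))"
proof (cases "Suc (ddim (tface V p)) = ddim V")
  case True
  then have "csym (tface V p)" using facets_csym_or_oppositeD[OF V p _ no] by blast
  then have "tface (tface V p) (- r) \<doteq> neg (tface (tface V p) r)" by (rule csym_tface)
  moreover have "translate_pm R (neg (tface (tface V p) r))" using pm by simp
  ultimately show ?thesis using translate_pm_trans translate_of_sym by blast
next
  case False
  then have "ddim (tface V p) \<le> ddim R" using ddim_tface_less[OF p] d by simp
  then have "ddim (tface V p) \<le> ddim (tface (tface V p) r)" using translate_pm_ddim[OF pm] by simp
  from tface_flat[OF this] show ?thesis using pm by simp
qed

text \<open>Otherwise the state "\<open>V\<close> shows the ridge up to sign, \<open>- V\<close>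
  does not" travels along the circle. After half a turn it says that \<open>- V\<close> shows the
  ridge on the other side of \<open>u\<close>, whereas crossing \<open>u\<close> itself says that it
  does not.\<close>

lemma ridge_opposite:
  fixes V :: "'a::euclidean_space set"
  assumes fin: "finite V" and V: "facets_csym_or_opposite V" and u: "u \<in> dirs V" "u \<noteq> 0"
    and d: "ddim V = Suc (Suc (ddim (tface V u)))"
    and w: "w \<in> dirs V" "w \<noteq> 0" "w \<bullet> u = 0" "\<And>x. x \<in> dirs (tface V u) \<Longrightarrow> w \<bullet> x = 0"
  shows "translate_pm (tface V u) (tface (tface (neg V) u) w)"
proof (rule ccontr)
  let ?R = "tface V u"
  assume no: "\<not> translate_pm ?R (tface (tface (neg V) u) w)"
  define Q where "Q A B \<longleftrightarrow> translate_pm ?R A \<and> \<not> translate_pm ?R B" for A B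
  have step: "Q (tface (tface V p) (- r)) (tface (tface (neg V) p) (- r))"
    if p: "p \<in> dirs V" "p \<noteq> 0" and Q: "Q (tface (tface V p) r) (tface (tface (neg V) p) r)" for p r
  proof -
    \<comment> \<open>Where the two faces are translates both sets show the same, so the state
      cannot occur; at all other facets the hypothesis yields central symmetry.\<close>
    have np: "\<not> tface V p \<doteq> tface (neg V) p"
      using Q translate_of_tface translate_pm_trans unfolding Q_def by blast
    then have np': "\<not> tface (neg V) p \<doteq> tface (neg (neg V)) p" using translate_of_sym by auto
    have "translate_pm ?R (tface (tface V p) (- r))"
      using translate_pm_flip[OF V p np d] Q unfolding Q_def by blast
    moreover have "\<not> translate_pm ?R (tface (tface (neg V) p) (- r))"
      using translate_pm_flip[OF facets_csym_or_opposite_neg[OF V] _ p(2) np', of ?R "- r"] p(1) d Q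
      unfolding Q_def by auto
    ultimately show ?thesis by (simp add: Q_def)
  qed
  have "tface ?R w = ?R" using w(4) tface_orth_eq by blast
  then have start: "Q (tface (tface V u) w) (tface (tface (neg V) u) w)"
    using no by (simp add: Q_def)
  have "Q (tface (tface V (- u)) w) (tface (tface (neg V) (- u)) w)"
    by (rule circle_propagate[where C = "dirs V" and u = u])
      (use fin u w step start in \<open>simp_all add: inner_commute\<close>)
  then have "translate_pm ?R (tface (tface (neg V) u) (- w))" by (simp add: Q_def tface_neg)
  moreover have "Q (tface (tface V u) (- w)) (tface (tface (neg V) u) (- w))"
    using step[OF u start] .
  ultimately show False by (simp add: Q_def)
qed

text \<open>Among the directions off the line of \<open>c\<close>, one whose face has largest
  dimension is a facet normal \<open>z\<close>. The component of \<open>c\<close> orthogonal to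
  \<open>z\<close> then lies in the directions of this facet. The line of \<open>c\<close> is
  avoided because a facet with normal \<open>c\<close> is perpendicular to \<open>c\<close>.\<close>

lemma facet_not_perpendicular:
  fixes V :: "'a::euclidean_space set"
  assumes fin: "finite V" "V \<noteq> {}" and d: "2 \<le> ddim V" and c: "c \<in> dirs V" "c \<noteq> 0"
  obtains z x where "z \<in> dirs V" "z \<noteq> 0" "Suc (ddim (tface V z)) = ddim V"
    "x \<in> dirs (tface V z)" "c \<bullet> x \<noteq> 0"
proof -
  define S where "S = {z \<in> dirs V. z \<notin> span {c}}"
  have "dim (span {c}) < dim (dirs V)" using d dim_le_card[of "{c}" "{c}"] by (simp add: ddim_def)
  then have "S \<noteq> {}" using dim_subset[of "dirs V" "span {c}"] by (force simp: S_def)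
  then obtain k where "k \<in> S" by blast
  moreover have "\<forall>p. p \<in> S \<longrightarrow> ddim (tface V p) < ddim V"
    using ddim_tface_less[of _ V] span_zero[of "{c}"] unfolding S_def by fast
  ultimately obtain z where z: "z \<in> S" "\<And>p. p \<in> S \<Longrightarrow> ddim (tface V p) \<le> ddim (tface V z)"
    using ex_has_greatest_nat[of "\<lambda>z. z \<in> S" k "\<lambda>p. ddim (tface V p)" "ddim V"] by blast
  let ?X = "tface V z"
  have zV: "z \<in> dirs V" "z \<noteq> 0" using z(1) by (auto simp: S_def span_zero)
  have flat: "tface (tface V p) r = ?X \<Longrightarrow> tface (tface V p) (- r) = ?X \<and> tface V p = ?X" if "p \<in> S" for p r
    using tface_flat[of "tface V p" r] z(2)[OF that] by auto
  have facet: "Suc (ddim ?X) = ddim V"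
  proof (rule ccontr)
    assume "Suc (ddim ?X) \<noteq> ddim V"
    then have "Suc (ddim ?X) < ddim V" using ddim_tface_less[OF zV] by simp
    then obtain w where w: "w \<in> dirs V" "w \<noteq> 0" "w \<bullet> z = 0" "\<And>x. x \<in> dirs ?X \<Longrightarrow> w \<bullet> x = 0"
      using orth_dirs_exists[OF zV(1) tface_subset] by blast
    show False
    proof (cases "c \<in> span {z, w}")
      case False
      have sub: "span {z, w} \<subseteq> dirs V" by (rule span_minimal) (use zV(1) w(1) in simp_all)
      have pS: "p \<in> S" if p: "p \<in> span {z, w}" "p \<noteq> 0" for p
      proof -
        have "p \<notin> span {c}"
        proof
          assume "p \<in> span {c}"
          then obtain k where "p = k *\<^sub>R c" by (auto simp: span_singleton)
          then have "c = inverse k *\<^sub>R p" "k \<noteq> 0" using p(2) by auto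
          then show False using False p(1) span_scale by metis
        qed
        then show ?thesis using p sub by (auto simp: S_def)
      qed
      \<comment> \<open>The circle avoids the line of \<open>c\<close>, so maximality holds all
        around it and \<open>?X\<close> would persist up to \<open>- z\<close>.\<close>
      define Q where "Q A B \<longleftrightarrow> A = ?X" for A B :: "'a set"
      have "Q (tface (tface V (- z)) w) (tface (tface V (- z)) w)"
      proof (rule circle_propagate[where C = "span {z, w}" and u = z])
        show "Q (tface ?X w) (tface ?X w)" using w(4) tface_orth_eq by (auto simp: Q_def)
        fix p r assume "p \<in> span {z, w}" "p \<noteq> 0" "Q (tface (tface V p) r) (tface (tface V p) r)"
        then show "Q (tface (tface V p) (- r)) (tface (tface V p) (- r))"
          using flat[OF pS] by (simp add: Q_def)
      qed (use fin zV w in \<open>simp_all add: inner_commute span_base\<close>)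
      then have "?X \<subseteq> tface V (- z)" unfolding Q_def using tface_subset by metis
      then show False using tface_antipode[OF zV] tface_nonempty[OF fin, of z] by blast
    next
      case True
      then obtain a where "c - a *\<^sub>R z \<in> span {w}" using span_breakdown_eq[of c z "{w}"] by blast
      then obtain b where "c - a *\<^sub>R z = b *\<^sub>R w" by (auto simp: span_singleton)
      then have cab: "c = a *\<^sub>R z + b *\<^sub>R w" by (simp add: algebra_simps)
      have cX: "\<forall>x\<in>dirs ?X. c \<bullet> x = 0"
        using w(4) tface_orth[of _ V z] by (simp add: cab inner_add_left)
      \<comment> \<open>Here the circle meets the line of \<open>c\<close>, but the affine line
        \<open>z + s c\<close> never does, so \<open>?X\<close> persists along it for every real
        \<open>s\<close>. This makes \<open>c\<close> constant on \<open>V\<close>.\<close>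
      have inS: "z + s *\<^sub>R c \<in> S" for s
      proof -
        have "z + s *\<^sub>R c \<notin> span {c}"
        proof
          assume "z + s *\<^sub>R c \<in> span {c}"
          moreover have "s *\<^sub>R c \<in> span {c}" by (simp add: span_base span_scale)
          ultimately have "(z + s *\<^sub>R c) - s *\<^sub>R c \<in> span {c}" by (rule span_diff)
          then show False using z(1) by (simp add: S_def)
        qed
        then show ?thesis using zV c by (simp add: S_def subspace_add subspace_scale)
      qed
      define Q where "Q A B \<longleftrightarrow> A = ?X" for A B :: "'a set"
      have line: "tface V (z + s *\<^sub>R c) = ?X" for s
      proof -
        have "Q (tface (tface V (z + s *\<^sub>R c)) (- (s *\<^sub>R c))) (tface (tface V (z + s *\<^sub>R c)) (- (s *\<^sub>R c)))"
        proof (rule segment_propagate[THEN iffD1, OF fin(1) fin(1)])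
          have "\<forall>x\<in>dirs ?X. (s *\<^sub>R c) \<bullet> x = 0" using cX by simp
          then show "Q (tface ?X (s *\<^sub>R c)) (tface ?X (s *\<^sub>R c))" unfolding Q_def by (rule tface_orth_eq)
          fix t :: real
          have p: "z + t *\<^sub>R s *\<^sub>R c \<in> S" using inS[of "t * s"] by simp
          show "Q (tface (tface V (z + t *\<^sub>R s *\<^sub>R c)) (s *\<^sub>R c)) (tface (tface V (z + t *\<^sub>R s *\<^sub>R c)) (s *\<^sub>R c)) \<longleftrightarrow>
            Q (tface (tface V (z + t *\<^sub>R s *\<^sub>R c)) (- (s *\<^sub>R c))) (tface (tface V (z + t *\<^sub>R s *\<^sub>R c)) (- (s *\<^sub>R c)))"
            using flat[OF p, of "s *\<^sub>R c"] flat[OF p, of "- (s *\<^sub>R c)"] unfolding Q_def by auto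
        qed
        then show ?thesis using flat[OF inS] unfolding Q_def by blast
      qed
      obtain x where x: "x \<in> ?X" using tface_nonempty[OF fin] by blast
      have "c \<bullet> y = c \<bullet> x" if y: "y \<in> V" for y
      proof (rule ccontr)
        assume ne: "c \<bullet> y \<noteq> c \<bullet> x"
        \<comment> \<open>Chosen so that \<open>y\<close> beats \<open>x\<close> by exactly 1 in the
          direction \<open>z + s c\<close>.\<close>
        define s where "s = (z \<bullet> x - z \<bullet> y + 1) / (c \<bullet> y - c \<bullet> x)"
        have "(z + s *\<^sub>R c) \<bullet> y \<le> (z + s *\<^sub>R c) \<bullet> x"
          using x line[of s] y by (auto simp: tface_def)
        moreover have "s * (c \<bullet> y - c \<bullet> x) = z \<bullet> x - z \<bullet> y + 1" using ne by (simp add: s_def)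
        ultimately show False by (simp add: inner_add_left algebra_simps)
      qed
      then have "\<forall>y\<in>V. \<forall>y'\<in>V. c \<bullet> y = c \<bullet> y'" by metis
      then have "c \<bullet> c = 0" using orth_dirs_iff[of V c] c(1) by blast
      then show False using c(2) by simp
    qed
  qed
  define x where "x = c - ((z \<bullet> c) / (z \<bullet> z)) *\<^sub>R z"
  have zx: "z \<bullet> x = 0" using zV(2) by (simp add: x_def inner_diff_right)
  have "x \<in> dirs V" using zV c by (simp add: x_def subspace_diff subspace_scale)
  then have xX: "x \<in> dirs ?X" using dirs_facet[OF zV facet _ zx] by blast
  have "c \<bullet> x \<noteq> 0"
  proof
    assume "c \<bullet> x = 0"
    moreover have "x \<bullet> x = c \<bullet> x - ((z \<bullet> c) / (z \<bullet> z)) * (z \<bullet> x)"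
      by (subst x_def) (simp add: inner_diff_left)
    ultimately have "x = 0" using zx by simp
    then have ceq: "c = ((z \<bullet> c) / (z \<bullet> z)) *\<^sub>R z" by (simp add: x_def)
    then have "(z \<bullet> c) / (z \<bullet> z) \<noteq> 0" using c(2) by (metis scaleR_zero_left)
    then have "z = inverse ((z \<bullet> c) / (z \<bullet> z)) *\<^sub>R c" by (metis ceq scaleR_scaleR left_inverse scaleR_one)
    then show False using z(1) span_scale[OF span_base[of c "{c}"]] by (metis (no_types, lifting) S_def mem_Collect_eq singletonI)
  qed
  then show thesis using that zV facet xX by blast
qed

text \<open>Tilting the facet normal slightly towards \<open>z\<close> exposes the ridge as a face
  of \<open>V\<close> itself, and the corresponding face of the opposite facet as a face of
  \<open>- V\<close>.\<close>

lemma facet_ridge_opposite: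
  fixes V :: "'a::euclidean_space set"
  assumes fin: "finite V" and V: "facets_csym_or_opposite V" and v: "v \<in> dirs V" "v \<noteq> 0"
    and facet: "Suc (ddim (tface V v)) = ddim V"
    and z: "z \<in> dirs (tface V v)" "z \<noteq> 0"
    and ridge: "Suc (ddim (tface (tface V v) z)) = ddim (tface V v)"
  obtains w where "translate_pm (tface (tface V v) z) (tface (tface (tface (neg V) v) z) w)"
proof -
  let ?R = "tface (tface V v) z"
  obtain e where e: "e > 0" "\<forall>t. 0 < t \<and> t < e \<longrightarrow> tface V (v + t *\<^sub>R z) = ?R \<and>
      tface (neg V) (v + t *\<^sub>R z) = tface (tface (neg V) v) z"
    using tface_tface_eq2[of V "neg V" v z] fin by auto
  define u where "u = v + (e / 2) *\<^sub>R z"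
  have uR: "tface V u = ?R" and uR': "tface (neg V) u = tface (tface (neg V) v) z"
    using e(1) e(2)[rule_format, of "e / 2"] by (simp_all add: u_def)
  have "z \<in> dirs V" using z(1) dirs_tface_subset by blast
  then have uV: "u \<in> dirs V" using v by (simp add: u_def subspace_add subspace_scale)
  have "v \<bullet> u = v \<bullet> v" using tface_orth[OF z(1)] by (simp add: u_def inner_add_right)
  then have u0: "u \<noteq> 0" using v(2) by auto
  have d: "ddim V = Suc (Suc (ddim (tface V u)))" using facet ridge uR by simp
  obtain w where w: "w \<in> dirs V" "w \<noteq> 0" "w \<bullet> u = 0" "\<And>x. x \<in> dirs (tface V u) \<Longrightarrow> w \<bullet> x = 0"
    using orth_dirs_exists[OF uV tface_subset, of u] d by auto
  show thesis using that[of w] ridge_opposite[OF fin V uV u0 d w] uR uR' by simp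
qed

text \<open>Every ridge of \<open>?F\<close> reappears in \<open>?G\<close> up to translation and
  sign, so its directions lie in both spaces. If their intersection were proper in
  \<open>dirs ?F\<close>, all ridges of \<open>?F\<close> would be orthogonal to one nonzero
  \<open>c\<close> in \<open>dirs ?F\<close>.\<close>

lemma dirs_facet_subset_opposite:
  fixes V :: "'a::euclidean_space set"
  assumes fin: "finite V" "V \<noteq> {}" and V: "facets_csym_or_opposite V" and d: "3 \<le> ddim V"
    and v: "v \<in> dirs V" "v \<noteq> 0" and facet: "Suc (ddim (tface V v)) = ddim V"
  shows "dirs (tface V v) \<subseteq> dirs (tface (neg V) v)"
proof (rule ccontr)
  let ?F = "tface V v" and ?G = "tface (neg V) v"
  assume no: "\<not> dirs ?F \<subseteq> dirs ?G"
  have sub: "subspace (dirs ?F \<inter> dirs ?G)" by (simp add: subspace_inter)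
  have "dirs ?F \<inter> dirs ?G \<subset> dirs ?F" using no by blast
  then have "dim (dirs ?F \<inter> dirs ?G) < dim (dirs ?F)"
    using dim_psubset[of "dirs ?F \<inter> dirs ?G" "dirs ?F"] sub by (simp add: span_eq_iff[THEN iffD2])
  then obtain c where c: "c \<in> dirs ?F" "c \<noteq> 0" "\<And>x. x \<in> dirs ?F \<inter> dirs ?G \<Longrightarrow> c \<bullet> x = 0"
    using orth_exists[of "dirs ?F" "dirs ?F \<inter> dirs ?G"] by auto
  have "2 \<le> ddim ?F" using d facet by simp
  then obtain z x where zx: "z \<in> dirs ?F" "z \<noteq> 0" "Suc (ddim (tface ?F z)) = ddim ?F"
    "x \<in> dirs (tface ?F z)" "c \<bullet> x \<noteq> 0"
    using facet_not_perpendicular[of ?F c] c(1,2) fin finite_tface tface_nonempty by metis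
  obtain w where "translate_pm (tface ?F z) (tface (tface ?G z) w)"
    using facet_ridge_opposite[OF fin(1) V v facet zx(1-3)] by blast
  then have "x \<in> dirs (tface (tface ?G z) w)" using translate_pm_dirs zx(4) by blast
  then have "x \<in> dirs ?G" using dirs_tface_subset by blast
  moreover have "x \<in> dirs ?F" using zx(4) dirs_tface_subset by blast
  ultimately show False using c(3) zx(5) by blast
qed

lemma facet_opposite:
  fixes V :: "'a::euclidean_space set"
  assumes fin: "finite V" "V \<noteq> {}" and V: "facets_csym_or_opposite V" and d: "3 \<le> ddim V"
    and v: "v \<in> dirs V" "v \<noteq> 0" and facet: "Suc (ddim (tface V v)) = ddim V"
  shows "Suc (ddim (tface (neg V) v)) = ddim V" and "dirs (tface (neg V) v) = dirs (tface V v)"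
proof -
  have sub: "dirs (tface V v) \<subseteq> dirs (tface (neg V) v)"
    using dirs_facet_subset_opposite[OF assms] .
  have "ddim (tface V v) \<le> ddim (tface (neg V) v)" using sub by (simp add: ddim_def dim_subset)
  moreover have "ddim (tface (neg V) v) < ddim V" using ddim_tface_less[of v "neg V"] v by simp
  ultimately show "Suc (ddim (tface (neg V) v)) = ddim V" using facet by simp
  then show "dirs (tface (neg V) v) = dirs (tface V v)"
    using dirs_eq_of_ddim[OF sub] facet by simp
qed

lemma facet_opposite_iff:
  fixes V :: "'a::euclidean_space set"
  assumes fin: "finite V" "V \<noteq> {}" and V: "facets_csym_or_opposite V" and d: "3 \<le> ddim V"
    and v: "v \<in> dirs V" "v \<noteq> 0"
  shows "Suc (ddim (tface (neg V) v)) = ddim V \<longleftrightarrow> Suc (ddim (tface V v)) = ddim V"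
  using facet_opposite(1)[OF fin V d v]
    facet_opposite(1)[of "neg V" v] facets_csym_or_opposite_neg[OF V] fin d v by auto

text \<open>Collects what is known about two opposite facets that are not translates and leaves the
  ambient polytope behind. Symmetry makes half turns useful inside \<open>dirs F\<close>, as
  \<open>tface F (- z)\<close> reflects \<open>tface F z\<close>.\<close>

definition csym_pair :: "'a::euclidean_space set \<Rightarrow> 'a set \<Rightarrow> bool" where
  "csym_pair F G \<longleftrightarrow> finite F \<and> F \<noteq> {} \<and> finite G \<and> G \<noteq> {} \<and> dirs F = dirs G \<and> csym F \<and> csym G \<and>
    (\<forall>z\<in>dirs F. z \<noteq> 0 \<longrightarrow> Suc (ddim (tface F z)) = ddim F \<or> Suc (ddim (tface G z)) = ddim F \<longrightarrow>
      translate_pm (tface F z) (tface G z))"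

lemma facet_csym_pair:
  fixes V :: "'a::euclidean_space set"
  assumes fin: "finite V" "V \<noteq> {}" and V: "facets_csym_or_opposite V" and d: "3 \<le> ddim V"
    and v: "v \<in> dirs V" "v \<noteq> 0" and facet: "Suc (ddim (tface V v)) = ddim V"
    and bad: "\<not> tface V v \<doteq> tface (neg V) v"
  shows "csym_pair (tface V v) (tface (neg V) v)"
proof -
  \<comment> \<open>Stated for arbitrary \<open>V\<close>, since ridges of the opposite facet need
    it for \<open>neg V\<close>.\<close>
  have pm: "translate_pm (tface (tface V v) z) (tface (tface (neg V) v) z)"
    if V: "finite V" "V \<noteq> {}" "facets_csym_or_opposite V" "3 \<le> ddim V" "v \<in> dirs V"
      and facet: "Suc (ddim (tface V v)) = ddim V"
      and z: "z \<in> dirs (tface V v)" "z \<noteq> 0"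
      and ridge: "Suc (ddim (tface (tface V v) z)) = ddim (tface V v)" for V z
  proof -
    let ?F = "tface V v" and ?G = "tface (neg V) v"
    obtain w where w: "translate_pm (tface ?F z) (tface (tface ?G z) w)"
      using facet_ridge_opposite[OF V(1,3,5) v(2) facet z ridge] by blast
    have eq: "dirs ?G = dirs ?F" using facet_opposite(2)[OF V(1-5) v(2) facet] .
    then have "ddim (tface ?G z) < ddim ?F" using ddim_tface_less[of z ?G] z by (simp add: ddim_def)
    then have "ddim (tface ?G z) \<le> ddim (tface (tface ?G z) w)"
      using translate_pm_ddim[OF w] ridge by simp
    then show ?thesis using tface_flat(1) w by metis
  qed
  have fin': "finite (neg V)" "neg V \<noteq> {}" using fin by auto
  note V' = facets_csym_or_opposite_neg[OF V]
  note opp = facet_opposite[OF fin V d v facet]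
  have dG: "ddim (tface (neg V) v) = ddim (tface V v)" using opp(2) by (simp add: ddim_def)
  have "csym (tface V v)" using facets_csym_or_oppositeD[OF V v facet bad] .
  moreover have "csym (tface (neg V) v)"
    using facets_csym_or_oppositeD[OF V' _ v(2)] v opp(1) bad translate_of_sym by auto
  moreover have "translate_pm (tface (tface V v) z) (tface (tface (neg V) v) z)"
    if z: "z \<in> dirs (tface V v)" "z \<noteq> 0"
      and c: "Suc (ddim (tface (tface V v) z)) = ddim (tface V v) \<or>
        Suc (ddim (tface (tface (neg V) v) z)) = ddim (tface V v)" for z
    using c
  proof
    assume "Suc (ddim (tface (tface V v) z)) = ddim (tface V v)"
    then show ?thesis using pm[OF fin V d v(1) facet z] by blast
  next
    assume "Suc (ddim (tface (tface (neg V) v) z)) = ddim (tface V v)"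
    then have "translate_pm (tface (tface (neg V) v) z) (tface (tface (neg (neg V)) v) z)"
      using z opp dG by (intro pm fin' V') (simp_all add: d v(1))
    then show ?thesis using translate_pm_sym by simp
  qed
  ultimately show ?thesis unfolding csym_pair_def
    using fin opp(2) finite_tface[of V v] tface_nonempty[of V v] finite_tface[of "neg V" v] tface_nonempty[of "neg V" v]
    by auto
qed

section \<open>Ridges on which opposite facets disagree\<close>

lemma translate_of_cong: "A \<doteq> B \<Longrightarrow> Y \<doteq> A \<longleftrightarrow> Y \<doteq> B"
  using translate_of_trans translate_of_sym by blast

text \<open>If \<open>?X\<close> violates the claim, a walk on the circle perpendicular to it
  compares \<open>F\<close> and \<open>G\<close>. Facets that agree are excluded by the state; at
  reflected ones the sides of the two faces are exchanged and negated. After half a turn the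
  symmetry of \<open>F\<close> and \<open>G\<close> gives two incompatible readings.\<close>

lemma csym_pair_facet:
  fixes F G :: "'a::euclidean_space set"
  assumes FG: "csym_pair F G" and z: "z \<in> dirs F" "z \<noteq> 0"
    and facet: "Suc (ddim (tface F z)) = ddim F" and bad: "\<not> tface F z \<doteq> tface G z"
  shows "facets_csym_or_opposite (tface F z)"
  unfolding facets_csym_or_opposite_def
proof (intro ballI impI, rule ccontr)
  let ?K = "tface F z"
  have fin: "finite F" "finite G" and csymF: "csym F" and csymG: "csym G" and dFG: "ddim G = ddim F"
    using FG by (simp_all add: csym_pair_def ddim_def)
  have pm: "tface F p \<doteq> tface G p \<or> neg (tface F p) \<doteq> tface G p"
    if "p \<in> dirs F" "p \<noteq> 0" "Suc (ddim (tface F p)) = ddim F \<or> Suc (ddim (tface G p)) = ddim F" for p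
    using that FG unfolding csym_pair_def translate_pm_def by blast
  have opp: "neg ?K \<doteq> tface G z" using pm[OF z] facet bad by blast
  fix w assume w: "w \<in> dirs ?K" "w \<noteq> 0" and ridge: "Suc (ddim (tface ?K w)) = ddim ?K"
  let ?X = "tface ?K w"
  assume "\<not> (csym ?X \<or> ?X \<doteq> tface (neg ?K) w)"
  then have nc: "\<not> csym ?X" and nX: "\<not> ?X \<doteq> tface (neg ?K) w" by blast+
  have dX: "ddim F = Suc (Suc (ddim ?X))" using facet ridge by simp
  have wF: "w \<in> dirs F" using w(1) dirs_tface_subset by blast
  \<comment> \<open>Invariant under replacing \<open>(A, B)\<close> by \<open>(- B, - A)\<close>,
    which is the effect of crossing a facet with
    \<open>neg (tface F p) \<doteq> tface G p\<close>.\<close>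
  define Q where "Q A B \<longleftrightarrow> (?X \<doteq> A \<and> \<not> ?X \<doteq> B) \<or> (neg ?X \<doteq> B \<and> \<not> neg ?X \<doteq> A)" for A B
  have step: "Q (tface (tface F p) (- r)) (tface (tface G p) (- r))"
    if p: "p \<in> dirs F" "p \<noteq> 0" and Q: "Q (tface (tface F p) r) (tface (tface G p) r)" for p r
  proof (cases "Suc (ddim (tface F p)) = ddim F \<or> Suc (ddim (tface G p)) = ddim F")
    case True
    have "\<not> tface F p \<doteq> tface G p"
    proof
      assume "tface F p \<doteq> tface G p"
      then have "Y \<doteq> tface (tface F p) r \<longleftrightarrow> Y \<doteq> tface (tface G p) r" for Y
        using translate_of_cong translate_of_tface by blast
      then show False using Q unfolding Q_def by blast
    qed
    then have n: "neg (tface F p) \<doteq> tface G p" using pm[OF p True] by blast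
    have 1: "neg (tface (tface F p) (- r)) \<doteq> tface (tface G p) r"
      using translate_of_tface[OF n, of r] by (simp add: tface_neg)
    have 2: "neg (tface (tface F p) r) \<doteq> tface (tface G p) (- r)"
      using translate_of_tface[OF n, of "- r"] by (simp add: tface_neg)
    have "Y \<doteq> tface (tface G p) r \<longleftrightarrow> neg Y \<doteq> tface (tface F p) (- r)" for Y
      using translate_of_cong[OF 1] translate_of_neg'[of Y] by blast
    moreover have "Y \<doteq> tface (tface G p) (- r) \<longleftrightarrow> neg Y \<doteq> tface (tface F p) r" for Y
      using translate_of_cong[OF 2] translate_of_neg'[of Y] by blast
    ultimately show ?thesis using Q unfolding Q_def by (metis neg_neg)
  next
    case False
    then have small: "ddim (tface F p) \<le> ddim ?X" "ddim (tface G p) \<le> ddim ?X"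
      using dX ddim_tface_less[OF p] ddim_tface_less[of p G] p FG dFG
      by (auto simp: csym_pair_def)
    have flatF: "tface (tface F p) (- s) = tface (tface F p) s"
      if "?X \<doteq> tface (tface F p) s \<or> neg ?X \<doteq> tface (tface F p) s" for s
    proof -
      have "ddim (tface (tface F p) s) = ddim ?X" using that translate_of_ddim ddim_neg by metis
      then show ?thesis using small(1) tface_flat[of "tface F p" s] by simp
    qed
    have flatG: "tface (tface G p) (- s) = tface (tface G p) s"
      if "?X \<doteq> tface (tface G p) s \<or> neg ?X \<doteq> tface (tface G p) s" for s
    proof -
      have "ddim (tface (tface G p) s) = ddim ?X" using that translate_of_ddim ddim_neg by metis
      then show ?thesis using small(2) tface_flat[of "tface G p" s] by simp
    qed
    show ?thesis using Q flatF[of r] flatG[of r] flatF[of "- r"] flatG[of "- r"] unfolding Q_def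
      by (metis minus_minus)
  qed
  have "tface (neg ?K) w \<doteq> tface (tface G z) w" using opp translate_of_tface by blast
  then have start: "Q ?X (tface (tface G z) w)"
    using nX translate_of_cong unfolding Q_def by (metis translate_of_refl)
  have "Q (tface (tface F (- z)) w) (tface (tface G (- z)) w)"
    by (rule circle_propagate[where C = "dirs F" and u = z])
      (use fin z w wF step start tface_orth[OF w(1)] in simp_all)
  moreover have "Y \<doteq> tface (tface F (- z)) w \<longleftrightarrow> neg Y \<doteq> tface ?K (- w)" for Y
  proof -
    have "tface (tface F (- z)) w \<doteq> neg (tface ?K (- w))"
      using translate_of_tface[OF csym_tface[OF csymF, of z], of w] by (simp add: tface_neg)
    then show ?thesis using translate_of_cong translate_of_neg'[of Y] by blast
  qed
  moreover have "Y \<doteq> tface (tface G (- z)) w \<longleftrightarrow> neg Y \<doteq> tface (tface G z) (- w)" for Y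
  proof -
    have "tface (tface G (- z)) w \<doteq> neg (tface (tface G z) (- w))"
      using translate_of_tface[OF csym_tface[OF csymG, of z], of w] by (simp add: tface_neg)
    then show ?thesis using translate_of_cong translate_of_neg'[of Y] by blast
  qed
  \<comment> \<open>In the cases that do not clash at once, one set would be a translate of both
    \<open>?X\<close> and \<open>- ?X\<close>.\<close>
  moreover have "\<not> (?X \<doteq> Y \<and> neg ?X \<doteq> Y)" for Y
    using nc translate_of_trans translate_of_sym unfolding csym_def by blast
  moreover have "Q (tface ?K (- w)) (tface (tface G z) (- w))" using step[OF z start] .
  ultimately show False unfolding Q_def by (metis neg_neg)
qed

text \<open>The criterion for translates, used for \<open>V\<close> and \<open>- V\<close> and again
  for opposite facets, leaves only ridges that match their counterpart after reflection but not
  without it. A symmetric ridge cannot be of this kind.\<close>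

lemma csym_if_ridges_csym:
  fixes V :: "'a::euclidean_space set"
  assumes V: "exposed_points V" "facets_csym_or_opposite V" "3 \<le> ddim V"
    and ridges: "\<And>v z. v \<in> dirs V \<Longrightarrow> v \<noteq> 0 \<Longrightarrow> Suc (ddim (tface V v)) = ddim V \<Longrightarrow>
      \<not> tface V v \<doteq> tface (neg V) v \<Longrightarrow> csym_pair (tface V v) (tface (neg V) v) \<Longrightarrow>
      z \<in> dirs (tface V v) \<Longrightarrow> z \<noteq> 0 \<Longrightarrow> Suc (ddim (tface (tface V v) z)) = ddim (tface V v) \<Longrightarrow>
      \<not> tface (tface V v) z \<doteq> tface (tface (neg V) v) z \<Longrightarrow> csym (tface (tface V v) z)"
  shows "csym V"
proof -
  have fin: "finite V" "V \<noteq> {}" using V by (auto simp: exposed_points_def)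
  have "V \<doteq> neg V"
  proof (rule translate_of_if_facets[OF V(1) exposed_points_neg[OF V(1)]])
    fix v assume v: "v \<in> dirs V" "v \<noteq> 0"
      and "Suc (ddim (tface V v)) = ddim V \<or> Suc (ddim (tface (neg V) v)) = ddim V"
    then have facet: "Suc (ddim (tface V v)) = ddim V" using facet_opposite_iff[OF fin V(2,3) v] by blast
    let ?F = "tface V v" and ?G = "tface (neg V) v"
    show "?F \<doteq> ?G"
    proof (rule ccontr)
      assume bad: "\<not> ?F \<doteq> ?G"
      note FG = facet_csym_pair[OF fin V(2,3) v facet bad]
      have "?F \<doteq> ?G"
      proof (rule translate_of_if_facets)
        fix z assume z: "z \<in> dirs ?F" "z \<noteq> 0"
          and c: "Suc (ddim (tface ?F z)) = ddim ?F \<or> Suc (ddim (tface ?G z)) = ddim ?F"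
        then have pm: "translate_pm (tface ?F z) (tface ?G z)" using FG unfolding csym_pair_def by blast
        then have facet': "Suc (ddim (tface ?F z)) = ddim ?F" using c translate_pm_ddim by metis
        show "tface ?F z \<doteq> tface ?G z"
        proof (rule ccontr)
          assume no: "\<not> tface ?F z \<doteq> tface ?G z"
          then have "csym (tface ?F z)" using ridges[OF v facet bad FG z facet'] by blast
          then show False using pm no unfolding csym_def translate_pm_def
            by (meson translate_of_trans)
        qed
      qed (use FG V facet exposed_points_tface exposed_points_neg in \<open>auto simp: csym_pair_def\<close>)
      then show False using bad by blast
    qed
  qed (use V in simp_all)
  then show ?thesis by (simp add: csym_def)
qed

lemma csym_dim_one:
  fixes V :: "'a::euclidean_space set"
  assumes V: "exposed_points V" and d: "ddim V = 1"
  shows "csym V"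
proof -
  have fin: "finite V" "V \<noteq> {}" using V by (auto simp: exposed_points_def)
  obtain e where e: "e \<in> dirs V" "e \<noteq> 0" using d unfolding ddim_def
    by (metis dim_eq_0 subsetI singletonI zero_neq_one)
  have eV: "dirs V = span {e}"
  proof -
    have "span {e} \<subseteq> dirs V" by (rule span_minimal) (use e in simp_all)
    moreover have "dim (span {e}) = dim (dirs V)" using d e(2) by (simp add: ddim_def)
    ultimately show ?thesis using subspace_dim_equal[of "span {e}" "dirs V"] by simp
  qed
  have single: "\<exists>a. tface V u = {a}" if u: "u \<in> dirs V" "u \<noteq> 0" for u
  proof -
    obtain a where a: "a \<in> tface V u" using tface_nonempty[OF fin] by blast
    have "ddim (tface V u) = 0" using ddim_tface_less[OF u] d by simp
    then have "dirs (tface V u) \<subseteq> {0}" by (simp add: ddim_def)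
    then have "b = a" if "b \<in> tface V u" for b using diff_in_dirs[OF that a] by auto
    then show ?thesis using a by blast
  qed
  obtain a where a: "tface V e = {a}" using single e by blast
  have "- e \<in> dirs V" "- e \<noteq> 0" using e by (simp_all add: subspace_neg)
  then obtain b where b: "tface V (- e) = {b}" using single by blast
  have "V = {a, b}"
  proof
    show "{a, b} \<subseteq> V" using a b tface_subset[of V e] tface_subset[of V "- e"] by auto
    show "V \<subseteq> {a, b}"
    proof
      fix x assume "x \<in> V"
      then obtain u where u: "u \<in> dirs V" "u \<noteq> 0" "tface V u = {x}" using exposed_in_dirs[OF V] d by auto
      then obtain k where k: "u = k *\<^sub>R e" "k \<noteq> 0" unfolding eV by (auto simp: span_singleton)
      show "x \<in> {a, b}"
      proof (cases "k > 0")
        case True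
        then show ?thesis using k u a tface_scale[of k V e] by simp
      next
        case False
        then show ?thesis using k u b tface_scale[of "- k" V "- e"] by simp
      qed
    qed
  qed
  then have "neg V = (+) (- a - b) ` V" by (auto simp: algebra_simps)
  then show ?thesis unfolding csym_def translate_of_def by blast
qed

section \<open>Ingredients for dimension four\<close>

text \<open>By \<open>step\<close> and independence modulo \<open>p\<close>, the state at
  \<open>p\<close> is the same for all \<open>r\<close> in the plane not parallel to
  \<open>p\<close>. So it suffices to reach \<open>u'\<close> from \<open>u\<close>, directly or, if
  they are parallel, through \<open>w\<close>.\<close>

lemma circle_propagate_all:
  fixes Q :: "'a::euclidean_space set \<Rightarrow> 'a set \<Rightarrow> bool"
  assumes fin: "finite V" "finite W"
    and uw: "u \<noteq> 0" "w \<noteq> 0" "u \<bullet> w = 0"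
    and step: "\<And>p r. p \<in> span {u, w} \<Longrightarrow> p \<noteq> 0 \<Longrightarrow> r \<in> span {u, w} \<Longrightarrow>
      Q (tface (tface V p) r) (tface (tface W p) r) \<Longrightarrow>
      Q (tface (tface V p) (- r)) (tface (tface W p) (- r))"
    and start: "Q (tface (tface V u) w) (tface (tface W u) w)"
    and uw': "u' \<in> span {u, w}" "w' \<in> span {u, w}" "u' \<noteq> 0" "w' \<noteq> 0" "u' \<bullet> w' = 0"
  shows "Q (tface (tface V u') w') (tface (tface W u') w')"
proof -
  let ?C = "span {u, w}"
  define H where "H p r \<longleftrightarrow> Q (tface (tface V p) r) (tface (tface W p) r)" for p r
  have neg: "H p (- r) \<longleftrightarrow> H p r" if "p \<in> ?C" "p \<noteq> 0" "r \<in> ?C" for p r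
    using step[OF that] step[of p "- r"] that by (auto simp: H_def span_neg)
  have corner: "H p (r + c *\<^sub>R p) \<longleftrightarrow> H p r" for p r c
  proof -
    have "\<forall>x\<in>dirs (tface X p). (c *\<^sub>R p) \<bullet> x = 0" for X by (simp add: tface_orth)
    then show ?thesis using tface_add_orth unfolding H_def by metis
  qed
  have scale: "H p (c *\<^sub>R r) \<longleftrightarrow> H p r" if c: "c \<noteq> 0" and p: "p \<in> ?C" "p \<noteq> 0" "r \<in> ?C" for p r c
  proof (cases "c > 0")
    case True then show ?thesis by (simp add: H_def tface_scale)
  next
    case False
    have "H p (c *\<^sub>R r) \<longleftrightarrow> H p (- (c *\<^sub>R r))" using neg[OF p(1,2)] p(3) span_scale by blast
    also have "\<dots> \<longleftrightarrow> H p r"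
    proof -
      have "tface X (- (c *\<^sub>R r)) = tface X r" for X using False c tface_scale[of "- c" X r] by simp
      then show ?thesis by (simp add: H_def)
    qed
    finally show ?thesis .
  qed
  have seg: "H b a" if ab: "a \<in> ?C" "b \<in> ?C" and nz: "\<And>t. 0 < t \<Longrightarrow> t < 1 \<Longrightarrow> a + t *\<^sub>R (b - a) \<noteq> 0" and ini: "H a b" for a b
  proof -
    have "Q (tface (tface V a) (b - a)) (tface (tface W a) (b - a)) \<longleftrightarrow>
      Q (tface (tface V (a + (b - a))) (- (b - a))) (tface (tface W (a + (b - a))) (- (b - a)))"
    proof (rule segment_propagate[OF fin])
      fix t :: real assume t: "0 < t" "t < 1"
      have "a + t *\<^sub>R (b - a) \<in> ?C" "b - a \<in> ?C" using ab by (simp_all add: span_add span_scale span_diff)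
      from neg[OF this(1) nz[OF t] this(2)]
      show "Q (tface (tface V (a + t *\<^sub>R (b - a))) (b - a)) (tface (tface W (a + t *\<^sub>R (b - a))) (b - a)) \<longleftrightarrow>
        Q (tface (tface V (a + t *\<^sub>R (b - a))) (- (b - a))) (tface (tface W (a + t *\<^sub>R (b - a))) (- (b - a)))"
        unfolding H_def by blast
    qed
    then have "H a (b - a) \<longleftrightarrow> H b (a - b)" by (simp add: H_def)
    then show ?thesis using corner[of a b "- 1"] corner[of b a "- 1"] ini by simp
  qed
  have uC: "u \<in> ?C" and wC: "w \<in> ?C" by (simp_all add: span_base)
  have coords: "\<exists>a b. x = a *\<^sub>R u + b *\<^sub>R w" if x: "x \<in> ?C" for x
  proof -
    obtain a where "x - a *\<^sub>R u \<in> span {w}" using x span_breakdown_eq[of x u "{w}"] by blast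
    then obtain b where "x - a *\<^sub>R u = b *\<^sub>R w" by (auto simp: span_singleton)
    then show ?thesis by (metis add.commute diff_add_cancel)
  qed
  obtain a b where ab: "u' = a *\<^sub>R u + b *\<^sub>R w" using coords uw' by blast
  obtain c d where cd: "w' = c *\<^sub>R u + d *\<^sub>R w" using coords uw' by blast
  have wu: "w \<bullet> u = 0" using uw(3) by (simp add: inner_commute)
  have s: "H u w" using start by (simp add: H_def)
  have "H u' w'"
  proof (cases "b = 0")
    case True
    have "w' \<bullet> u = 0" using uw'(3,5) ab True by (simp add: inner_commute)
    then have c0: "c = 0" using uw(1) wu by (simp add: cd inner_add_left)
    then have d: "d \<noteq> 0" using uw'(4) cd by auto
    have a: "a \<noteq> 0" using uw'(3) ab True by auto
    have "H w u"
    proof (rule seg[OF uC wC _ s])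
      fix t :: real assume "0 < t"
      have "(u + t *\<^sub>R (w - u)) \<bullet> w = t * (w \<bullet> w)" by (simp add: inner_add_left inner_diff_left uw(3))
      then show "u + t *\<^sub>R (w - u) \<noteq> 0" using \<open>0 < t\<close> uw(2) by (metis inner_zero_left inner_eq_zero_iff mult_eq_0_iff order_less_irrefl)
    qed
    then have "H w u'" using scale[OF a wC uw(2) uC] ab True by simp
    then have "H u' w"
    proof (rule seg[OF wC uw'(1), rotated])
      fix t :: real assume "t < 1"
      have "(w + t *\<^sub>R (u' - w)) \<bullet> w = (1 - t) * (w \<bullet> w)"
        by (simp add: inner_add_left inner_diff_left uw(3) ab True algebra_simps)
      then show "w + t *\<^sub>R (u' - w) \<noteq> 0" using \<open>t < 1\<close> uw(2) by (metis inner_zero_left inner_eq_zero_iff mult_eq_0_iff order_less_irrefl right_minus_eq)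
    qed
    then show ?thesis using scale[OF d uw'(1,3) wC] cd c0 by simp
  next
    case False
    have "H u (b *\<^sub>R w)" using scale[OF False uC uw(1) wC] s by simp
    then have "H u u'" using corner[of u "b *\<^sub>R w" a] ab by (simp add: add.commute)
    then have h: "H u' u"
    proof (rule seg[OF uC uw'(1), rotated])
      fix t :: real assume "0 < t"
      have "(u + t *\<^sub>R (u' - u)) \<bullet> w = t * b * (w \<bullet> w)"
        by (simp add: inner_add_left inner_diff_left uw(3) ab)
      then show "u + t *\<^sub>R (u' - u) \<noteq> 0" using \<open>0 < t\<close> uw(2) False by (metis inner_zero_left inner_eq_zero_iff mult_eq_0_iff order_less_irrefl)
    qed
    define k where "k = c - d * a / b"
    have w'eq: "w' = k *\<^sub>R u + (d / b) *\<^sub>R u'"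
      using False by (simp add: cd ab k_def algebra_simps)
    have "k \<noteq> 0"
    proof
      assume "k = 0"
      then have "u' \<bullet> w' = (d / b) * (u' \<bullet> u')" using w'eq by simp
      then have "d = 0" using uw'(3,5) False by simp
      then show False using uw'(4) w'eq \<open>k = 0\<close> by simp
    qed
    then have "H u' (k *\<^sub>R u)" using scale[OF _ uw'(1,3) uC] h by blast
    then show ?thesis using corner[of u' "k *\<^sub>R u" "d / b"] w'eq by simp
  qed
  then show ?thesis by (simp add: H_def)
qed

text \<open>Kelly's argument: a point off a line at minimal positive distance leads to a smaller distance.\<close>

lemma sylvester_gallai:
  fixes S :: "'a::euclidean_space set"
  assumes fin: "finite S"
    and third: "\<And>p q. p \<in> S \<Longrightarrow> q \<in> S \<Longrightarrow> p \<noteq> q \<Longrightarrow>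
      \<exists>r\<in>S. r \<noteq> p \<and> r \<noteq> q \<and> (\<exists>t. r = p + t *\<^sub>R (q - p))"
    and pqr: "p \<in> S" "q \<in> S" "p \<noteq> q" "r \<in> S"
  shows "\<exists>t. r = p + t *\<^sub>R (q - p)"
proof (rule ccontr)
  assume off: "\<nexists>t. r = p + t *\<^sub>R (q - p)"
  \<comment> \<open>The Gram determinant: \<open>N P X / (X \<bullet> X)\<close> is the squared
    distance of \<open>P\<close> from the line of \<open>X\<close>. By its symmetry one triangle can
    be measured over two of its sides.\<close>
  define N where "N P X = (P \<bullet> P) * (X \<bullet> X) - (P \<bullet> X)\<^sup>2" for P X :: 'a
  have N_nonneg: "N P X \<ge> 0" for P X using Cauchy_Schwarz_ineq[of P X] by (simp add: N_def)
  have N_zero: "\<exists>t. P = t *\<^sub>R X" if "N P X = 0" "X \<noteq> 0" for P X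
  proof -
    define D where "D = P - ((P \<bullet> X) / (X \<bullet> X)) *\<^sub>R X"
    have "D \<bullet> D = P \<bullet> P - 2 * ((P \<bullet> X) / (X \<bullet> X)) * (P \<bullet> X) + ((P \<bullet> X) / (X \<bullet> X))\<^sup>2 * (X \<bullet> X)"
      by (simp add: D_def inner_diff_left inner_diff_right inner_commute power2_eq_square algebra_simps)
    also have "\<dots> = N P X / (X \<bullet> X)" using that(2) by (simp add: N_def power2_eq_square field_simps)
    finally have "D = 0" using that by simp
    then show ?thesis by (auto simp: D_def)
  qed
  have N_sym: "N P X = N X P" for P X by (simp add: N_def inner_commute mult.commute)
  have N_shift: "N (P - s *\<^sub>R X) (k *\<^sub>R X) = k\<^sup>2 * N P X" for P X s k
    by (simp add: N_def inner_diff_left inner_diff_right inner_commute power2_eq_square algebra_simps)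
  define T where "T = {(a, y, x). a \<in> S \<and> y \<in> S \<and> x \<in> S \<and> x \<noteq> y \<and> N (a - y) (x - y) > 0}"
  define f where "f = (\<lambda>(a, y, x). N (a - y) (x - y) / ((x - y) \<bullet> (x - y)))"
  have "T \<subseteq> S \<times> S \<times> S" by (auto simp: T_def)
  then have "finite T" using fin finite_subset by blast
  moreover have "(r, p, q) \<in> T"
  proof -
    have "N (r - p) (q - p) \<noteq> 0"
    proof
      assume "N (r - p) (q - p) = 0"
      then obtain t where "r - p = t *\<^sub>R (q - p)" using N_zero pqr(3) by (metis right_minus_eq)
      then have "r = p + t *\<^sub>R (q - p)" by (metis add.commute diff_add_cancel)
      then show False using off by blast
    qed
    then show ?thesis using pqr N_nonneg[of "r - p" "q - p"] by (simp add: T_def)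
  qed
  ultimately obtain m where m: "m \<in> T" "\<And>n. n \<in> T \<Longrightarrow> f m \<le> f n"
    using arg_min_if_finite[of T f] by (metis empty_iff not_le)
  obtain a y x where ayx: "m = (a, y, x)" by (cases m)
  define P d where "P = a - y" and "d = x - y"
  have T: "a \<in> S" "y \<in> S" "x \<in> S" "d \<noteq> 0" "N P d > 0" using m(1) by (auto simp: T_def ayx P_def d_def)
  have dd: "d \<bullet> d > 0" using T by simp
  obtain z t where z: "z \<in> S" "z \<noteq> y" "z \<noteq> x" "z = y + t *\<^sub>R d"
  proof -
    have "y \<noteq> x" using T(4) by (auto simp: d_def)
    then show ?thesis using third[OF T(2,3)] that unfolding d_def by blast
  qed
  have t0: "t \<noteq> 0"
  proof
    assume "t = 0" then show False using z(2,4) by simp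
  qed
  have t1: "t \<noteq> 1"
  proof
    assume "t = 1" then show False using z(3,4) by (simp add: d_def)
  qed
  define c where "c = (P \<bullet> d) / (d \<bullet> d)"
  \<comment> \<open>The foot of the perpendicular from \<open>a\<close> has parameter
    \<open>c\<close>. Two of the three parameters lie on the same side of it, and the product is
    nonnegative exactly if \<open>s1\<close> lies between \<open>c\<close> and
    \<open>s2\<close>.\<close>
  have "\<exists>s1 s2. s1 \<in> {0, 1, t} \<and> s2 \<in> {0, 1, t} \<and> s1 \<noteq> s2 \<and> 0 \<le> (c - s1) * (s1 - s2)"
  proof -
    have above: "0 \<le> (c - s1) * (s1 - s2)" if "c \<le> s1" "s1 < s2" for s1 s2
      using that by (intro mult_nonpos_nonpos) simp_all
    have below: "0 \<le> (c - s1) * (s1 - s2)" if "s1 \<le> c" "s2 < s1" for s1 s2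
      using that by (intro mult_nonneg_nonneg) simp_all
    have two: "\<exists>s1 s2. s1 \<in> {p, q} \<and> s2 \<in> {p, q} \<and> s1 \<noteq> s2 \<and> 0 \<le> (c - s1) * (s1 - s2)"
      if pq: "p \<noteq> q" "c \<le> p \<and> c \<le> q \<or> p \<le> c \<and> q \<le> c" for p q
    proof (cases "p < q")
      case True
      then show ?thesis using pq above[of p q] below[of q p] by blast
    next
      case False
      then have "q < p" using pq by simp
      then show ?thesis using pq above[of q p] below[of p q] by blast
    qed
    show ?thesis
    proof (cases "c \<le> 0 \<and> c \<le> 1 \<or> 0 \<le> c \<and> 1 \<le> c")
      case True
      then obtain s1 s2 where "s1 \<in> {0, 1}" "s2 \<in> {0, 1}" "s1 \<noteq> s2" "0 \<le> (c - s1) * (s1 - s2)"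
        using two[of 0 1] by (metis zero_neq_one)
      then show ?thesis by blast
    next
      case False
      then consider "c \<le> 0 \<and> c \<le> t \<or> 0 \<le> c \<and> t \<le> c" | "c \<le> 1 \<and> c \<le> t \<or> 1 \<le> c \<and> t \<le> c" by linarith
      then show ?thesis
      proof cases
        case 1 then show ?thesis using two[OF t0[symmetric]] by blast
      next
        case 2 then show ?thesis using two[OF t1[symmetric]] by blast
      qed
    qed
  qed
  then obtain s1 s2 where s: "s1 \<in> {0, 1, t}" "s2 \<in> {0, 1, t}" "s1 \<noteq> s2" "0 \<le> (c - s1) * (s1 - s2)" by blast
  have "y + 1 *\<^sub>R d = x" by (simp add: d_def)
  then have inS: "y + s *\<^sub>R d \<in> S" if "s \<in> {0, 1, t}" for s using that T(2,3) z(1,4) by force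
  define x' y' where "x' = y + s1 *\<^sub>R d" and "y' = y + s2 *\<^sub>R d"
  define P' X' where "P' = a - y'" and "X' = x' - y'"
  have P': "P' = P - s2 *\<^sub>R d" by (simp add: P'_def P_def y'_def)
  have X': "X' = (s1 - s2) *\<^sub>R d" by (simp add: X'_def x'_def y'_def algebra_simps)
  have N': "N P' X' = (s1 - s2)\<^sup>2 * N P d" unfolding P' X' by (rule N_shift)
  have XX: "X' \<bullet> X' = (s1 - s2)\<^sup>2 * (d \<bullet> d)" by (simp add: X' power2_eq_square)
  have X0: "X' \<bullet> X' > 0" using XX s(3) dd by simp
  have N0: "N P' X' > 0" using N' s(3) T(5) by simp
  have fm: "f m = N P' X' / (X' \<bullet> X')" using N' XX s(3) by (simp add: f_def ayx P_def d_def)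
  have "P' \<bullet> X' - X' \<bullet> X' = (s1 - s2) * (P \<bullet> d - s1 * (d \<bullet> d))"
    by (simp add: P' X' inner_diff_left algebra_simps)
  also have "P \<bullet> d = c * (d \<bullet> d)" using dd by (simp add: c_def)
  finally have "P' \<bullet> X' - X' \<bullet> X' = ((c - s1) * (s1 - s2)) * (d \<bullet> d)" by (simp add: algebra_simps)
  \<comment> \<open>The triangle \<open>a\<close>, \<open>x'\<close>, \<open>y'\<close> has no acute
    angle at \<open>x'\<close>, so its side from \<open>y'\<close> to \<open>a\<close> is longer
    than that from \<open>y'\<close> to \<open>x'\<close> and carries the smaller height.\<close>
  then have PX: "P' \<bullet> X' \<ge> X' \<bullet> X'" using mult_nonneg_nonneg[OF s(4), of "d \<bullet> d"] dd by simp
  then have "(P' \<bullet> X')\<^sup>2 \<ge> (X' \<bullet> X') * (X' \<bullet> X')"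
    unfolding power2_eq_square using X0 PX by (intro mult_mono) linarith+
  then have "(P' \<bullet> P') * (X' \<bullet> X') > (X' \<bullet> X') * (X' \<bullet> X')" using N0 unfolding N_def by linarith
  then have PP: "P' \<bullet> P' > X' \<bullet> X'" using X0 by simp
  have xy: "x' \<in> S" "y' \<in> S" unfolding x'_def y'_def using inS s(1,2) by blast+
  have PP0: "P' \<bullet> P' > 0" using PP X0 by linarith
  then have "P' \<noteq> 0" by force
  then have "a \<noteq> y'" by (simp add: P'_def)
  moreover have "N X' P' > 0" using N0 N_sym by simp
  ultimately have "(x', y', a) \<in> T" using xy T(1) by (simp add: T_def P'_def X'_def)
  then have "f m \<le> f (x', y', a)" using m(2) by blast
  also have "\<dots> = N P' X' / (P' \<bullet> P')" using N_sym[of X' P'] by (simp add: f_def P'_def X'_def)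
  also have "\<dots> < N P' X' / (X' \<bullet> X')" using PP N0 by (intro divide_strict_left_mono mult_pos_pos PP0 X0)
  finally show False using fm by simp
qed

text \<open>If all edges of a polygon except those in two directions had opposite edges of the same length,
  the translations matching the arcs of directions between the two would all coincide.\<close>

lemma polygon_third_edge:
  fixes K :: "'a::euclidean_space set"
  assumes K: "exposed_points K" and d: "ddim K = 2" and nc: "\<not> csym K"
    and w: "dirs K = span {w1, w2}" "w1 \<notin> span {w2}" "w2 \<notin> span {w1}"
  shows "\<exists>w\<in>dirs K. w \<notin> span {w1} \<and> w \<notin> span {w2} \<and> \<not> tface K w \<doteq> tface (neg K) w"
proof (rule ccontr)
  assume no: "\<not> ?thesis"
  let ?W = "neg K"
  have fin: "finite K" "K \<noteq> {}" "finite ?W" using K by (auto simp: exposed_points_def)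
  have W: "exposed_points ?W" by (rule exposed_points_neg[OF K])
  have in1: "a *\<^sub>R w1 + b *\<^sub>R w2 \<in> dirs K" for a b
    unfolding w(1) by (intro span_add span_scale) (simp_all add: span_base)
  have good: "tface K (a *\<^sub>R w1 + b *\<^sub>R w2) \<doteq> tface ?W (a *\<^sub>R w1 + b *\<^sub>R w2)" if ab: "a \<noteq> 0" "b \<noteq> 0" for a b
  proof (rule ccontr)
    let ?u = "a *\<^sub>R w1 + b *\<^sub>R w2"
    assume ng: "\<not> tface K ?u \<doteq> tface ?W ?u"
    have "?u \<notin> span {w1}"
    proof
      assume "?u \<in> span {w1}"
      then have "?u - a *\<^sub>R w1 \<in> span {w1}" by (intro span_diff span_scale) (simp_all add: span_base)
      then have "b *\<^sub>R w2 \<in> span {w1}" by simp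
      from span_scale[OF this, of "inverse b"]
      show False using ab w(3) by simp
    qed
    moreover have "?u \<notin> span {w2}"
    proof
      assume "?u \<in> span {w2}"
      then have "?u - b *\<^sub>R w2 \<in> span {w2}" by (intro span_diff span_scale) (simp_all add: span_base)
      then have "a *\<^sub>R w1 \<in> span {w2}" by simp
      from span_scale[OF this, of "inverse a"]
      show False using ab w(2) by simp
    qed
    ultimately show False using no in1 ng by blast
  qed
  \<comment> \<open>An open quadrant with respect to \<open>w1\<close> and \<open>w2\<close> is
    convex and free of exceptional directions, so a single vector serves for all of it. The sign of
    \<open>j\<close> selects the quadrant.\<close>
  have quadrant: "tface ?W (a *\<^sub>R w1 + b *\<^sub>R w2) = (+) t ` tface K (a *\<^sub>R w1 + b *\<^sub>R w2)"
    if t: "tface ?W (w1 + j *\<^sub>R w2) = (+) t ` tface K (w1 + j *\<^sub>R w2)" and ab: "a > 0" "b * j > 0" for a b j t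
  proof (rule translation_propagate[OF fin _ t])
    show "tface K (a *\<^sub>R w1 + b *\<^sub>R w2) \<doteq> tface ?W (a *\<^sub>R w1 + b *\<^sub>R w2)"
      using ab by (intro good) auto
    fix s :: real assume s: "0 < s" "s < 1"
    let ?a = "(1 - s) + s * a" and ?b = "(1 - s) * j + s * b"
    have eq: "w1 + j *\<^sub>R w2 + s *\<^sub>R ((a *\<^sub>R w1 + b *\<^sub>R w2) - (w1 + j *\<^sub>R w2)) = ?a *\<^sub>R w1 + ?b *\<^sub>R w2"
      by (simp add: algebra_simps)
    have "?a > 0" using s ab by (simp add: add_pos_pos)
    moreover have "?b * j = (1 - s) * (j * j) + s * (b * j)" by (simp add: algebra_simps)
    then have "?b * j > 0" using s ab by (simp add: add_nonneg_pos)
    then have "?b \<noteq> 0" by auto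
    ultimately show "tface K (w1 + j *\<^sub>R w2 + s *\<^sub>R ((a *\<^sub>R w1 + b *\<^sub>R w2) - (w1 + j *\<^sub>R w2))) \<doteq>
      tface ?W (w1 + j *\<^sub>R w2 + s *\<^sub>R ((a *\<^sub>R w1 + b *\<^sub>R w2) - (w1 + j *\<^sub>R w2)))"
      unfolding eq by (intro good) auto
  qed
  \<comment> \<open>As \<open>?W\<close> is \<open>- K\<close>, a vector valid at \<open>u\<close>
    is valid at \<open>- u\<close>; four quadrants need only two vectors.\<close>
  have antipodal: "tface ?W (- u) = (+) t ` tface K (- u)" if "tface ?W u = (+) t ` tface K u" for t u
  proof -
    have "tface K (- u) = neg (tface ?W u)" by (simp add: tface_neg)
    also have "\<dots> = (+) (- t) ` neg (tface K u)" unfolding that neg_translate ..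
    also have "neg (tface K u) = tface ?W (- u)" by (simp add: tface_neg)
    finally show ?thesis by (simp add: image_image)
  qed
  obtain t1 where t1: "tface ?W (w1 + 1 *\<^sub>R w2) = (+) t1 ` tface K (w1 + 1 *\<^sub>R w2)"
    using good[of 1 1] by (auto simp: translate_of_def)
  obtain t2 where t2: "tface ?W (w1 + (- 1) *\<^sub>R w2) = (+) t2 ` tface K (w1 + (- 1) *\<^sub>R w2)"
    using good[of 1 "- 1"] by (auto simp: translate_of_def)
  have q1: "tface ?W (a *\<^sub>R w1 + b *\<^sub>R w2) = (+) t1 ` tface K (a *\<^sub>R w1 + b *\<^sub>R w2)" if "a * b > 0" for a b
  proof (cases "a > 0")
    case True then show ?thesis using quadrant[OF t1] that by (simp add: zero_less_mult_iff)
  next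
    case False
    then have "- a > 0" "- b > 0" using that by (auto simp: zero_less_mult_iff)
    then have "tface ?W ((- a) *\<^sub>R w1 + (- b) *\<^sub>R w2) = (+) t1 ` tface K ((- a) *\<^sub>R w1 + (- b) *\<^sub>R w2)"
      by (intro quadrant[OF t1]) simp_all
    then show ?thesis using antipodal[of "(- a) *\<^sub>R w1 + (- b) *\<^sub>R w2" t1] by (simp add: add.commute)
  qed
  have q2: "tface ?W (a *\<^sub>R w1 + b *\<^sub>R w2) = (+) t2 ` tface K (a *\<^sub>R w1 + b *\<^sub>R w2)" if "a * b < 0" for a b
  proof (cases "a > 0")
    case True then show ?thesis using quadrant[OF t2] that by (simp add: mult_less_0_iff)
  next
    case False
    then have "- a > 0" "- b < 0" using that by (auto simp: mult_less_0_iff)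
    then have "tface ?W ((- a) *\<^sub>R w1 + (- b) *\<^sub>R w2) = (+) t2 ` tface K ((- a) *\<^sub>R w1 + (- b) *\<^sub>R w2)"
      by (intro quadrant[OF t2]) simp_all
    then show ?thesis using antipodal[of "(- a) *\<^sub>R w1 + (- b) *\<^sub>R w2" t2] by (simp add: add.commute)
  qed
  have limit: "tface (tface ?W p) r = (+) t ` tface (tface K p) r"
    if "\<And>e. e > 0 \<Longrightarrow> tface ?W (p + e *\<^sub>R r) = (+) t ` tface K (p + e *\<^sub>R r)" for p r t
  proof -
    obtain e where "e > 0" "\<forall>s. 0 < s \<and> s < e \<longrightarrow> tface K (p + s *\<^sub>R r) = tface (tface K p) r \<and>
      tface ?W (p + s *\<^sub>R r) = tface (tface ?W p) r"
      using tface_tface_eq2[OF fin(1,3), of p r] by blast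
    then show ?thesis using that[of "e / 2"] by simp
  qed
  \<comment> \<open>The limits from two quadrants adjacent at \<open>p\<close> lie in one face at
    \<open>p\<close>, so the vectors differ orthogonally to \<open>p\<close>. Orthogonal to both
    \<open>w1\<close> and \<open>w2\<close>, the difference vanishes.\<close>
  have orth: "p \<bullet> (t1 - t2) = 0 \<and> t1 - t2 \<in> dirs K"
    if a: "tface (tface ?W p) r = (+) t1 ` tface (tface K p) r"
      and b: "tface (tface ?W p) r' = (+) t2 ` tface (tface K p) r'" for p r r'
  proof -
    have ne: "tface (tface K p) s \<noteq> {}" for s using fin finite_tface tface_nonempty by metis
    obtain x1 where x1: "x1 \<in> tface (tface K p) r" using ne by blast
    obtain x2 where x2: "x2 \<in> tface (tface K p) r'" using ne by blast
    have "t1 + x1 \<in> tface ?W p" "t2 + x2 \<in> tface ?W p"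
      using x1 x2 a b tface_subset by blast+
    then have dW: "(t1 + x1) - (t2 + x2) \<in> dirs (tface ?W p)" by (rule diff_in_dirs)
    have "x1 \<in> tface K p" "x2 \<in> tface K p" using x1 x2 tface_subset by blast+
    then have dK: "x1 - x2 \<in> dirs (tface K p)" by (rule diff_in_dirs)
    have eq: "t1 - t2 = ((t1 + x1) - (t2 + x2)) - (x1 - x2)" by simp
    have "p \<bullet> (t1 - t2) = 0"
      unfolding eq using tface_orth[OF dW] tface_orth[OF dK] by (simp only: inner_diff_right)
    moreover have "t1 - t2 \<in> dirs K"
    proof -
      have "(t1 + x1) - (t2 + x2) \<in> dirs K" using dW dirs_tface_subset[of ?W p] by auto
      moreover have "x1 - x2 \<in> dirs K" using dK dirs_tface_subset[of K p] by auto
      ultimately show ?thesis unfolding eq by (rule subspace_diff[OF subspace_dirs])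
    qed
    ultimately show ?thesis by blast
  qed
  have o1: "w1 \<bullet> (t1 - t2) = 0 \<and> t1 - t2 \<in> dirs K"
  proof (rule orth[of w1 w2 "- w2"])
    show "tface (tface ?W w1) w2 = (+) t1 ` tface (tface K w1) w2"
      using q1[of 1] by (intro limit) simp
    show "tface (tface ?W w1) (- w2) = (+) t2 ` tface (tface K w1) (- w2)"
    proof (rule limit)
      fix e :: real assume "e > 0"
      then show "tface ?W (w1 + e *\<^sub>R - w2) = (+) t2 ` tface K (w1 + e *\<^sub>R - w2)" using q2[of 1 "- e"] by simp
    qed
  qed
  have o2: "w2 \<bullet> (t1 - t2) = 0 \<and> t1 - t2 \<in> dirs K"
  proof (rule orth[of w2 w1 "- w1"])
    show "tface (tface ?W w2) w1 = (+) t1 ` tface (tface K w2) w1"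
    proof (rule limit)
      fix e :: real assume "e > 0"
      then show "tface ?W (w2 + e *\<^sub>R w1) = (+) t1 ` tface K (w2 + e *\<^sub>R w1)" using q1[of e 1] by (simp add: add.commute)
    qed
    show "tface (tface ?W w2) (- w1) = (+) t2 ` tface (tface K w2) (- w1)"
    proof (rule limit)
      fix e :: real assume "e > 0"
      then show "tface ?W (w2 + e *\<^sub>R - w1) = (+) t2 ` tface K (w2 + e *\<^sub>R - w1)"
        using q2[of "- e" 1] by (simp add: add.commute)
    qed
  qed
  have "t1 - t2 \<in> span {w1, w2}" using o1 w(1) by simp
  then obtain a where "t1 - t2 - a *\<^sub>R w1 \<in> span {w2}" using span_breakdown_eq[of "t1 - t2" w1 "{w2}"] by blast
  then obtain b where "t1 - t2 - a *\<^sub>R w1 = b *\<^sub>R w2" by (auto simp: span_singleton)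
  then have tab: "t1 - t2 = a *\<^sub>R w1 + b *\<^sub>R w2" by (metis add.commute diff_add_cancel)
  have "(t1 - t2) \<bullet> (t1 - t2) = (a *\<^sub>R w1 + b *\<^sub>R w2) \<bullet> (t1 - t2)"
    by (rule arg_cong[OF tab, of "\<lambda>x. x \<bullet> (t1 - t2)"])
  also have "\<dots> = 0" using o1 o2 by (simp add: inner_add_left)
  finally have t: "t1 = t2" by simp
  have generic: "tface ?W (a *\<^sub>R w1 + b *\<^sub>R w2) = (+) t1 ` tface K (a *\<^sub>R w1 + b *\<^sub>R w2)"
    if "a \<noteq> 0" "b \<noteq> 0" for a b
  proof (cases "a * b > 0")
    case True then show ?thesis by (rule q1)
  next
    case False
    moreover have "a * b \<noteq> 0" using that by simp
    ultimately have "a * b < 0" by linarith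
    then show ?thesis unfolding t by (rule q2)
  qed
  \<comment> \<open>Nudging \<open>u\<close> along \<open>w1 + w2\<close> reaches a direction off
    the two exceptional lines, as only two values of \<open>s\<close> must be avoided. A face that
    is a single vertex is not changed by the nudge.\<close>
  have perturb: "tface (tface ?W u) (w1 + w2) = (+) t1 ` tface (tface K u) (w1 + w2)" if u: "u \<in> dirs K" for u
  proof -
    obtain a where "u - a *\<^sub>R w1 \<in> span {w2}" using u w(1) span_breakdown_eq[of u w1 "{w2}"] by blast
    then obtain b where "u - a *\<^sub>R w1 = b *\<^sub>R w2" by (auto simp: span_singleton)
    then have ub: "u = a *\<^sub>R w1 + b *\<^sub>R w2" by (metis add.commute diff_add_cancel)
    obtain e where e: "e > 0" "\<forall>s. 0 < s \<and> s < e \<longrightarrow>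
      tface K (u + s *\<^sub>R (w1 + w2)) = tface (tface K u) (w1 + w2) \<and>
      tface ?W (u + s *\<^sub>R (w1 + w2)) = tface (tface ?W u) (w1 + w2)"
      using tface_tface_eq2[OF fin(1,3), of u "w1 + w2"] by blast
    have "infinite ({0<..<e} - {- a, - b})" using e(1) infinite_Ioo by simp
    then have "{0<..<e} - {- a, - b} \<noteq> {}" by (rule infinite_imp_nonempty)
    then obtain s where "s \<in> {0<..<e} - {- a, - b}" by blast
    then have s: "0 < s" "s < e" "s \<noteq> - a" "s \<noteq> - b" by simp_all
    have eq: "u + s *\<^sub>R (w1 + w2) = (a + s) *\<^sub>R w1 + (b + s) *\<^sub>R w2" by (simp add: ub algebra_simps)
    have "a + s \<noteq> 0" "b + s \<noteq> 0" using s(3,4) by linarith+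
    then have "tface ?W (u + s *\<^sub>R (w1 + w2)) = (+) t1 ` tface K (u + s *\<^sub>R (w1 + w2))"
      unfolding eq by (rule generic)
    then show ?thesis using e(2) s(1,2) by simp
  qed
  have single: "tface {x} r = {x}" for x r :: 'a unfolding tface_def by blast
  have dW: "0 < ddim ?W" and dK: "0 < ddim K" using d by simp_all
  have "?W \<subseteq> (+) t1 ` K"
  proof
    fix y assume y: "y \<in> ?W"
    obtain u where u: "u \<in> dirs ?W" "tface ?W u = {y}" using exposed_in_dirs[OF W dW y] by blast
    have "{y} = (+) t1 ` tface (tface K u) (w1 + w2)"
      using perturb[of u] u(1) unfolding u(2) single by simp
    then have "y \<in> (+) t1 ` tface (tface K u) (w1 + w2)" by blast
    then show "y \<in> (+) t1 ` K" using tface_subset by blast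
  qed
  moreover have "(+) t1 ` K \<subseteq> ?W"
  proof
    fix y assume "y \<in> (+) t1 ` K"
    then obtain x where x: "x \<in> K" "y = t1 + x" by blast
    obtain u where u: "u \<in> dirs K" "tface K u = {x}" using exposed_in_dirs[OF K dK x(1)] by blast
    have "tface (tface ?W u) (w1 + w2) = {y}"
      using perturb[OF u(1)] unfolding u(2) single x(2) by simp
    then have "y \<in> tface (tface ?W u) (w1 + w2)" by blast
    then show "y \<in> ?W" using tface_subset by blast
  qed
  ultimately have "?W = (+) t1 ` K" by blast
  then have "csym K" unfolding csym_def translate_of_def by blast
  then show False using nc by blast
qed

lemma ridge_dirs_opposite:
  fixes V :: "'a::euclidean_space set"
  assumes fin: "finite V" and V: "facets_csym_or_opposite V" and p: "p \<in> dirs V" "p \<noteq> 0"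
    and d: "ddim V = Suc (Suc (ddim (tface V p)))" and le: "ddim (tface (neg V) p) \<le> ddim (tface V p)"
  shows "dirs (tface (neg V) p) = dirs (tface V p)"
proof -
  have "Suc (ddim (tface V p)) < ddim V" using d by simp
  then obtain w where w: "w \<in> dirs V" "w \<noteq> 0" "w \<bullet> p = 0" "\<And>x. x \<in> dirs (tface V p) \<Longrightarrow> w \<bullet> x = 0"
    using orth_dirs_exists[OF p(1) tface_subset] by blast
  have "dirs (tface V p) = dirs (tface (tface (neg V) p) w)"
    using translate_pm_dirs[OF ridge_opposite[OF fin V p d w]] .
  also have "\<dots> \<subseteq> dirs (tface (neg V) p)" by (rule dirs_tface_subset)
  finally show ?thesis using dirs_eq_of_ddim[OF _ le] by blast
qed

lemma ddim_one_span:
  assumes "ddim X = 1" obtains e where "e \<noteq> 0" "dirs X = span {e}"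
proof -
  obtain e where e: "e \<in> dirs X" "e \<noteq> 0" using assms unfolding ddim_def
    by (metis dim_eq_0 subsetI singletonI zero_neq_one)
  have "span {e} \<subseteq> dirs X" by (rule span_minimal) (use e in simp_all)
  moreover have "dim (span {e}) = dim (dirs X)" using assms e(2) by (simp add: ddim_def)
  ultimately have "span {e} = dirs X" using subspace_dim_equal[of "span {e}" "dirs X"] by simp
  then show thesis using that e by blast
qed

lemma span_pair_eq:
  fixes S :: "'a::euclidean_space set"
  assumes "subspace S" "dim S \<le> 2" "a \<in> S" "b \<in> S" "b \<noteq> 0" "a \<notin> span {b}"
  shows "S = span {a, b}"
proof -
  have "a \<noteq> b" using assms(6) span_base[of b "{b}"] by blast
  have "independent {a, b}" using assms(5,6) by (simp add: independent_insert)
  then have "dim (span {a, b}) = 2" using \<open>a \<noteq> b\<close> by (simp add: dim_eq_card_independent)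
  moreover have "span {a, b} \<subseteq> S" using assms by (intro span_minimal) simp_all
  ultimately show ?thesis using subspace_dim_equal[of "span {a, b}" S] assms(1,2) by simp
qed

text \<open>If the edges at opposite directions were not parallel, then travelling along the great circle
  perpendicular to both, one could only meet facets, at which either edge is reflected. But after half a
  turn the two edges are exchanged.\<close>

lemma no_saddle:
  fixes V :: "'a::euclidean_space set"
  assumes exp: "exposed_points V" and V: "facets_csym_or_opposite V" and d: "ddim V = 4"
    and u: "u \<in> dirs V" "u \<noteq> 0" and dX: "ddim (tface V u) = 1" and dY: "ddim (tface (neg V) u) = 1"
  shows "dirs (tface V u) = dirs (tface (neg V) u)"
proof (rule ccontr)
  let ?X = "tface V u" and ?W = "neg V" and ?Y = "tface (neg V) u"
  assume ne: "dirs ?X \<noteq> dirs ?Y"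
  have fin: "finite V" "V \<noteq> {}" and finW: "finite ?W" "?W \<noteq> {}" using exp by (auto simp: exposed_points_def)
  note W = facets_csym_or_opposite_neg[OF V]
  have csX: "csym ?X" using csym_dim_one exposed_points_tface exp dX by blast
  have csY: "csym ?Y" using csym_dim_one exposed_points_tface exposed_points_neg exp dY by blast
  have XY: "\<not> ?X \<doteq> ?Y" using ne translate_of_dirs by blast
  obtain e1 where e1: "e1 \<noteq> 0" "dirs ?X = span {e1}" using ddim_one_span[OF dX] by blast
  obtain e2 where e2: "e2 \<noteq> 0" "dirs ?Y = span {e2}" using ddim_one_span[OF dY] by blast
  have e12: "e1 \<notin> span {e2}"
  proof
    assume "e1 \<in> span {e2}"
    then have "dirs ?X \<subseteq> dirs ?Y" unfolding e1(2) e2(2) by (intro span_minimal) auto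
    then show False using ne dirs_eq_of_ddim[of ?X ?Y] dX dY by simp
  qed
  have plane: "dirs A = span {e1, e2}" if "ddim A = 2" "dirs ?X \<subseteq> dirs A" "dirs ?Y \<subseteq> dirs A" for A
    using that e1 e2 e12 span_base[of e1 "{e1}"] span_base[of e2 "{e2}"]
    by (intro span_pair_eq) (auto simp: ddim_def)
  have subX: "dirs ?X \<subseteq> dirs V" by (rule dirs_tface_subset)
  have subY: "dirs ?Y \<subseteq> dirs V" using dirs_tface_subset[of ?W u] by simp
  have e12V: "e1 \<in> dirs V" "e2 \<in> dirs V"
    using subX subY e1 e2 span_base[of e1 "{e1}"] span_base[of e2 "{e2}"] by auto
  have "card {u, e1, e2} \<le> 3" by (simp add: card_insert_if)
  then have "dim {u, e1, e2} < dim (dirs V)"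
    using dim_le_card'[of "{u, e1, e2}"] d by (simp add: ddim_def)
  then obtain w where w: "w \<in> dirs V" "w \<noteq> 0" "\<And>x. x \<in> {u, e1, e2} \<Longrightarrow> w \<bullet> x = 0"
    using orth_exists[of "dirs V" "{u, e1, e2}"] u e12V by auto
  \<comment> \<open>The two edges span two of the four dimensions, so \<open>C\<close> is the plane
    of the circle.\<close>
  define C where "C = {x. x \<in> dirs V \<and> e1 \<bullet> x = 0 \<and> e2 \<bullet> x = 0}"
  have "C = dirs V \<inter> ({x. e1 \<bullet> x = 0} \<inter> {x. e2 \<bullet> x = 0})" by (auto simp: C_def)
  then have C: "subspace C" by (simp add: subspace_inter subspace_hyperplane)
  have uX: "e1 \<bullet> u = 0" "e2 \<bullet> u = 0"
    using tface_orth[of e1 V u] tface_orth[of e2 ?W u] e1 e2 by (simp_all add: span_base inner_commute)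
  have uC: "u \<in> C" using u uX by (simp add: C_def)
  have wC: "w \<in> C" using w by (simp add: C_def inner_commute)
  have orthX: "r \<bullet> x = 0" if "r \<in> C" "x \<in> span {e1, e2}" for r x
  proof -
    have "r \<bullet> e1 = 0" "r \<bullet> e2 = 0" using that(1) by (simp_all add: C_def inner_commute)
    then have "span {e1, e2} \<subseteq> {x. r \<bullet> x = 0}"
      by (intro span_minimal) (simp_all add: subspace_hyperplane)
    then show ?thesis using that(2) by blast
  qed
  define Q where "Q A B \<longleftrightarrow> ?X \<doteq> A \<and> ?Y \<doteq> B" for A B
  have step: "Q (tface (tface V p) (- r)) (tface (tface ?W p) (- r))"
    if p: "p \<in> C" "p \<noteq> 0" and r: "r \<in> C" and Q: "Q (tface (tface V p) r) (tface (tface ?W p) r)" for p r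
  proof -
    have pV: "p \<in> dirs V" "p \<in> dirs ?W" using p(1) by (simp_all add: C_def)
    have QX: "?X \<doteq> tface (tface V p) r" and QY: "?Y \<doteq> tface (tface ?W p) r" using Q by (simp_all add: Q_def)
    have nog: "\<not> tface V p \<doteq> tface ?W p"
      using XY QX QY translate_of_tface translate_of_trans translate_of_sym by metis
    have nog': "\<not> tface ?W p \<doteq> tface (neg ?W) p" using nog translate_of_sym by auto
    have dirX: "dirs ?X \<subseteq> dirs (tface V p)" and dirY: "dirs ?Y \<subseteq> dirs (tface ?W p)"
      using translate_of_dirs[OF QX] translate_of_dirs[OF QY] dirs_tface_subset by blast+
    have lt: "ddim (tface V p) < 4" "ddim (tface ?W p) < 4"
      using ddim_tface_less[OF pV(1) p(2)] ddim_tface_less[OF pV(2) p(2)] d by simp_all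
    have iff: "Suc (ddim (tface ?W p)) = ddim V \<longleftrightarrow> Suc (ddim (tface V p)) = ddim V"
      using facet_opposite_iff[OF fin V _ pV(1) p(2)] d by simp
    show ?thesis
    proof (cases "Suc (ddim (tface V p)) = ddim V")
      case True
      have "csym (tface V p)" using facets_csym_or_oppositeD[OF V pV(1) p(2) True nog] .
      then have "tface (tface V p) (- r) \<doteq> neg (tface (tface V p) r)" by (rule csym_tface)
      also have "\<dots> \<doteq> neg ?X" using QX translate_of_neg translate_of_sym by blast
      also have "neg ?X \<doteq> ?X" using csX translate_of_sym by (auto simp: csym_def)
      finally have 1: "?X \<doteq> tface (tface V p) (- r)" by (rule translate_of_sym)
      have "csym (tface ?W p)"
        using facets_csym_or_oppositeD[OF W pV(2) p(2) _ nog'] iff True by simp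
      then have "tface (tface ?W p) (- r) \<doteq> neg (tface (tface ?W p) r)" by (rule csym_tface)
      also have "\<dots> \<doteq> neg ?Y" using QY translate_of_neg translate_of_sym by blast
      also have "neg ?Y \<doteq> ?Y" using csY translate_of_sym by (auto simp: csym_def)
      finally have 2: "?Y \<doteq> tface (tface ?W p) (- r)" by (rule translate_of_sym)
      show ?thesis using 1 2 by (simp add: Q_def)
    next
      case False
      have le: "ddim (tface V p) \<le> 2" "ddim (tface ?W p) \<le> 2" using False iff lt d by auto
      \<comment> \<open>A two-dimensional face met here has direction space
        \<open>span {e1, e2}\<close>, so every \<open>r\<close> in \<open>C\<close> is constant on
        it and its face towards \<open>r\<close> is not an edge.\<close>
      have n2: "ddim (tface V p) \<noteq> 2"
      proof
        assume 2: "ddim (tface V p) = 2"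
        have "dirs (tface ?W p) = dirs (tface V p)"
          using ridge_dirs_opposite[OF fin(1) V pV(1) p(2)] 2 le d by simp
        then have "dirs (tface V p) = span {e1, e2}" using plane[OF 2 dirX] dirY by simp
        then have "tface (tface V p) r = tface V p" using tface_orth_eq orthX[OF r] by blast
        then show False using translate_of_ddim[OF QX] dX 2 by simp
      qed
      have n2': "ddim (tface ?W p) \<noteq> 2"
      proof
        assume 2: "ddim (tface ?W p) = 2"
        have "dirs (tface (neg ?W) p) = dirs (tface ?W p)"
          by (rule ridge_dirs_opposite[OF finW(1) W pV(2) p(2)]) (use 2 le d in simp_all)
        then have "dirs (tface ?W p) = span {e1, e2}" using plane[OF 2 _ dirY] dirX by simp
        then have "tface (tface ?W p) r = tface ?W p" using tface_orth_eq orthX[OF r] by blast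
        then show False using translate_of_ddim[OF QY] dY 2 by simp
      qed
      have "ddim (tface V p) \<le> ddim (tface (tface V p) r)" "ddim (tface ?W p) \<le> ddim (tface (tface ?W p) r)"
        using le n2 n2' translate_of_ddim[OF QX] translate_of_ddim[OF QY] dX dY by simp_all
      from tface_flat[OF this(1)] tface_flat[OF this(2)] show ?thesis using Q by simp
    qed
  qed
  have "tface ?X w = ?X" "tface ?Y w = ?Y"
    using orthX[OF wC] e1(2) e2(2) span_mono[of "{e1}" "{e1, e2}"] span_mono[of "{e2}" "{e1, e2}"]
    by (intro tface_orth_eq; blast)+
  then have start: "Q (tface ?X w) (tface ?Y w)" by (simp add: Q_def)
  have "Q (tface (tface V (- u)) w) (tface (tface ?W (- u)) w)"
    by (rule circle_propagate[where C = C and u = u])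
      (use fin C uC wC u w step start in \<open>simp_all add: inner_commute\<close>)
  then have "?X \<doteq> neg (tface ?Y (- w))" by (simp add: Q_def tface_neg)
  then have 1: "neg ?X \<doteq> tface ?Y (- w)" using translate_of_neg' by blast
  have 2: "?Y \<doteq> tface ?Y (- w)" using step[OF uC u(2) wC start] by (simp add: Q_def)
  have "?X \<doteq> neg ?X" using csX by (simp add: csym_def)
  then have "?X \<doteq> ?Y" using 1 2 translate_of_trans translate_of_sym by blast
  then show False using XY by blast
qed

text \<open>Provides an affine chart of a projective space that contains finitely many given points.
  Each new vector is added with a factor that avoids finitely many bad values.\<close>

lemma exists_nonorthogonal:
  fixes B :: "'a::euclidean_space set"
  assumes "finite B" "0 \<notin> B" shows "\<exists>f. \<forall>b\<in>B. f \<bullet> b \<noteq> 0"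
  using assms
proof (induction rule: finite_induct)
  case empty then show ?case by simp
next
  case (insert e B)
  then obtain f where f: "\<forall>b\<in>B. f \<bullet> b \<noteq> 0" by auto
  have e: "e \<bullet> e \<noteq> 0" using insert.prems by auto
  let ?N = "(\<lambda>b. - (f \<bullet> b) / (e \<bullet> b)) ` insert e B"
  have "finite ?N" using insert.hyps by simp
  then have "infinite ({0<..<1::real} - ?N)" by (intro Diff_infinite_finite infinite_Ioo) simp_all
  then have "{0<..<1::real} - ?N \<noteq> {}" by (rule infinite_imp_nonempty)
  then obtain s where "s \<in> {0<..<1::real} - ?N" by blast
  then have s: "0 < s" "s \<notin> ?N" by (simp_all only: Diff_iff greaterThanLessThan_iff not_False_eq_True)
  have "(f + s *\<^sub>R e) \<bullet> b \<noteq> 0" if b: "b \<in> insert e B" for b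
  proof
    assume "(f + s *\<^sub>R e) \<bullet> b = 0"
    then have eq: "s * (e \<bullet> b) = - (f \<bullet> b)" by (simp add: inner_add_left)
    show False
    proof (cases "e \<bullet> b = 0")
      case True
      then have "f \<bullet> b = 0" using eq by simp
      then show False using f b e True by auto
    next
      case False
      then have "s = - (f \<bullet> b) / (e \<bullet> b)" using nonzero_mult_div_cancel_right[OF False, of s] eq by metis
      then show False using s(2) b by blast
    qed
  qed
  then show ?case by blast
qed

lemma ddim_zero_singleton:
  assumes "ddim A = 0" "A \<noteq> {}" obtains a where "A = {a}"
proof -
  obtain a where a: "a \<in> A" using assms(2) by blast
  have "dirs A \<subseteq> {0}" using assms(1) by (simp add: ddim_def)
  then have "b = a" if "b \<in> A" for b using diff_in_dirs[OF that a] by auto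
  then have "A = {a}" using a by blast
  then show thesis by (rule that)
qed

lemma ddim_one_points:
  assumes "dirs A = span {e}" "e \<noteq> 0"
  obtains x y k where "x \<in> A" "y \<in> A" "k \<noteq> 0" "x - y = k *\<^sub>R e"
proof -
  have "\<exists>x\<in>A. \<exists>y\<in>A. x \<noteq> y"
  proof (rule ccontr)
    assume no: "\<not> ?thesis"
    have "x - y = 0" if "x \<in> A" "y \<in> A" for x y using no that by (metis right_minus_eq)
    then have "{x - y |x y. x \<in> A \<and> y \<in> A} \<subseteq> {0}" by blast
    then have "dirs A \<subseteq> span {0}" unfolding dirs_def by (rule span_mono)
    then have "e \<in> span {0}" using assms span_base[of e "{e}"] by auto
    then show False using assms(2) by simp
  qed
  then obtain x y where xy: "x \<in> A" "y \<in> A" "x \<noteq> y" by blast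
  then have "x - y \<in> span {e}" using diff_in_dirs assms(1) by blast
  then obtain k where k: "x - y = k *\<^sub>R e" by (auto simp: span_singleton)
  then have "k \<noteq> 0" using xy(3) by auto
  then show thesis using that xy k by blast
qed

text \<open>Walking from one end of a half turn to the other, the initial face has to be left in between.\<close>

lemma exists_break:
  fixes H :: "'a::euclidean_space set"
  assumes fin: "finite H" "H \<noteq> {}" and z: "z \<in> dirs H" "z \<noteq> 0" and w: "w \<noteq> 0" "z \<bullet> w = 0"
  shows "\<exists>p\<in>span {z, w}. p \<notin> span {z} \<and> (\<exists>r.
    tface (tface H p) r = tface (tface H z) w \<and> tface (tface H p) (- r) \<noteq> tface (tface H z) w)"
proof (rule ccontr)
  let ?A = "tface (tface H z) w"
  assume no: "\<not> ?thesis"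
  have flip: "tface (tface H p) (- r) = ?A" if "p \<in> span {z, w}" "p \<notin> span {z}" "tface (tface H p) r = ?A" for p r
    using no that by blast
  define Q where "Q A B \<longleftrightarrow> A = ?A" for A B :: "'a set"
  have corner: "tface (tface H p) (r + c *\<^sub>R p) = tface (tface H p) r" for p r c
    by (rule tface_add_orth) (simp add: tface_orth)
  have notin: "a *\<^sub>R z + b *\<^sub>R w \<in> span {z, w} \<and> a *\<^sub>R z + b *\<^sub>R w \<notin> span {z}" if "b \<noteq> 0" for a b
  proof
    show "a *\<^sub>R z + b *\<^sub>R w \<in> span {z, w}" by (intro span_add span_scale) (simp_all add: span_base)
    show "a *\<^sub>R z + b *\<^sub>R w \<notin> span {z}"
    proof
      assume "a *\<^sub>R z + b *\<^sub>R w \<in> span {z}"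
      then obtain k where "a *\<^sub>R z + b *\<^sub>R w = k *\<^sub>R z" by (auto simp: span_singleton)
      then have "(a *\<^sub>R z + b *\<^sub>R w) \<bullet> w = (k *\<^sub>R z) \<bullet> w" by simp
      then show False using w that by (simp add: inner_add_left)
    qed
  qed
  have seg: "Q (tface (tface H a) (b - a)) (tface (tface H a) (b - a)) \<longleftrightarrow>
      Q (tface (tface H (a + (b - a))) (- (b - a))) (tface (tface H (a + (b - a))) (- (b - a)))"
    if "\<And>t. 0 < t \<Longrightarrow> t < 1 \<Longrightarrow> a + t *\<^sub>R (b - a) \<in> span {z, w} \<and> a + t *\<^sub>R (b - a) \<notin> span {z}" for a b
  proof (rule segment_propagate[OF fin(1) fin(1)])
    fix t :: real assume t: "0 < t" "t < 1"
    let ?p = "a + t *\<^sub>R (b - a)"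
    have p: "?p \<in> span {z, w}" "?p \<notin> span {z}" using that[OF t] by blast+
    show "Q (tface (tface H ?p) (b - a)) (tface (tface H ?p) (b - a)) \<longleftrightarrow>
      Q (tface (tface H ?p) (- (b - a))) (tface (tface H ?p) (- (b - a)))"
      using flip[OF p, of "b - a"] flip[OF p, of "- (b - a)"] unfolding Q_def by (metis minus_minus)
  qed
  \<comment> \<open>The path from \<open>z\<close> over \<open>w\<close> to \<open>- z\<close>
    leaves the line of \<open>z\<close> at once and returns only at its end, so \<open>flip\<close>
    applies in between.\<close>
  have c1: "z + t *\<^sub>R (w - z) \<in> span {z, w} \<and> z + t *\<^sub>R (w - z) \<notin> span {z}" if "0 < t" for t
  proof -
    have "z + t *\<^sub>R (w - z) = (1 - t) *\<^sub>R z + t *\<^sub>R w" by (simp add: algebra_simps)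
    then show ?thesis using notin[of t "1 - t"] that by simp
  qed
  have e: "w + (- z - w) = - z" by simp
  have c2: "w + t *\<^sub>R (- z - w) \<in> span {z, w} \<and> w + t *\<^sub>R (- z - w) \<notin> span {z}" if "t < 1" for t
  proof -
    have "w + t *\<^sub>R (- z - w) = (- t) *\<^sub>R z + (1 - t) *\<^sub>R w" by (simp add: algebra_simps)
    then show ?thesis using notin[of "1 - t" "- t"] that by (metis diff_gt_0_iff_gt less_irrefl)
  qed
  have "Q (tface (tface H z) (w - z)) (tface (tface H z) (w - z))"
    using corner[of z w "- 1"] by (simp add: Q_def)
  then have "Q (tface (tface H (z + (w - z))) (- (w - z))) (tface (tface H (z + (w - z))) (- (w - z)))"
    using seg[of z w, OF c1] by blast
  then have "tface (tface H w) z = ?A" using corner[of w z "- 1"] by (simp add: Q_def)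
  then have "tface (tface H w) (- z) = ?A" using flip[of w z] notin[of 1 0] by simp
  then have "Q (tface (tface H w) (- z - w)) (tface (tface H w) (- z - w))"
    using corner[of w "- z" "- 1"] by (simp add: Q_def)
  then have "Q (tface (tface H (w + (- z - w))) (- (- z - w))) (tface (tface H (w + (- z - w))) (- (- z - w)))"
    using seg[of w "- z", OF c2] by blast
  then have "tface (tface H (- z)) (- (- z - w)) = ?A" unfolding Q_def e .
  then have "?A \<subseteq> tface H (- z)" using tface_subset by metis
  moreover have "?A \<subseteq> tface H z" by (rule tface_subset)
  moreover have "?A \<noteq> {}" using fin finite_tface tface_nonempty by metis
  ultimately show False using tface_antipode[OF z] by blast
qed

section \<open>Opposite facets in dimension four\<close>

lemma span_singleton_scale: "c \<noteq> 0 \<Longrightarrow> span {c *\<^sub>R e} = span {e :: 'a::euclidean_space}"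
proof -
  assume c: "c \<noteq> 0"
  have "span {c *\<^sub>R e} \<subseteq> span {e}" by (intro span_minimal) (simp_all add: span_base span_scale)
  moreover have "inverse c *\<^sub>R (c *\<^sub>R e) \<in> span {c *\<^sub>R e}" by (intro span_scale span_base) simp
  then have "e \<in> span {c *\<^sub>R e}" using c by simp
  then have "span {e} \<subseteq> span {c *\<^sub>R e}" by (intro span_minimal) simp_all
  ultimately show ?thesis by blast
qed

lemma orth_line_in_plane:
  fixes S :: "'a::euclidean_space set"
  assumes S: "subspace S" "dim S \<le> 2" and e: "e \<in> S" "e \<noteq> 0"
    and w: "w \<in> S" "w \<noteq> 0" "w \<bullet> e = 0" and x: "x \<in> S" "x \<bullet> e = 0"
  shows "x \<in> span {w}"
proof -
  have "e \<notin> span {w}"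
  proof
    assume "e \<in> span {w}"
    then obtain k where "e = k *\<^sub>R w" by (auto simp: span_singleton)
    then have "e \<bullet> e = k * (w \<bullet> e)" by simp
    then show False using w(3) e(2) by simp
  qed
  then have "S = span {e, w}" by (intro span_pair_eq S e w)
  then obtain k where k: "x - k *\<^sub>R e \<in> span {w}" using x(1) span_breakdown_eq[of x e "{w}"] by blast
  then obtain l where "x - k *\<^sub>R e = l *\<^sub>R w" by (auto simp: span_singleton)
  then have "(x - k *\<^sub>R e) \<bullet> e = (l *\<^sub>R w) \<bullet> e" by simp
  then have "k = 0" using x(2) w(3) e(2) by (simp add: inner_diff_left)
  then show ?thesis using k by simp
qed

lemma two_dims:
  assumes "e1 \<in> dirs A" "e2 \<in> dirs A" "e2 \<noteq> 0" "e1 \<notin> span {e2}" shows "2 \<le> ddim A"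
proof (rule ccontr)
  assume "\<not> 2 \<le> ddim A"
  then have d: "dim (dirs A) < 2" by (simp add: ddim_def)
  then have "dirs A = span {e1, e2}" using assms by (intro span_pair_eq) simp_all
  moreover have "independent {e1, e2}" using assms by (simp add: independent_insert)
  moreover have "e1 \<noteq> e2" using assms(4) span_base[of e2 "{e2}"] by blast
  ultimately show False using d by (simp add: dim_eq_card_independent)
qed

lemma independent_exists:
  assumes d: "2 \<le> ddim A" and e: "e \<in> dirs A" "e \<noteq> 0"
  shows "\<exists>b\<in>dirs A. b \<notin> span {e} \<and> e \<notin> span {b}"
proof -
  have "dim {e} < dim (dirs A)" using d dim_le_card'[of "{e}"] by (simp add: ddim_def)
  then obtain b where b: "b \<in> dirs A" "b \<noteq> 0" "\<And>x. x \<in> {e} \<Longrightarrow> b \<bullet> x = 0"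
    using orth_exists[of "dirs A" "{e}"] e by auto
  have eb: "b \<bullet> e = 0" using b(3) by simp
  have "b \<notin> span {e}"
  proof
    assume "b \<in> span {e}"
    then obtain k where "b = k *\<^sub>R e" by (auto simp: span_singleton)
    then show False using eb e(2) b(2) by simp
  qed
  moreover have "e \<notin> span {b}"
  proof
    assume "e \<in> span {b}"
    then obtain k where "e = k *\<^sub>R b" by (auto simp: span_singleton)
    then show False using eb e(2) b(2) by simp
  qed
  ultimately show ?thesis using b(1) by blast
qed

text \<open>Models two opposite facets of a 4-polytope that are not translates;
  \<open>no_saddle\<close> is what is kept of the ambient polytope besides the relation between
  \<open>F\<close> and \<open>G\<close>.\<close>

locale csym_pair_3 =
  fixes F G :: "'a::euclidean_space set"
  assumes pair: "csym_pair F G" and expF: "exposed_points F" and expG: "exposed_points G"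
    and dim3: "ddim F = 3"
    and no_saddle: "\<And>z. z \<in> dirs F \<Longrightarrow> z \<noteq> 0 \<Longrightarrow> ddim (tface F z) = 1 \<Longrightarrow> ddim (tface G z) = 1 \<Longrightarrow>
      dirs (tface F z) = dirs (tface G z)"
begin

section \<open>Faces of the three-dimensional pair\<close>

lemma fin: "finite F" "F \<noteq> {}" "finite G" "G \<noteq> {}"
  using pair by (simp_all add: csym_pair_def)

lemma dirs_eq: "dirs G = dirs F"
  using pair by (simp add: csym_pair_def)

lemma dim3G: "ddim G = 3"
  using dirs_eq dim3 by (simp add: ddim_def)

lemma ddim_faces:
  assumes "z \<in> dirs F" "z \<noteq> 0" shows "ddim (tface F z) \<le> 2" "ddim (tface G z) \<le> 2"
  using ddim_tface_less[of z F] ddim_tface_less[of z G] assms dirs_eq dim3 dim3G by simp_all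

lemma facet_pm:
  assumes "z \<in> dirs F" "z \<noteq> 0" "ddim (tface F z) = 2 \<or> ddim (tface G z) = 2"
  shows "tface F z \<doteq> tface G z \<or> neg (tface F z) \<doteq> tface G z"
  using pair assms dim3 unfolding csym_pair_def translate_pm_def by auto

lemma facet_dirs:
  assumes "z \<in> dirs F" "z \<noteq> 0" "ddim (tface F z) = 2 \<or> ddim (tface G z) = 2"
  shows "ddim (tface F z) = 2" "dirs (tface G z) = dirs (tface F z)"
proof -
  have "translate_pm (tface F z) (tface G z)" using facet_pm[OF assms] by (simp add: translate_pm_def)
  then show "dirs (tface G z) = dirs (tface F z)" using translate_pm_dirs by blast
  then show "ddim (tface F z) = 2" using assms(3) by (simp add: ddim_def)
qed

text \<open>On the circle perpendicular to \<open>e\<close>, the edge \<open>X\<close> parallel to \<open>e\<close> is always present in exactly one of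
  \<open>F\<close> and \<open>G\<close>.\<close>

definition unbalanced :: "'a \<Rightarrow> 'a set \<Rightarrow> bool" where
  "unbalanced e X \<longleftrightarrow> (\<forall>z\<in>dirs F. \<forall>w\<in>dirs F. z \<noteq> 0 \<longrightarrow> w \<noteq> 0 \<longrightarrow> z \<bullet> w = 0 \<longrightarrow> z \<bullet> e = 0 \<longrightarrow> w \<bullet> e = 0 \<longrightarrow>
    (X \<doteq> tface (tface F z) w) \<noteq> (X \<doteq> tface (tface G z) w))"

text \<open>Only the line of \<open>e\<close> matters: bad directions are points of the projective
  plane of \<open>dirs F\<close>.\<close>

definition bad :: "'a \<Rightarrow> bool" where
  "bad e \<longleftrightarrow> e \<in> dirs F \<and> e \<noteq> 0 \<and> (\<exists>X. dirs X = span {e} \<and> unbalanced e X)"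

lemma bad_scale:
  assumes "bad e" "c \<noteq> 0" shows "bad (c *\<^sub>R e)"
  using assms unfolding bad_def unbalanced_def
  by (simp add: span_singleton_scale subspace_scale)

text \<open>Crossing a facet on which \<open>F\<close> and \<open>G\<close> disagree swaps the two
  sets and reflects the faces. As \<open>X\<close> is symmetric only the swap is felt, and an
  exclusive or ignores it. At smaller faces \<open>X\<close> can only be the whole face.\<close>

lemma unbalanced_flip:
  assumes X: "csym X" "ddim X = 1" and p: "p \<in> dirs F" "p \<noteq> 0"
    and Q: "(X \<doteq> tface (tface F p) r) \<noteq> (X \<doteq> tface (tface G p) r)"
  shows "(X \<doteq> tface (tface F p) (- r)) \<noteq> (X \<doteq> tface (tface G p) (- r))"
proof (cases "ddim (tface F p) = 2 \<or> ddim (tface G p) = 2")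
  case True
  have "\<not> tface F p \<doteq> tface G p"
  proof
    assume "tface F p \<doteq> tface G p"
    then have "tface (tface F p) r \<doteq> tface (tface G p) r" by (rule translate_of_tface)
    then show False using Q translate_of_cong by blast
  qed
  then have n: "neg (tface F p) \<doteq> tface G p" using facet_pm[OF p True] by blast
  have swap: "X \<doteq> tface (tface G p) s \<longleftrightarrow> X \<doteq> tface (tface F p) (- s)" for s
  proof -
    have "neg (tface (tface F p) (- s)) \<doteq> tface (tface G p) s"
      using translate_of_tface[OF n, of s] by (simp add: tface_neg)
    then have "X \<doteq> tface (tface G p) s \<longleftrightarrow> X \<doteq> neg (tface (tface F p) (- s))"
      using translate_of_cong by blast
    also have "\<dots> \<longleftrightarrow> neg X \<doteq> tface (tface F p) (- s)" by (simp add: translate_of_neg')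
    also have "\<dots> \<longleftrightarrow> X \<doteq> tface (tface F p) (- s)"
      using X(1) translate_of_trans translate_of_sym unfolding csym_def by blast
    finally show ?thesis .
  qed
  show ?thesis using Q swap[of r] swap[of "- r"] by auto
next
  case False
  then have small: "ddim (tface F p) \<le> 1" "ddim (tface G p) \<le> 1" using ddim_faces[OF p] by linarith+
  have flat: "tface A (- s) = tface A s" if A: "ddim A \<le> 1" "X \<doteq> tface A s" for A s
    using tface_flat[of A s] A translate_of_ddim[OF A(2)] X(2) by simp
  show ?thesis
    using Q flat[OF small(1), of r] flat[OF small(1), of "- r"] flat[OF small(2), of r] flat[OF small(2), of "- r"]
    by (metis minus_minus)
qed

lemma in_span_orth:
  assumes e: "e \<in> dirs F" "e \<noteq> 0" and z: "z \<in> dirs F" "z \<noteq> 0" "z \<bullet> e = 0"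
    and w: "w \<in> dirs F" "w \<noteq> 0" "w \<bullet> e = 0" "z \<bullet> w = 0" and x: "x \<in> dirs F" "x \<bullet> e = 0"
  shows "x \<in> span {z, w}"
proof -
  let ?S = "{y \<in> dirs F. e \<bullet> y = 0}"
  have "?S = dirs F \<inter> {y. e \<bullet> y = 0}" by blast
  then have S: "subspace ?S" by (simp add: subspace_inter subspace_hyperplane)
  have "e \<notin> ?S" using e(2) by simp
  then have "?S \<subset> dirs F" using e(1) by blast
  then have "dim ?S < 3" using dim_psubset[of ?S "dirs F"] S dim3
    by (simp add: ddim_def span_eq_iff[THEN iffD2])
  moreover have "z \<notin> span {w}"
  proof
    assume "z \<in> span {w}"
    then obtain k where "z = k *\<^sub>R w" by (auto simp: span_singleton)
    then have "z \<bullet> z = k * (z \<bullet> w)" by (metis inner_scaleR_right)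
    then show False using z(2) w(4) by simp
  qed
  ultimately have "?S = span {z, w}"
    by (intro span_pair_eq S) (use z w in \<open>simp_all add: inner_commute\<close>)
  then show ?thesis using x by (metis (mono_tags, lifting) inner_commute mem_Collect_eq)
qed

text \<open>One frame of the plane orthogonal to \<open>e\<close> suffices, because the exclusive or
  travels to all others.\<close>

lemma badI:
  assumes e: "e \<in> dirs F" "e \<noteq> 0" and X: "dirs X = span {e}" "csym X"
    and z: "z \<in> dirs F" "z \<noteq> 0" "z \<bullet> e = 0" and w: "w \<in> dirs F" "w \<noteq> 0" "w \<bullet> e = 0" "z \<bullet> w = 0"
    and Q: "(X \<doteq> tface (tface F z) w) \<noteq> (X \<doteq> tface (tface G z) w)"
  shows "bad e"
proof -
  have d: "ddim X = 1" using X(1) e(2) by (simp add: ddim_def)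
  have sub: "span {z, w} \<subseteq> dirs F" by (intro span_minimal) (use z w in simp_all)
  have "(X \<doteq> tface (tface F z') w') \<noteq> (X \<doteq> tface (tface G z') w')"
    if z': "z' \<in> dirs F" "z' \<noteq> 0" "z' \<bullet> e = 0" and w': "w' \<in> dirs F" "w' \<noteq> 0" "w' \<bullet> e = 0" "z' \<bullet> w' = 0" for z' w'
  proof -
    define Q' where "Q' A B \<longleftrightarrow> (X \<doteq> A) \<noteq> (X \<doteq> B)" for A B
    have "Q' (tface (tface F z') w') (tface (tface G z') w')"
    proof (rule circle_propagate_all[where u = z and w = w])
      show "Q' (tface (tface F p) (- r)) (tface (tface G p) (- r))"
        if p: "p \<in> span {z, w}" "p \<noteq> 0" and Q: "Q' (tface (tface F p) r) (tface (tface G p) r)" for p r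
        using unbalanced_flip[OF X(2) d _ p(2)] p(1) sub Q unfolding Q'_def by blast
      show "z' \<in> span {z, w}" "w' \<in> span {z, w}"
        using in_span_orth[OF e z w] z' w' by blast+
    qed (use fin z w z' w' Q in \<open>simp_all add: Q'_def\<close>)
    then show ?thesis by (simp add: Q'_def)
  qed
  then show ?thesis using e X(1) unfolding bad_def unbalanced_def by blast
qed

text \<open>\<open>tface G z\<close> is a translate of \<open>- ?K\<close> but not of
  \<open>?K\<close>, so the polygon \<open>?K\<close> is asymmetric and differs from its reflection
  in a direction \<open>w\<close> other than the normals of \<open>e1\<close> and \<open>e2\<close>.
  The edge there is unbalanced.\<close>

lemma bad_third:
  assumes z: "z \<in> dirs F" "z \<noteq> 0" and facet: "ddim (tface F z) = 2" and ng: "\<not> tface F z \<doteq> tface G z"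
    and e1: "e1 \<in> dirs (tface F z)" "e1 \<notin> span {e2}" and e2: "e2 \<in> dirs (tface F z)" "e2 \<notin> span {e1}"
  shows "\<exists>e. bad e \<and> e \<in> dirs (tface F z) \<and> e \<notin> span {e1} \<and> e \<notin> span {e2}"
proof -
  let ?K = "tface F z"
  have e0: "e1 \<noteq> 0" "e2 \<noteq> 0" using e1(2) e2(2) span_zero by metis+
  have n: "neg ?K \<doteq> tface G z" using facet_pm[OF z] facet ng by blast
  have nc: "\<not> csym ?K" using n ng translate_of_trans unfolding csym_def by blast
  have expK: "exposed_points ?K" by (rule exposed_points_tface[OF expF])
  have dK: "dim (dirs ?K) = 2" using facet by (simp add: ddim_def)
  have "\<exists>w\<in>dirs ?K. w \<noteq> 0 \<and> w \<bullet> e = 0" if e: "e \<in> dirs ?K" for e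
  proof -
    have "dim {e} < dim (dirs ?K)" using dK by simp
    then obtain w where "w \<in> dirs ?K" "w \<noteq> 0" "\<And>x. x \<in> {e} \<Longrightarrow> w \<bullet> x = 0"
      using orth_exists[of "dirs ?K" "{e}"] e by auto
    then show ?thesis by blast
  qed
  then obtain w1 w2 where w1: "w1 \<in> dirs ?K" "w1 \<noteq> 0" "w1 \<bullet> e1 = 0"
    and w2: "w2 \<in> dirs ?K" "w2 \<noteq> 0" "w2 \<bullet> e2 = 0" using e1(1) e2(1) by metis
  note plane = orth_line_in_plane[OF subspace_dirs[of ?K]]
  have w12: "w1 \<notin> span {w2}"
  proof
    assume "w1 \<in> span {w2}"
    then obtain k where "w1 = k *\<^sub>R w2" by (auto simp: span_singleton)
    then have "e2 \<bullet> w1 = 0" using w2(3) by (simp add: inner_commute)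
    moreover have "e1 \<bullet> w1 = 0" using w1(3) by (simp add: inner_commute)
    ultimately have "e2 \<in> span {e1}" using plane[of w1 e1 e2] dK w1 e1(1) e2(1) e0 by simp
    then show False using e2(2) by blast
  qed
  then have w21: "w2 \<notin> span {w1}"
  proof -
    have "w1 \<in> span {w2}" if h: "w2 \<in> span {w1}"
    proof -
      obtain k where k: "w2 = k *\<^sub>R w1" using h by (auto simp: span_singleton)
      then have "k \<noteq> 0" using w2(2) by auto
      then show ?thesis using span_singleton_scale[of k w1] k span_base[of w1 "{w1}"] by simp
    qed
    then show ?thesis using w12 by blast
  qed
  have spanK: "dirs ?K = span {w1, w2}" using span_pair_eq[OF subspace_dirs _ w1(1) w2(1,2) w12] dK by simp
  obtain w where w: "w \<in> dirs ?K" "w \<notin> span {w1}" "w \<notin> span {w2}" "\<not> tface ?K w \<doteq> tface (neg ?K) w"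
    using polygon_third_edge[OF expK facet nc spanK w12 w21] by blast
  have w0: "w \<noteq> 0" using w(2) span_zero by blast
  have Gw: "tface (neg ?K) w \<doteq> tface (tface G z) w" by (rule translate_of_tface[OF n])
  \<comment> \<open>One of the two faces may be a vertex, but not both, since single points are
    translates of each other.\<close>
  obtain X where X: "X = tface ?K w \<or> X = tface (neg ?K) w" "ddim X = 1"
  proof -
    have le: "ddim (tface ?K w) \<le> 1" "ddim (tface (neg ?K) w) \<le> 1"
      using ddim_tface_less[of w ?K] ddim_tface_less[of w "neg ?K"] w(1) w0 facet by simp_all
    have ne: "tface ?K w \<noteq> {}" "tface (neg ?K) w \<noteq> {}"
      using fin finite_tface tface_nonempty expK exposed_points_neg[OF expK] unfolding exposed_points_def by metis+
    have "ddim (tface ?K w) = 1 \<or> ddim (tface (neg ?K) w) = 1"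
    proof (rule ccontr)
      assume "\<not> ?thesis"
      then have "ddim (tface ?K w) = 0" "ddim (tface (neg ?K) w) = 0" using le by linarith+
      then obtain a b where "tface ?K w = {a}" "tface (neg ?K) w = {b}"
        using ddim_zero_singleton ne by metis
      then have "tface (neg ?K) w = (+) (b - a) ` tface ?K w" by simp
      then show False using w(4) unfolding translate_of_def by blast
    qed
    then show thesis using that by blast
  qed
  obtain e where e: "e \<noteq> 0" "dirs X = span {e}" using ddim_one_span[OF X(2)] by blast
  have eX: "e \<in> dirs X" using e(2) by (simp add: span_base)
  have "dirs X \<subseteq> dirs ?K" using X(1) dirs_tface_subset[of ?K w] dirs_tface_subset[of "neg ?K" w] by auto
  then have eK: "e \<in> dirs ?K" using eX by blast
  have we: "w \<bullet> e = 0" using X(1) eX tface_orth by blast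
  have ze: "z \<bullet> e = 0" "z \<bullet> w = 0" using tface_orth[OF eK] tface_orth[OF w(1)] by simp_all
  have "exposed_points X" using X(1) exposed_points_tface expK exposed_points_neg[OF expK] by blast
  then have cX: "csym X" using csym_dim_one X(2) by blast
  have sub: "dirs ?K \<subseteq> dirs F" by (rule dirs_tface_subset)
  have "(X \<doteq> tface (tface F z) w) \<noteq> (X \<doteq> tface (tface G z) w)"
    using X(1)
  proof
    assume "X = tface ?K w"
    then show ?thesis using w(4) translate_of_cong[OF Gw] by simp
  next
    assume "X = tface (neg ?K) w"
    then show ?thesis using w(4) Gw translate_of_sym by blast
  qed
  then have "bad e"
    by (intro badI[OF _ e(1,2) cX z ze(1) _ w0 we ze(2)]) (use eK w(1) sub in blast)+
  moreover have "e \<notin> span {e'}" if e': "e' \<in> dirs ?K" and w': "w' \<in> dirs ?K" "w' \<noteq> 0" "w' \<bullet> e' = 0" "w \<notin> span {w'}" for e' w'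
  proof
    assume "e \<in> span {e'}"
    then obtain k where k: "e = k *\<^sub>R e'" by (auto simp: span_singleton)
    then have "k \<noteq> 0" "e' \<noteq> 0" using e(1) by auto
    then have "w \<bullet> e' = 0" using we k by simp
    then have "w \<in> span {w'}" using plane[of e' w' w] dK e' \<open>e' \<noteq> 0\<close> w' w(1) by simp
    then show False using w'(4) by blast
  qed
  ultimately show ?thesis using eK e1(1) e2(1) w1 w2 w(2,3) by blast
qed

lemma bad_at:
  assumes e: "bad e" and z: "z \<in> dirs F" "z \<noteq> 0" "z \<bullet> e = 0"
  shows "\<not> tface F z \<doteq> tface G z" "e \<in> dirs (tface F z) \<or> e \<in> dirs (tface G z)"
    "\<exists>w X. w \<in> dirs F \<and> w \<noteq> 0 \<and> z \<bullet> w = 0 \<and> dirs X = span {e} \<and>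
      (X \<doteq> tface (tface F z) w \<or> X \<doteq> tface (tface G z) w)"
proof -
  have e0: "e \<in> dirs F" "e \<noteq> 0" using e by (simp_all add: bad_def)
  obtain X where X: "dirs X = span {e}" "unbalanced e X" using e unfolding bad_def by blast
  have "card {z, e} \<le> 2" by (simp add: card_insert_if)
  then have "dim {z, e} < dim (dirs F)" using dim_le_card'[of "{z, e}"] dim3 by (simp add: ddim_def)
  then obtain w where w: "w \<in> dirs F" "w \<noteq> 0" "\<And>x. x \<in> {z, e} \<Longrightarrow> w \<bullet> x = 0"
    using orth_exists[of "dirs F" "{z, e}"] z e0 by auto
  have zw: "z \<bullet> w = 0" "w \<bullet> e = 0" using w(3)[of z] w(3)[of e] inner_commute[of w z] by simp_all
  have Q: "(X \<doteq> tface (tface F z) w) \<noteq> (X \<doteq> tface (tface G z) w)"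
    using X(2) z w(1,2) zw unfolding unbalanced_def by blast
  show "\<not> tface F z \<doteq> tface G z"
  proof
    assume "tface F z \<doteq> tface G z"
    then have "tface (tface F z) w \<doteq> tface (tface G z) w" by (rule translate_of_tface)
    then show False using Q translate_of_cong by blast
  qed
  have "X \<doteq> tface (tface F z) w \<or> X \<doteq> tface (tface G z) w" using Q by blast
  then show "\<exists>w X. w \<in> dirs F \<and> w \<noteq> 0 \<and> z \<bullet> w = 0 \<and> dirs X = span {e} \<and>
      (X \<doteq> tface (tface F z) w \<or> X \<doteq> tface (tface G z) w)"
    using w(1,2) zw(1) X(1) by blast
  have "e \<in> dirs X" using X(1) by (simp add: span_base)
  then show "e \<in> dirs (tface F z) \<or> e \<in> dirs (tface G z)"
    using Q translate_of_dirs[of X "tface (tface F z) w"] translate_of_dirs[of X "tface (tface G z) w"]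
      dirs_tface_subset[of "tface F z" w] dirs_tface_subset[of "tface G z" w]
    by blast
qed

text \<open>A \<open>z\<close> orthogonal to both lines sees both directions. Without a
  two-dimensional face at \<open>z\<close>, the sets \<open>F\<close> and \<open>G\<close> would
  have nonparallel edges there, which \<open>no_saddle\<close> forbids. So a projective line through
  two bad points comes from a facet on which \<open>F\<close> and \<open>G\<close> disagree.\<close>

lemma bad_cross:
  assumes e1: "bad e1" and e2: "bad e2" and ind: "e1 \<notin> span {e2}"
  shows "\<exists>z\<in>dirs F. z \<noteq> 0 \<and> ddim (tface F z) = 2 \<and> \<not> tface F z \<doteq> tface G z \<and>
    e1 \<in> dirs (tface F z) \<and> e2 \<in> dirs (tface F z)"
proof -
  have eF: "e1 \<in> dirs F" "e2 \<in> dirs F" "e1 \<noteq> 0" "e2 \<noteq> 0" using e1 e2 by (simp_all add: bad_def)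
  have "card {e1, e2} \<le> 2" by (simp add: card_insert_if)
  then have "dim {e1, e2} < dim (dirs F)" using dim_le_card'[of "{e1, e2}"] dim3 by (simp add: ddim_def)
  then obtain z where z: "z \<in> dirs F" "z \<noteq> 0" "\<And>x. x \<in> {e1, e2} \<Longrightarrow> z \<bullet> x = 0"
    using orth_exists[of "dirs F" "{e1, e2}"] eF by auto
  have ze: "z \<bullet> e1 = 0" "z \<bullet> e2 = 0" using z(3) by simp_all
  note b1 = bad_at[OF e1 z(1,2) ze(1)] and b2 = bad_at[OF e2 z(1,2) ze(2)]
  have facet: "ddim (tface F z) = 2 \<or> ddim (tface G z) = 2"
  proof (rule ccontr)
    assume no: "\<not> ?thesis"
    then have le: "ddim (tface F z) \<le> 1" "ddim (tface G z) \<le> 1" using ddim_faces[OF z(1,2)] by linarith+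
    have nb: "\<not> (e1 \<in> dirs A \<and> e2 \<in> dirs A)" if "ddim A \<le> 1" for A
      using two_dims[of e1 A e2] eF ind that by linarith
    have "dirs (tface F z) \<noteq> dirs (tface G z)" using b1(2) b2(2) nb[OF le(1)] by auto
    moreover have "ddim (tface F z) = 1 \<and> ddim (tface G z) = 1"
    proof -
      have "ddim A \<noteq> 0" if "e \<in> dirs A" "e \<noteq> 0" for A and e :: 'a
        using that by (auto simp: ddim_def)
      then have "ddim (tface F z) \<noteq> 0" "ddim (tface G z) \<noteq> 0"
        using b1(2) b2(2) nb[OF le(1)] nb[OF le(2)] eF by metis+
      then show ?thesis using le by linarith
    qed
    ultimately show False using no_saddle[OF z(1,2)] by blast
  qed
  show ?thesis using facet_dirs[OF z(1,2) facet] b1 b2 z(1,2) by auto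
qed

text \<open>The edge cannot persist through a half turn starting at \<open>z\<close>; where it is
  left, the face must be larger than an edge, hence two-dimensional.\<close>

lemma bad_other_facet:
  assumes e: "bad e" and z: "z \<in> dirs F" "z \<noteq> 0" "z \<bullet> e = 0"
  shows "\<exists>p\<in>dirs F. p \<noteq> 0 \<and> p \<notin> span {z} \<and> ddim (tface F p) = 2 \<and> \<not> tface F p \<doteq> tface G p \<and>
    e \<in> dirs (tface F p)"
proof -
  have e0: "e \<in> dirs F" "e \<noteq> 0" using e by (simp_all add: bad_def)
  obtain w X where w: "w \<in> dirs F" "w \<noteq> 0" "z \<bullet> w = 0" and X: "dirs X = span {e}"
    and XFG: "X \<doteq> tface (tface F z) w \<or> X \<doteq> tface (tface G z) w"
    using bad_at(3)[OF e z] by blast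
  have key: "\<exists>p\<in>dirs F. p \<noteq> 0 \<and> p \<notin> span {z} \<and> ddim (tface H p) = 2 \<and> e \<in> dirs (tface H p)"
    if H: "H = F \<or> H = G" and XH: "X \<doteq> tface (tface H z) w" for H
  proof -
    let ?A = "tface (tface H z) w"
    have finH: "finite H" "H \<noteq> {}" "z \<in> dirs H" using H fin z dirs_eq by auto
    obtain p r where p: "p \<in> span {z, w}" "p \<notin> span {z}"
      and r: "tface (tface H p) r = ?A" "tface (tface H p) (- r) \<noteq> ?A"
      using exists_break[OF finH z(2) w(2,3)] by blast
    have p0: "p \<noteq> 0" using p(2) span_zero by blast
    have "span {z, w} \<subseteq> dirs F" by (intro span_minimal) (use z w in simp_all)
    then have pF: "p \<in> dirs F" using p(1) by blast
    have dA: "dirs ?A = span {e}" using translate_of_dirs[OF XH] X by simp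
    then have d1: "ddim ?A = 1" using e0(2) by (simp add: ddim_def)
    have "\<not> ddim (tface H p) \<le> ddim (tface (tface H p) r)" using tface_flat[of "tface H p" r] r by auto
    then have "2 \<le> ddim (tface H p)" using r(1) d1 by simp
    moreover have "ddim (tface H p) \<le> 2" using ddim_faces[OF pF p0] H by auto
    moreover have "e \<in> dirs (tface H p)" using dA dirs_tface_subset[of "tface H p" r] r(1) by (auto simp: span_base)
    ultimately show ?thesis using pF p0 p(2) by auto
  qed
  have "\<exists>p\<in>dirs F. p \<noteq> 0 \<and> p \<notin> span {z} \<and> ((ddim (tface F p) = 2 \<and> e \<in> dirs (tface F p)) \<or>
      (ddim (tface G p) = 2 \<and> e \<in> dirs (tface G p)))"
    using XFG key[of F] key[of G] by blast
  then obtain p where p: "p \<in> dirs F" "p \<noteq> 0" "p \<notin> span {z}"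
    and c: "(ddim (tface F p) = 2 \<and> e \<in> dirs (tface F p)) \<or> (ddim (tface G p) = 2 \<and> e \<in> dirs (tface G p))"
    by blast
  have f: "ddim (tface F p) = 2" "dirs (tface G p) = dirs (tface F p)" using facet_dirs[OF p(1,2)] c by blast+
  then have eK: "e \<in> dirs (tface F p)" using c by auto
  then have "p \<bullet> e = 0" by (rule tface_orth)
  then show ?thesis using bad_at(1)[OF e p(1,2)] p f(1) eK by blast
qed

section \<open>The finite configuration of bad directions\<close>

lemma finite_differences:
  "finite ({x - y |x y. x \<in> F \<and> y \<in> F} \<union> {x - y |x y. x \<in> G \<and> y \<in> G} - {0})"
proof -
  have "finite {x - y |x y. x \<in> A \<and> y \<in> A}" if "finite A" for A :: "'a set"
    using finite_image_set2[of "\<lambda>x. x \<in> A" "\<lambda>y. y \<in> A" "\<lambda>x y. x - y"] that by simp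
  then show ?thesis using fin by blast
qed

text \<open>Each bad line is spanned by a difference of two points of \<open>F\<close> or of
  \<open>G\<close>, and normalising by \<open>f\<close> picks one representative per line.\<close>

lemma finite_bad:
  assumes f: "\<forall>b\<in>{x - y |x y. x \<in> F \<and> y \<in> F} \<union> {x - y |x y. x \<in> G \<and> y \<in> G} - {0}. f \<bullet> b \<noteq> 0"
  shows "finite {e. bad e \<and> f \<bullet> e = 1}" "\<And>e. bad e \<Longrightarrow> f \<bullet> e \<noteq> 0"
proof -
  let ?D = "{x - y |x y. x \<in> F \<and> y \<in> F} \<union> {x - y |x y. x \<in> G \<and> y \<in> G} - {0}"
  note finD = finite_differences
  have rep: "\<exists>k d. d \<in> ?D \<and> k \<noteq> 0 \<and> d = k *\<^sub>R e" if e: "bad e" for e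
  proof -
    have e0: "e \<in> dirs F" "e \<noteq> 0" using e by (simp_all add: bad_def)
    have "dim {e} < dim (dirs F)" using dim3 e0 by (simp add: ddim_def)
    then obtain z where z: "z \<in> dirs F" "z \<noteq> 0" "z \<bullet> e = 0" using orth_exists[of "dirs F" "{e}"] e0 by auto
    obtain w X where X: "dirs X = span {e}"
      and XFG: "X \<doteq> tface (tface F z) w \<or> X \<doteq> tface (tface G z) w"
      using bad_at(3)[OF e z] by blast
    then obtain H where H: "H = F \<or> H = G" "X \<doteq> tface (tface H z) w" by blast
    have "dirs (tface (tface H z) w) = span {e}" using translate_of_dirs[OF H(2)] X by simp
    then obtain x y k where xy: "x \<in> tface (tface H z) w" "y \<in> tface (tface H z) w" "k \<noteq> 0" "x - y = k *\<^sub>R e"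
      by (rule ddim_one_points[OF _ e0(2)])
    have "x \<in> H" "y \<in> H" using xy(1,2) tface_subset by blast+
    then have "x - y \<in> {x - y |x y. x \<in> F \<and> y \<in> F} \<union> {x - y |x y. x \<in> G \<and> y \<in> G}" using H(1) by blast
    moreover have "x - y \<noteq> 0" using xy(3,4) e0(2) by simp
    ultimately show ?thesis using xy(3,4) by blast
  qed
  show ne: "f \<bullet> e \<noteq> 0" if e: "bad e" for e
  proof -
    obtain k d where kd: "d \<in> ?D" "k \<noteq> 0" "d = k *\<^sub>R e" using rep[OF e] by (elim exE conjE) (rule that)
    have "f \<bullet> d \<noteq> 0" by (rule bspec[OF f kd(1)])
    then show ?thesis using kd(3) by auto
  qed
  have "{e. bad e \<and> f \<bullet> e = 1} \<subseteq> (\<lambda>d. inverse (f \<bullet> d) *\<^sub>R d) ` ?D"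
  proof
    fix e assume "e \<in> {e. bad e \<and> f \<bullet> e = 1}"
    then have e: "bad e" "f \<bullet> e = 1" by simp_all
    obtain k d where kd: "d \<in> ?D" "k \<noteq> 0" "d = k *\<^sub>R e" using rep[OF e(1)] by (elim exE conjE) (rule that)
    have "inverse (f \<bullet> d) *\<^sub>R d = e" using kd(2,3) e(2) by simp
    then show "e \<in> (\<lambda>d. inverse (f \<bullet> d) *\<^sub>R d) ` ?D" by (rule rev_image_eqI[OF kd(1) sym])
  qed
  then show "finite {e. bad e \<and> f \<bullet> e = 1}" by (rule finite_subset[OF _ finite_imageI[OF finD]])
qed

lemma bad_coplanar:
  assumes pq: "bad p" "bad q" "p \<notin> span {q}" and e: "bad e"
  shows "e \<in> span {p, q}"
proof -
  let ?D = "{x - y |x y. x \<in> F \<and> y \<in> F} \<union> {x - y |x y. x \<in> G \<and> y \<in> G} - {0}"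
  have "0 \<notin> ?D" by simp
  from exists_nonorthogonal[OF finite_differences this]
  obtain f where f: "\<forall>b\<in>?D. f \<bullet> b \<noteq> 0" by (elim exE) (rule that)
  let ?S = "{e. bad e \<and> f \<bullet> e = 1}"
  note finS = finite_bad(1)[OF f] and ne = finite_bad(2)[OF f]
  have par: "a = b" if ab: "a \<in> span {b}" "f \<bullet> a = 1" "f \<bullet> b = 1" for a b
  proof -
    obtain k where "a = k *\<^sub>R b" using ab(1) by (auto simp: span_singleton)
    then show ?thesis using ab(2,3) by simp
  qed
  have unit: "\<exists>c. c \<noteq> 0 \<and> c *\<^sub>R a \<in> ?S" if "bad a" for a
    using bad_scale[OF that, of "inverse (f \<bullet> a)"] ne[OF that] by (intro exI[of _ "inverse (f \<bullet> a)"]) simp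
  have third: "\<exists>r\<in>?S. r \<noteq> a \<and> r \<noteq> b \<and> (\<exists>t. r = a + t *\<^sub>R (b - a))"
    if ab: "a \<in> ?S" "b \<in> ?S" "a \<noteq> b" for a b
  proof -
    have ind: "a \<notin> span {b}" "b \<notin> span {a}" using par ab by blast+
    obtain z where z: "z \<in> dirs F" "z \<noteq> 0" "ddim (tface F z) = 2" "\<not> tface F z \<doteq> tface G z"
      "a \<in> dirs (tface F z)" "b \<in> dirs (tface F z)"
      using bad_cross[of a b] ab ind by blast
    obtain g where g: "bad g" "g \<in> dirs (tface F z)" "g \<notin> span {a}" "g \<notin> span {b}"
      using bad_third[OF z(1-4) z(5) ind(1) z(6) ind(2)] by blast
    obtain c where c: "c \<noteq> 0" "c *\<^sub>R g \<in> ?S" using unit[OF g(1)] by blast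
    have b0: "b \<noteq> 0" using ab(2) by (auto simp: bad_def)
    have "dirs (tface F z) = span {a, b}"
      using z ind(1) b0 by (intro span_pair_eq) (simp_all add: ddim_def)
    then have "c *\<^sub>R g \<in> span {a, b}" using g(2) span_scale by blast
    then obtain k where "c *\<^sub>R g - k *\<^sub>R a \<in> span {b}" using span_breakdown_eq[of "c *\<^sub>R g" a "{b}"] by blast
    then obtain l where kl: "c *\<^sub>R g - k *\<^sub>R a = l *\<^sub>R b" by (auto simp: span_singleton)
    then have "f \<bullet> (c *\<^sub>R g - k *\<^sub>R a) = f \<bullet> (l *\<^sub>R b)" by simp
    \<comment> \<open>\<open>f\<close> is 1 on \<open>a\<close>, \<open>b\<close> and the rescaled
      \<open>g\<close>, so the coefficients sum to 1 and the new point lies on the line through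
      \<open>a\<close> and \<open>b\<close>.\<close>
    then have "1 - k = l" using ab c(2) by (simp add: inner_diff_right)
    then have k: "k = 1 - l" by simp
    have "c *\<^sub>R g = l *\<^sub>R b + k *\<^sub>R a" by (metis kl diff_add_cancel)
    then have "c *\<^sub>R g = a + l *\<^sub>R (b - a)" unfolding k by (simp add: algebra_simps)
    moreover have "c *\<^sub>R g \<noteq> h" if h: "g \<notin> span {h}" for h
    proof
      assume "c *\<^sub>R g = h"
      then have "g = inverse c *\<^sub>R h" using c(1) by auto
      then show False using h span_scale[OF span_base[of h "{h}"]] by (metis singletonI)
    qed
    ultimately show ?thesis using c(2) g(3,4) by blast
  qed
  obtain cp where cp: "cp \<noteq> 0" "cp *\<^sub>R p \<in> ?S" using unit[OF pq(1)] by blast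
  obtain cq where cq: "cq \<noteq> 0" "cq *\<^sub>R q \<in> ?S" using unit[OF pq(2)] by blast
  obtain ce where ce: "ce \<noteq> 0" "ce *\<^sub>R e \<in> ?S" using unit[OF e] by blast
  have "cp *\<^sub>R p \<noteq> cq *\<^sub>R q"
  proof
    assume "cp *\<^sub>R p = cq *\<^sub>R q"
    then have "p = (inverse cp * cq) *\<^sub>R q" using cp(1) by (metis left_inverse scaleR_one scaleR_scaleR)
    then show False using pq(3) span_scale[OF span_base[of q "{q}"]] by (metis singletonI)
  qed
  then obtain t where t: "ce *\<^sub>R e = cp *\<^sub>R p + t *\<^sub>R (cq *\<^sub>R q - cp *\<^sub>R p)"
    using sylvester_gallai[OF finS third cp(2) cq(2) _ ce(2)] by blast
  have "cp *\<^sub>R p + t *\<^sub>R (cq *\<^sub>R q - cp *\<^sub>R p) \<in> span {p, q}"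
    by (intro span_add span_scale span_diff) (simp_all add: span_base)
  then have "inverse ce *\<^sub>R (ce *\<^sub>R e) \<in> span {p, q}" unfolding t[symmetric] by (rule span_scale)
  then show ?thesis using ce(1) by simp
qed

text \<open>Two bad directions \<open>e1\<close>, \<open>e2\<close> span \<open>?K\<close>; a second
  facet through \<open>e1\<close> contains another bad direction \<open>e3\<close>. Coplanarity
  makes the two facets parallel, although their normals \<open>z\<close> and \<open>p\<close> are
  not.\<close>

lemma facets_translates:
  assumes z: "z \<in> dirs F" "z \<noteq> 0" and facet: "ddim (tface F z) = 2"
  shows "tface F z \<doteq> tface G z"
proof (rule ccontr)
  assume ng: "\<not> tface F z \<doteq> tface G z"
  let ?K = "tface F z"
  have two: "2 \<le> ddim ?K" using facet by simp
  have "\<not> dirs ?K \<subseteq> {0}"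
  proof
    assume "dirs ?K \<subseteq> {0}"
    then have "ddim ?K = 0" by (simp add: ddim_def)
    then show False using facet by simp
  qed
  then obtain a where a: "a \<in> dirs ?K" "a \<noteq> 0" by blast
  obtain b where b: "b \<in> dirs ?K" "b \<notin> span {a}" "a \<notin> span {b}"
    using independent_exists[OF two a] by blast
  obtain e1 where e1: "bad e1" "e1 \<in> dirs ?K"
    using bad_third[OF z facet ng a(1) b(3) b(1,2)] by blast
  have e10: "e1 \<noteq> 0" using e1(1) by (simp add: bad_def)
  obtain b' where b': "b' \<in> dirs ?K" "b' \<notin> span {e1}" "e1 \<notin> span {b'}"
    using independent_exists[OF two e1(2) e10] by blast
  obtain e2 where e2: "bad e2" "e2 \<in> dirs ?K" "e2 \<notin> span {e1}"
    using bad_third[OF z facet ng e1(2) b'(3) b'(1,2)] by blast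
  have K: "dirs ?K = span {e2, e1}"
    using facet e1(2) e2(2,3) e10 by (intro span_pair_eq) (simp_all add: ddim_def)
  obtain p where p: "p \<in> dirs F" "p \<noteq> 0" "p \<notin> span {z}" "ddim (tface F p) = 2"
    "\<not> tface F p \<doteq> tface G p" "e1 \<in> dirs (tface F p)"
    using bad_other_facet[OF e1(1) z tface_orth[OF e1(2)]] by blast
  obtain b'' where b'': "b'' \<in> dirs (tface F p)" "b'' \<notin> span {e1}" "e1 \<notin> span {b''}"
    using independent_exists[OF _ p(6) e10] p(4) by (metis order_refl)
  obtain e3 where e3: "bad e3" "e3 \<in> dirs (tface F p)" "e3 \<notin> span {e1}"
    using bad_third[OF p(1,2,4,5) p(6) b''(3) b''(1,2)] by blast
  have "e3 \<in> dirs ?K" unfolding K using bad_coplanar[OF e2(1) e1(1) e2(3) e3(1)] .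
  then have "dirs ?K = span {e3, e1}"
    using facet e1(2) e3(3) e10 by (intro span_pair_eq) (simp_all add: ddim_def)
  moreover have "dirs (tface F p) = span {e3, e1}"
    using p(4,6) e3(2,3) e10 by (intro span_pair_eq) (simp_all add: ddim_def)
  ultimately have same: "dirs ?K = dirs (tface F p)" by simp
  \<comment> \<open>The part of \<open>p\<close> orthogonal to \<open>z\<close> lies in the common
    direction space, to which \<open>p\<close> is orthogonal too, so it vanishes.\<close>
  define x where "x = p - ((z \<bullet> p) / (z \<bullet> z)) *\<^sub>R z"
  have zx: "z \<bullet> x = 0" using z(2) by (simp add: x_def inner_diff_right)
  have xF: "x \<in> dirs F" using z(1) p(1) by (simp add: x_def subspace_diff subspace_scale)
  have "x \<in> dirs ?K" by (rule dirs_facet[OF z _ xF zx]) (simp add: facet dim3)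
  then have px: "p \<bullet> x = 0" using same tface_orth by blast
  have "x \<bullet> x = p \<bullet> x - ((z \<bullet> p) / (z \<bullet> z)) * (z \<bullet> x)" by (subst x_def) (simp add: inner_diff_left)
  then have "x = 0" using zx px by simp
  then have "p = ((z \<bullet> p) / (z \<bullet> z)) *\<^sub>R z" by (simp add: x_def)
  then show False using p(3) span_scale[OF span_base[of z "{z}"]] by (metis singletonI)
qed

end

lemma csym_dim_four:
  fixes V :: "'a::euclidean_space set"
  assumes V: "exposed_points V" "facets_csym_or_opposite V" and d: "ddim V = 4"
  shows "csym V"
proof (rule csym_if_ridges_csym[OF V])
  show "3 \<le> ddim V" using d by simp
  fix v z
  let ?F = "tface V v" and ?G = "tface (neg V) v"
  assume v: "v \<in> dirs V" "v \<noteq> 0" and facet: "Suc (ddim ?F) = ddim V" and bad: "\<not> ?F \<doteq> ?G"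
    and pair: "csym_pair ?F ?G" and z: "z \<in> dirs ?F" "z \<noteq> 0" and ridge: "Suc (ddim (tface ?F z)) = ddim ?F"
    and ng: "\<not> tface ?F z \<doteq> tface ?G z"
  have fin: "finite V" "finite (neg V)" using V by (auto simp: exposed_points_def)
  have "csym_pair_3 ?F ?G"
  proof
    show "csym_pair ?F ?G" by (rule pair)
    show "exposed_points ?F" "exposed_points ?G"
      using V exposed_points_tface exposed_points_neg by blast+
    show "ddim ?F = 3" using facet d by simp
    fix y assume y: "y \<in> dirs ?F" "y \<noteq> 0" and d1: "ddim (tface ?F y) = 1" "ddim (tface ?G y) = 1"
    obtain e where e: "e > 0" "\<forall>t. 0 < t \<and> t < e \<longrightarrow>
      tface V (v + t *\<^sub>R y) = tface ?F y \<and> tface (neg V) (v + t *\<^sub>R y) = tface ?G y"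
      using tface_tface_eq2[OF fin, of v y] by blast
    define u where "u = v + (e / 2) *\<^sub>R y"
    have uF: "tface V u = tface ?F y" "tface (neg V) u = tface ?G y"
      using e(1) e(2)[rule_format, of "e / 2"] by (simp_all add: u_def)
    have "y \<in> dirs V" using y(1) dirs_tface_subset by blast
    then have uV: "u \<in> dirs V" using v by (simp add: u_def subspace_add subspace_scale)
    have "v \<bullet> u = v \<bullet> v" using tface_orth[OF y(1)] by (simp add: u_def inner_add_right)
    then have "u \<noteq> 0" using v(2) by auto
    from no_saddle[OF V d uV this] show "dirs (tface ?F y) = dirs (tface ?G y)"
      using uF d1 by simp
  qed
  moreover have "ddim (tface ?F z) = 2" using facet ridge d by simp
  ultimately have "tface ?F z \<doteq> tface ?G z" by (rule csym_pair_3.facets_translates[OF _ z])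
  \<comment> \<open>No disagreeing ridge exists, so the demand is met vacuously.\<close>
  then show "csym (tface ?F z)" using ng by blast
qed

lemma csym_if_facets:
  fixes V :: "'a::euclidean_space set"
  assumes "exposed_points V" "facets_csym_or_opposite V" "ddim V = 1 \<or> 3 \<le> ddim V"
  shows "csym V"
  using assms
proof (induction "ddim V" arbitrary: V rule: less_induct)
  case less
  consider "ddim V = 1" | "ddim V = 4" | "ddim V = 3 \<or> 5 \<le> ddim V" using less.prems(3) by linarith
  then show ?case
  proof cases
    case 1 then show ?thesis using csym_dim_one less.prems(1) by blast
  next
    case 2 then show ?thesis using csym_dim_four less.prems(1,2) by blast
  next
    case 3
    show ?thesis
    proof (rule csym_if_ridges_csym[OF less.prems(1,2)])
      show "3 \<le> ddim V" using 3 by linarith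
      fix v z
      let ?F = "tface V v"
      assume facet: "Suc (ddim ?F) = ddim V" and pair: "csym_pair ?F (tface (neg V) v)"
        and z: "z \<in> dirs ?F" "z \<noteq> 0" "Suc (ddim (tface ?F z)) = ddim ?F"
          "\<not> tface ?F z \<doteq> tface (tface (neg V) v) z"
      show "csym (tface ?F z)"
      proof (rule less.hyps)
        show "ddim (tface ?F z) < ddim V" using facet z(3) by simp
        show "exposed_points (tface ?F z)" using less.prems(1) exposed_points_tface by blast
        show "facets_csym_or_opposite (tface ?F z)" by (rule csym_pair_facet[OF pair z])
        \<comment> \<open>Descending by two from 3 or from at least 5 never reaches dimension
          2.\<close>
        show "ddim (tface ?F z) = 1 \<or> 3 \<le> ddim (tface ?F z)" using 3 facet z(3) by linarith
      qed
    qed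
  qed
qed

section \<open>Polytopes\<close>

lemma aff_dim_eq_ddim:
  fixes A :: "'a::euclidean_space set"
  assumes "A \<noteq> {}" shows "aff_dim A = int (ddim A)"
proof -
  obtain a where a: "a \<in> A" using assms by blast
  have "(\<lambda>x. x - a) ` A \<subseteq> dirs A" using a diff_in_dirs by blast
  then have "span ((\<lambda>x. x - a) ` A) \<subseteq> dirs A" by (intro span_minimal) simp_all
  moreover have "dirs A \<subseteq> span ((\<lambda>x. x - a) ` A)"
    unfolding dirs_def
  proof (rule span_minimal)
    show "{x - y |x y. x \<in> A \<and> y \<in> A} \<subseteq> span ((\<lambda>x. x - a) ` A)"
    proof
      fix d assume "d \<in> {x - y |x y. x \<in> A \<and> y \<in> A}"
      then obtain x y where xy: "x \<in> A" "y \<in> A" "d = (x - a) - (y - a)" by auto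
      show "d \<in> span ((\<lambda>x. x - a) ` A)" unfolding xy(3) using xy(1,2) by (intro span_diff span_base) simp_all
    qed
  qed simp
  ultimately have "span ((\<lambda>x. x - a) ` A) = dirs A" by blast
  then have "dim ((\<lambda>x. x - a) ` A) = ddim A" unfolding ddim_def by (metis dim_span)
  moreover have "a \<in> affine hull A" using a by (rule hull_inc)
  ultimately show ?thesis using aff_dim_eq_dim_subtract[of a A] by simp
qed

lemma extreme_point_of_reflection:
  fixes S :: "'a::euclidean_space set"
  assumes S: "S = {2 *\<^sub>R c - x | x. x \<in> S}" and x: "x extreme_point_of S"
  shows "(2 *\<^sub>R c - x) extreme_point_of S"
proof -
  have refl: "2 *\<^sub>R c - y \<in> S" if "y \<in> S" for y using that by (subst S) blast
  have "2 *\<^sub>R c - x \<notin> open_segment a b" if ab: "a \<in> S" "b \<in> S" for a b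
  proof
    assume "2 *\<^sub>R c - x \<in> open_segment a b"
    then obtain t where t: "a \<noteq> b" "0 < t" "t < 1" "2 *\<^sub>R c - x = (1 - t) *\<^sub>R a + t *\<^sub>R b"
      by (auto simp: in_segment)
    have "x = 2 *\<^sub>R c - (2 *\<^sub>R c - x)" by simp
    also have "\<dots> = (1 - t) *\<^sub>R (2 *\<^sub>R c - a) + t *\<^sub>R (2 *\<^sub>R c - b)" unfolding t(4) by (simp add: algebra_simps)
    finally have "x \<in> open_segment (2 *\<^sub>R c - a) (2 *\<^sub>R c - b)" using t(1-3) by (auto simp: in_segment)
    then show False using x refl[OF ab(1)] refl[OF ab(2)] unfolding extreme_point_of_def by blast
  qed
  then show ?thesis using x refl unfolding extreme_point_of_def by blast
qed

lemma csym_extreme_points: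
  fixes S :: "'a::euclidean_space set"
  assumes "centrally_symmetric S" shows "csym {x. x extreme_point_of S}"
proof -
  obtain c where c: "S = {2 *\<^sub>R c - x | x. x \<in> S}" using assms by (auto simp: centrally_symmetric_def)
  let ?E = "{x. x extreme_point_of S}"
  have refl: "2 *\<^sub>R c - x \<in> ?E" if "x \<in> ?E" for x using extreme_point_of_reflection[OF c] that by simp
  have "neg ?E = (+) (- (2 *\<^sub>R c)) ` ?E"
  proof
    show "neg ?E \<subseteq> (+) (- (2 *\<^sub>R c)) ` ?E"
    proof
      fix y assume "y \<in> neg ?E"
      then have "2 *\<^sub>R c - (- y) \<in> ?E" using refl[of "- y"] by auto
      then show "y \<in> (+) (- (2 *\<^sub>R c)) ` ?E" by (rule rev_image_eqI) simp
    qed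
    show "(+) (- (2 *\<^sub>R c)) ` ?E \<subseteq> neg ?E"
    proof
      fix y assume "y \<in> (+) (- (2 *\<^sub>R c)) ` ?E"
      then obtain x where x: "x \<in> ?E" "y = - (2 *\<^sub>R c) + x" by blast
      from refl[OF x(1)] show "y \<in> neg ?E" by (rule rev_image_eqI) (simp add: x(2))
    qed
  qed
  then show ?thesis unfolding csym_def translate_of_def by blast
qed

lemma centrally_symmetric_convex_hull:
  fixes V :: "'a::euclidean_space set"
  assumes "csym V" shows "centrally_symmetric (convex hull V)"
proof -
  obtain t where t: "neg V = (+) t ` V" using assms by (auto simp: csym_def translate_of_def)
  \<comment> \<open>From \<open>- V = t + V\<close> follows \<open>V = - t - V\<close>, a reflection
    in the point \<open>- t / 2\<close>.\<close>
  define c where "c = - (1 / 2) *\<^sub>R t"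
  have "V = neg (neg V)" by simp
  also have "\<dots> = (\<lambda>x. 2 *\<^sub>R c + (- 1) *\<^sub>R x) ` V" unfolding t image_image by (simp add: c_def)
  finally have "convex hull V = (\<lambda>x. 2 *\<^sub>R c + (- 1) *\<^sub>R x) ` (convex hull V)"
    by (metis convex_hull_affinity)
  also have "\<dots> = {2 *\<^sub>R c - x |x. x \<in> convex hull V}" by auto
  finally show ?thesis unfolding centrally_symmetric_def by blast
qed

text \<open>Faces of a polyhedron are exposed, so a hyperplane touching \<open>P\<close> at one
  vertex only supplies the direction.\<close>

lemma exposed_points_extreme:
  fixes P :: "'a::euclidean_space set"
  assumes P: "polytope P" "P \<noteq> {}"
  shows "exposed_points {x. x extreme_point_of P}" "P = convex hull {x. x extreme_point_of P}"
proof -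
  let ?V = "{x. x extreme_point_of P}"
  have ph: "polyhedron P" using P(1) by (rule polytope_imp_polyhedron)
  show hull: "P = convex hull ?V"
    by (rule Krein_Milman_Minkowski) (use P(1) in \<open>simp_all add: polytope_imp_compact polytope_imp_convex\<close>)
  have "\<exists>u. tface ?V u = {x}" if x: "x extreme_point_of P" for x
  proof -
    have "{x} exposed_face_of P" using x by (simp add: exposed_face_of_polyhedron[OF ph] face_of_singleton)
    then obtain a b where ab: "P \<subseteq> {y. a \<bullet> y \<le> b}" "{x} = P \<inter> {y. a \<bullet> y = b}"
      by (auto simp: exposed_face_of_def)
    have VP: "?V \<subseteq> P" by (auto simp: extreme_point_of_def)
    have "a \<bullet> x = b" using ab(2) by blast
    then have "x \<in> tface ?V a" using x ab(1) VP by (auto simp: tface_def)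
    moreover have "y = x" if y: "y \<in> tface ?V a" for y
    proof -
      have "a \<bullet> x \<le> a \<bullet> y" using y x by (simp add: tface_def)
      moreover have "y \<in> P" using y VP tface_subset by blast
      ultimately have "y \<in> P \<inter> {y. a \<bullet> y = b}" using ab(1) \<open>a \<bullet> x = b\<close> by auto
      then show ?thesis using ab(2) by blast
    qed
    ultimately show ?thesis by blast
  qed
  moreover have "?V \<noteq> {}" using hull P(2) by (metis convex_hull_empty)
  ultimately show "exposed_points ?V"
    using finite_polyhedron_extreme_points[OF ph] by (simp add: exposed_points_def)
qed

text \<open>The supporting hyperplane with normal \<open>u\<close> cuts out a face whose extreme
  points are those of \<open>P\<close> lying in it. This links the facets of the polytope with
  maximising vertices.\<close>

lemma tface_extreme_points:
  fixes P :: "'a::euclidean_space set"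
  assumes P: "polytope P" "P \<noteq> {}"
  obtains F where "F face_of P" "{x. x extreme_point_of F} = tface {x. x extreme_point_of P} u"
    "F \<noteq> {}" "aff_dim F = int (ddim (tface {x. x extreme_point_of P} u))"
proof -
  let ?V = "{x. x extreme_point_of P}"
  have V: "finite ?V" "?V \<noteq> {}" using exposed_points_extreme(1)[OF P] by (simp_all add: exposed_points_def)
  note hull = exposed_points_extreme(2)[OF P]
  obtain m where m: "m \<in> tface ?V u" using tface_nonempty[OF V] by blast
  then have "?V \<subseteq> {x. u \<bullet> x \<le> u \<bullet> m}" by (auto simp: tface_def)
  then have "convex hull ?V \<subseteq> {x. u \<bullet> x \<le> u \<bullet> m}" by (rule hull_minimal) (rule convex_halfspace_le)
  then have le: "u \<bullet> x \<le> u \<bullet> m" if "x \<in> P" for x using that hull by blast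
  define F where "F = P \<inter> {x. u \<bullet> x = u \<bullet> m}"
  have F: "F face_of P" unfolding F_def
    by (rule face_of_Int_supporting_hyperplane_le) (use P(1) le in \<open>simp_all add: polytope_imp_convex\<close>)
  have VP: "?V \<subseteq> P" by (auto simp: extreme_point_of_def)
  have "x \<in> tface ?V u \<longleftrightarrow> x extreme_point_of P \<and> x \<in> F" for x
  proof
    assume x: "x \<in> tface ?V u"
    have "u \<bullet> x = u \<bullet> m" using x m by (intro order_antisym) (simp_all add: tface_def)
    then show "x extreme_point_of P \<and> x \<in> F" using x VP by (auto simp: tface_def F_def)
  next
    assume x: "x extreme_point_of P \<and> x \<in> F"
    have "u \<bullet> y \<le> u \<bullet> x" if "y \<in> ?V" for y using le[of y] that VP x by (auto simp: F_def)
    then show "x \<in> tface ?V u" using x by (simp add: tface_def)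
  qed
  then have ext: "{x. x extreme_point_of F} = tface ?V u" using extreme_point_of_face[OF F] by blast
  have pF: "polytope F" using face_of_polytope_polytope[OF P(1) F] .
  have mF: "m \<in> F" using m ext by (auto simp: extreme_point_of_def)
  have "F = convex hull (tface ?V u)" using exposed_points_extreme(2)[OF pF] mF ext by auto
  then have "aff_dim F = aff_dim (tface ?V u)" by (metis aff_dim_convex_hull)
  also have "\<dots> = int (ddim (tface ?V u))" using m by (intro aff_dim_eq_ddim) blast
  finally show thesis using that F ext mF by blast
qed

theorem proposition1p3:
  fixes P :: "'a::euclidean_space set" and n :: nat
  assumes "n > 2"
    and "polytope P"
    and "aff_dim P = int n"
    and "\<And>F. F facet_of P \<Longrightarrow> centrally_symmetric F"
  shows "centrally_symmetric P"
proof -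
  let ?V = "{x. x extreme_point_of P}"
  have P: "polytope P" "P \<noteq> {}" using assms(2,3) by auto
  have exp: "exposed_points ?V" and hull: "P = convex hull ?V" using exposed_points_extreme[OF P] .
  have "aff_dim P = aff_dim ?V" using hull by (metis aff_dim_convex_hull)
  also have "\<dots> = int (ddim ?V)" using exp by (intro aff_dim_eq_ddim) (simp add: exposed_points_def)
  finally have d: "ddim ?V = n" using assms(3) by simp
  \<comment> \<open>At the start the first alternative of the weakened property holds for every
    facet; the second one arises during the descent.\<close>
  have "csym (tface ?V u)" if u: "Suc (ddim (tface ?V u)) = ddim ?V" for u
  proof -
    obtain F where F: "F face_of P" "{x. x extreme_point_of F} = tface ?V u" "F \<noteq> {}"
      "aff_dim F = int (ddim (tface ?V u))"
      by (rule tface_extreme_points[OF P])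
    have "F facet_of P" using F(1,3,4) u d assms(3) by (simp add: facet_of_def)
    then have "csym {x. x extreme_point_of F}" using assms(4) csym_extreme_points by blast
    then show ?thesis using F(2) by simp
  qed
  then have "facets_csym_or_opposite ?V" unfolding facets_csym_or_opposite_def by blast
  then have "csym ?V" using csym_if_facets[OF exp] d assms(1) by simp
  then show ?thesis using centrally_symmetric_convex_hull hull by metis
qed

end
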